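(* Let $\mathcal{A}$ be a finite von Neumann algebra containing no direct summand of type $I_2$, acting in a separable complex Hilbert space, and let $\mathcal{M}\subseteq\mathcal{A}^{pr}$ be an ideal of projections. Then any closed measure $\mu:\mathcal{M}\to[0,+\infty]$ can be extended to a $\sigma$-finite measure; that is, there exists a $\sigma$-finite measure $\mu_1:\mathcal{A}^{pr}\to[0,+\infty]$ with $\mu_1(p)=\mu(p)$ for all $p\in\mathcal{M}$.
   Context: $\mathcal{A}^{pr}$ denotes the set of all orthogonal projections (self-adjoint idempotents) belonging to $\mathcal{A}$, with its usual order and lattice operations; $I$ is the identity operator. The notation $p_n\nearrow I$ means that $p_1\le p_2\le\cdots$ and $\sup_n p_n=I$. A subset $\mathcal{M}\subseteq\mathcal{A}^{pr}$ is an ideal of projections if: (a) $p\le q$ with $p\in\mathcal{A}^{pr}$, $q\in\mathcal{M}$ implies $p\in\mathcal{M}$; (b) $p,q\in\mathcal{M}$ and $\|pq\|<1$ imply $p\vee q\in\mathcal{M}$; (c) $\sup\{p: p\in\mathcal{M}\}=I$. The whole set $\mathcal{A}^{pr}$ is an ideal of projections. Let $\mathcal{M}$ be an ideal of projections. For $p\in\mathcal{A}^{pr}$ put $\mathcal{M}_p:=\{q\in\mathcal{M}: q\le p\}$. A function $\mu:\mathcal{M}\to[0,+\infty]$ is a measure if $\mu(e)=\sum_i\mu(e_i)$ for every $e\in\mathcal{M}$ and every representation $e=\sum_i e_i$ of $e$ as a sum of (mutually orthogonal) projections $e_i\in\mathcal{M}$ (finite or infinite sums, converging in the strong operator topology).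 For a measure $\mu:\mathcal{M}\to[0,+\infty]$, a projection $p\in\mathcal{A}^{pr}$ is a projection of finite $\mu$-measure if $\sup\{q: q\in\mathcal{M}_p\}=p$ (supremum in the projection lattice) and $\sup\{\mu(q):q\in\mathcal{M}_p\}<+\infty$; it is a hereditary projection of finite $\mu$-measure if every $q\in\mathcal{A}^{pr}$ with $q\le p$ is a projection of finite $\mu$-measure. The measure $\mu:\mathcal{M}\to[0,+\infty]$ is: finite if $\mu(p)<\infty$ for all $p\in\mathcal{M}$; closed if $\mu$ is finite and every hereditary projection $p\in\mathcal{A}^{pr}$ of finite $\mu$-measure belongs to $\mathcal{M}$; $\sigma$-finite if $\mathcal{M}=\mathcal{A}^{pr}$ and there exists a sequence $\{p_n\}\subset\mathcal{A}^{pr}$ with $p_n\nearrow I$ and $\mu(p_n)<+\infty$ for all $n$. *)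

theory Defs
  imports "HOL-Analysis.Analysis"
begin

section \<open>Complex Hilbert spaces\<close>

text \<open>The inner product is linear in its first argument.\<close>

class complex_inner = real_normed_vector +
  fixes scaleC :: "complex \<Rightarrow> 'a \<Rightarrow> 'a"
    and cinner :: "'a \<Rightarrow> 'a \<Rightarrow> complex"
  assumes scaleC_add_right: "scaleC c (x + y) = scaleC c x + scaleC c y"
    and scaleC_add_left: "scaleC (c + d) x = scaleC c x + scaleC d x"
    and scaleC_scaleC: "scaleC c (scaleC d x) = scaleC (c * d) x"
    and scaleR_scaleC: "scaleR r x = scaleC (complex_of_real r) x"
    and cinner_commute: "cinner x y = cnj (cinner y x)"
    and cinner_add_left: "cinner (x + y) z = cinner x z + cinner y z"
    and cinner_scaleC_left: "cinner (scaleC c x) y = c * cinner x y"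
    and cinner_ge_zero: "0 \<le> Re (cinner x x)"
    and cinner_eq_zero_iff: "cinner x x = 0 \<longleftrightarrow> x = 0"
    and norm_eq_sqrt_cinner: "norm x = sqrt (Re (cinner x x))"

class complex_hilbert = complex_inner + complete_space

section \<open>Bounded operators\<close>

text \<open>The type of bounded linear functions of the library consists of the real-linear ones;
  the bounded operators of the complex Hilbert space are those that are complex-linear.\<close>

definition bounded_ops :: "('h::complex_hilbert \<Rightarrow>\<^sub>L 'h) set" where
  "bounded_ops = {T :: 'h \<Rightarrow>\<^sub>L 'h. \<forall>c x. T (scaleC c x) = scaleC c (T x)}"

definition is_adjoint :: "('h::complex_hilbert \<Rightarrow>\<^sub>L 'h) \<Rightarrow> ('h \<Rightarrow>\<^sub>L 'h) \<Rightarrow> bool" where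
  "is_adjoint S T \<longleftrightarrow> (\<forall>x y. cinner (T x) y = cinner x (S y))"

definition op_le :: "('h::complex_hilbert \<Rightarrow>\<^sub>L 'h) \<Rightarrow> ('h \<Rightarrow>\<^sub>L 'h) \<Rightarrow> bool" where
  "op_le S T \<longleftrightarrow> (\<forall>x. cinner (blinfun_apply (T - S) x) x \<in> \<real>\<^sub>\<ge>\<^sub>0)"

section \<open>Von Neumann algebras\<close>

definition commutant :: "('h::complex_hilbert \<Rightarrow>\<^sub>L 'h) set \<Rightarrow> ('h \<Rightarrow>\<^sub>L 'h) set" where
  "commutant A = {T \<in> bounded_ops. \<forall>S\<in>A. T o\<^sub>L S = S o\<^sub>L T}"

text \<open>A self-adjoint set of operators that equals its bicommutant; it is then automatically
  a unital *-subalgebra of the algebra of all bounded operators.\<close>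

definition von_neumann_algebra :: "('h::complex_hilbert \<Rightarrow>\<^sub>L 'h) set \<Rightarrow> bool" where
  "von_neumann_algebra A \<longleftrightarrow>
     A \<subseteq> bounded_ops \<and> (\<forall>T\<in>A. \<exists>S\<in>A. is_adjoint S T) \<and> commutant (commutant A) = A"

definition projs :: "('h::complex_hilbert \<Rightarrow>\<^sub>L 'h) set \<Rightarrow> ('h \<Rightarrow>\<^sub>L 'h) set" where
  "projs A = {p \<in> A. is_adjoint p p \<and> p o\<^sub>L p = p}"

definition is_proj_sup ::
  "('h::complex_hilbert \<Rightarrow>\<^sub>L 'h) set \<Rightarrow> ('h \<Rightarrow>\<^sub>L 'h) set \<Rightarrow> ('h \<Rightarrow>\<^sub>L 'h) \<Rightarrow> bool" where
  "is_proj_sup A E p \<longleftrightarrow>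
     p \<in> projs A \<and> (\<forall>q\<in>E. op_le q p) \<and>
     (\<forall>r\<in>projs A. (\<forall>q\<in>E. op_le q r) \<longrightarrow> op_le p r)"

text \<open>Murray--von Neumann equivalence: some \<open>v\<close> in the algebra has \<open>v\<^sup>*v = e\<close> and \<open>vv\<^sup>* = f\<close>.\<close>

definition mvn_equiv ::
  "('h::complex_hilbert \<Rightarrow>\<^sub>L 'h) set \<Rightarrow> ('h \<Rightarrow>\<^sub>L 'h) \<Rightarrow> ('h \<Rightarrow>\<^sub>L 'h) \<Rightarrow> bool" where
  "mvn_equiv A e f \<longleftrightarrow> (\<exists>v\<in>A. \<exists>w\<in>A. is_adjoint w v \<and> w o\<^sub>L v = e \<and> v o\<^sub>L w = f)"

definition finite_proj :: "('h::complex_hilbert \<Rightarrow>\<^sub>L 'h) set \<Rightarrow> ('h \<Rightarrow>\<^sub>L 'h) \<Rightarrow> bool" where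
  "finite_proj A e \<longleftrightarrow>
     e \<in> projs A \<and> (\<forall>f\<in>projs A. mvn_equiv A e f \<and> op_le f e \<longrightarrow> f = e)"

definition finite_algebra :: "('h::complex_hilbert \<Rightarrow>\<^sub>L 'h) set \<Rightarrow> bool" where
  "finite_algebra A \<longleftrightarrow> finite_proj A id_blinfun"

definition abelian_proj :: "('h::complex_hilbert \<Rightarrow>\<^sub>L 'h) set \<Rightarrow> ('h \<Rightarrow>\<^sub>L 'h) \<Rightarrow> bool" where
  "abelian_proj A e \<longleftrightarrow>
     e \<in> projs A \<and>
     (\<forall>S\<in>A. \<forall>T\<in>A. (e o\<^sub>L S o\<^sub>L e) o\<^sub>L (e o\<^sub>L T o\<^sub>L e) = (e o\<^sub>L T o\<^sub>L e) o\<^sub>L (e o\<^sub>L S o\<^sub>L e))"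

text \<open>The unit \<open>u\<close> is an argument because the unit of a direct summand is a central projection
  of the ambient algebra and not the identity operator.\<close>

definition type_I :: "('h::complex_hilbert \<Rightarrow>\<^sub>L 'h) set \<Rightarrow> ('h \<Rightarrow>\<^sub>L 'h) \<Rightarrow> nat \<Rightarrow> bool" where
  "type_I A u n \<longleftrightarrow>
     (\<exists>e. (\<forall>i<n. abelian_proj A (e i)) \<and>
          (\<forall>i<n. \<forall>j<n. mvn_equiv A (e i) (e j)) \<and>
          (\<forall>i<n. \<forall>j<n. i \<noteq> j \<longrightarrow> e i o\<^sub>L e j = 0) \<and>
          (\<Sum>i<n. e i) = u)"

definition central_projs :: "('h::complex_hilbert \<Rightarrow>\<^sub>L 'h) set \<Rightarrow> ('h \<Rightarrow>\<^sub>L 'h) set" where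
  "central_projs A = projs A \<inter> commutant A"

definition direct_summand ::
  "('h::complex_hilbert \<Rightarrow>\<^sub>L 'h) set \<Rightarrow> ('h \<Rightarrow>\<^sub>L 'h) \<Rightarrow> ('h \<Rightarrow>\<^sub>L 'h) set" where
  "direct_summand A z = (\<lambda>T. T o\<^sub>L z) ` A"

definition has_type_I_summand :: "('h::complex_hilbert \<Rightarrow>\<^sub>L 'h) set \<Rightarrow> nat \<Rightarrow> bool" where
  "has_type_I_summand A n \<longleftrightarrow>
     (\<exists>z\<in>central_projs A. z \<noteq> 0 \<and> type_I (direct_summand A z) z n)"

section \<open>Ideals of projections and measures\<close>

definition projection_ideal ::
  "('h::complex_hilbert \<Rightarrow>\<^sub>L 'h) set \<Rightarrow> ('h \<Rightarrow>\<^sub>L 'h) set \<Rightarrow> bool" where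
  "projection_ideal A M \<longleftrightarrow>
     M \<subseteq> projs A \<and>
     (\<forall>p\<in>projs A. \<forall>q\<in>M. op_le p q \<longrightarrow> p \<in> M) \<and>
     (\<forall>p\<in>M. \<forall>q\<in>M. norm (p o\<^sub>L q) < 1 \<longrightarrow> (\<exists>r\<in>M. is_proj_sup A {p, q} r)) \<and>
     is_proj_sup A M id_blinfun"

definition below ::
  "('h::complex_hilbert \<Rightarrow>\<^sub>L 'h) set \<Rightarrow> ('h \<Rightarrow>\<^sub>L 'h) \<Rightarrow> ('h \<Rightarrow>\<^sub>L 'h) set" where
  "below M p = {q \<in> M. op_le q p}"

text \<open>An orthogonal family of projections can repeat only the zero projection, so it suffices to
  consider sets \<open>E\<close> of projections; the empty set gives \<open>\<mu> 0 = 0\<close>. Only the values of \<open>\<mu>\<close>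
  on \<open>M\<close> matter. The sum of the operators converges in the strong operator topology.\<close>

definition proj_measure ::
  "('h::complex_hilbert \<Rightarrow>\<^sub>L 'h) set \<Rightarrow> (('h \<Rightarrow>\<^sub>L 'h) \<Rightarrow> ennreal) \<Rightarrow> bool" where
  "proj_measure M \<mu> \<longleftrightarrow>
     (\<forall>e\<in>M. \<forall>E\<subseteq>M.
        pairwise (\<lambda>p q. p o\<^sub>L q = 0) E \<and> (\<forall>x. ((\<lambda>p. blinfun_apply p x) has_sum blinfun_apply e x) E) \<longrightarrow>
        \<mu> e = (\<Sum>\<^sub>\<infinity>p\<in>E. \<mu> p))"

definition finite_measure_proj ::
  "('h::complex_hilbert \<Rightarrow>\<^sub>L 'h) set \<Rightarrow> ('h \<Rightarrow>\<^sub>L 'h) set \<Rightarrow> (('h \<Rightarrow>\<^sub>L 'h) \<Rightarrow> ennreal)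
     \<Rightarrow> ('h \<Rightarrow>\<^sub>L 'h) \<Rightarrow> bool" where
  "finite_measure_proj A M \<mu> p \<longleftrightarrow>
     p \<in> projs A \<and> is_proj_sup A (below M p) p \<and> (SUP q\<in>below M p. \<mu> q) < \<infinity>"

definition hereditary_finite_measure_proj ::
  "('h::complex_hilbert \<Rightarrow>\<^sub>L 'h) set \<Rightarrow> ('h \<Rightarrow>\<^sub>L 'h) set \<Rightarrow> (('h \<Rightarrow>\<^sub>L 'h) \<Rightarrow> ennreal)
     \<Rightarrow> ('h \<Rightarrow>\<^sub>L 'h) \<Rightarrow> bool" where
  "hereditary_finite_measure_proj A M \<mu> p \<longleftrightarrow>
     p \<in> projs A \<and> (\<forall>q\<in>projs A. op_le q p \<longrightarrow> finite_measure_proj A M \<mu> q)"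

definition finite_proj_measure ::
  "('h::complex_hilbert \<Rightarrow>\<^sub>L 'h) set \<Rightarrow> (('h \<Rightarrow>\<^sub>L 'h) \<Rightarrow> ennreal) \<Rightarrow> bool" where
  "finite_proj_measure M \<mu> \<longleftrightarrow> proj_measure M \<mu> \<and> (\<forall>p\<in>M. \<mu> p < \<infinity>)"

definition closed_proj_measure ::
  "('h::complex_hilbert \<Rightarrow>\<^sub>L 'h) set \<Rightarrow> ('h \<Rightarrow>\<^sub>L 'h) set \<Rightarrow> (('h \<Rightarrow>\<^sub>L 'h) \<Rightarrow> ennreal)
     \<Rightarrow> bool" where
  "closed_proj_measure A M \<mu> \<longleftrightarrow>
     finite_proj_measure M \<mu> \<and>
     (\<forall>p\<in>projs A. hereditary_finite_measure_proj A M \<mu> p \<longrightarrow> p \<in> M)"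

definition sigma_finite_proj_measure ::
  "('h::complex_hilbert \<Rightarrow>\<^sub>L 'h) set \<Rightarrow> ('h \<Rightarrow>\<^sub>L 'h) set \<Rightarrow> (('h \<Rightarrow>\<^sub>L 'h) \<Rightarrow> ennreal)
     \<Rightarrow> bool" where
  "sigma_finite_proj_measure A M \<mu> \<longleftrightarrow>
     proj_measure M \<mu> \<and> M = projs A \<and>
     (\<exists>p :: nat \<Rightarrow> 'h \<Rightarrow>\<^sub>L 'h.
        (\<forall>n. p n \<in> projs A) \<and> (\<forall>n. op_le (p n) (p (Suc n))) \<and>
        is_proj_sup A (range p) id_blinfun \<and> (\<forall>n. \<mu> (p n) < \<infinity>))"

end

theory Submission
  imports Defs
begin

text \<open>
  There is only one candidate for the extension: it equals \<open>\<mu>\<close> on \<open>M\<close> and infinity elsewhere. For if an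
  extension is finite at \<open>e\<close> then it bounds \<open>\<mu>\<close> on all elements of \<open>M\<close> below \<open>e\<close>. Every projection is the
  supremum of the elements of \<open>M\<close> below it (\<open>ideal_is_proj_sup_below\<close>), so \<open>e\<close> is hereditary of finite
  \<open>\<mu>\<close>-measure and belongs to \<open>M\<close> by closedness. Two things need proof. The candidate is countably
  additive, which means that the sum \<open>e\<close> of an orthogonal family in \<open>M\<close> with finite total measure \<open>C\<close>
  lies in \<open>M\<close> (\<open>closed_measure_sum_mem\<close>). And it is \<open>\<sigma>\<close>-finite, which means that some increasing sequence in
  \<open>M\<close> exhausts the identity (\<open>ideal_exhaustion\<close>).

  Both rest on the continuity of the projection lattice of a finite algebra (\<open>meet_continuous\<close>): if
  \<open>q n\<close> increases to \<open>p\<close> and \<open>r\<close> lies below \<open>p\<close>, then the meets of \<open>r\<close> with \<open>q n\<close> increase to \<open>r\<close>. For the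
  first point let \<open>q n\<close> be the finite partial sums of the family. They belong to \<open>M\<close> and have measure at
  most \<open>C\<close>. For any \<open>k\<close> in \<open>M\<close> below \<open>e\<close>, its meets with \<open>q n\<close> have measure at most \<open>C\<close> and increase to \<open>k\<close>, so
  \<open>\<mu> k \<le> C\<close> by additivity of \<open>\<mu>\<close> inside \<open>M\<close>. Hence \<open>\<mu>\<close> is bounded by \<open>C\<close> below \<open>e\<close>, although \<open>k\<close> need not commute
  with the members of the family. For the second point, continuity shows that a maximal
  orthogonal family in \<open>M\<close> sums to the identity. It also yields the supremum property of the first paragraph.

  Continuity fails only if a nonzero \<open>r\<close> below \<open>p\<close> has no common vector with any \<open>q n\<close>. In that case spectral
  cuts of the operators \<open>r (1 - q n) r\<close> yield a nonzero projection below \<open>r\<close> on which infinitely many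
  orthogonal differences \<open>q n - q m\<close> are bounded below. Polar decomposition turns these differences into
  orthogonal copies of that projection, and shifting the copies by one place gives a non-unitary
  isometry in the algebra, contrary to finiteness. The spectral projections needed for the cuts come
  from a norm-convergent square root of positive contractions.
\<close>

section \<open>Hilbert space geometry\<close>

text \<open>The real part of the inner product is a real inner product with the same norm. Being symmetric
  and real-bilinear, it avoids all conjugations, and no information is lost by passing to it.\<close>

definition rinner :: "'h::complex_inner \<Rightarrow> 'h \<Rightarrow> real" where
  "rinner x y = Re (cinner x y)"

lemma rinner_commute: "rinner x y = rinner y x"
  by (simp add: rinner_def cinner_commute[of x y])

lemma norm_sq_rinner: "(norm x)\<^sup>2 = rinner x x"
  by (simp add: rinner_def norm_eq_sqrt_cinner cinner_ge_zero)

lemma rinner_add_left: "rinner (x + y) z = rinner x z + rinner y z"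
  by (simp add: rinner_def cinner_add_left)

lemma rinner_scaleR_left: "rinner (r *\<^sub>R x) y = r * rinner x y"
  by (simp add: rinner_def scaleR_scaleC cinner_scaleC_left)

lemma rinner_add_right: "rinner z (x + y) = rinner z x + rinner z y"
  using rinner_add_left rinner_commute by metis

lemma rinner_scaleR_right: "rinner x (r *\<^sub>R y) = r * rinner x y"
  using rinner_scaleR_left rinner_commute by metis

lemma rinner_le_norm: "rinner x y \<le> norm x * norm y"
proof -
  have "(norm (x + y))\<^sup>2 = (norm x)\<^sup>2 + 2 * rinner x y + (norm y)\<^sup>2"
    by (simp add: norm_sq_rinner rinner_add_left rinner_add_right rinner_commute[of y x])
  moreover have "(norm (x + y))\<^sup>2 \<le> (norm x + norm y)\<^sup>2"
    by (simp add: norm_triangle_ineq)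
  ultimately show ?thesis by (simp add: power2_sum)
qed

lemma abs_rinner_le_norm: "\<bar>rinner x y\<bar> \<le> norm x * norm y"
  using rinner_le_norm[of x y] rinner_le_norm[of "(-1) *\<^sub>R x" y]
  by (simp only: rinner_scaleR_left) auto

lemma bounded_bilinear_rinner: "bounded_bilinear rinner"
  by unfold_locales
    (auto simp: rinner_add_left rinner_add_right rinner_scaleR_left rinner_scaleR_right
      intro!: exI[of _ 1] abs_rinner_le_norm)

interpretation rinner: bounded_bilinear rinner
  by (rule bounded_bilinear_rinner)

lemmas rinner_simps = rinner.add_left rinner.add_right rinner.diff_left rinner.diff_right
  rinner.minus_left rinner.minus_right rinner_scaleR_left rinner_scaleR_right

lemma norm_add_sq: "(norm (x + y))\<^sup>2 = (norm x)\<^sup>2 + 2 * rinner x y + (norm y)\<^sup>2"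
  by (simp add: norm_sq_rinner rinner_simps rinner_commute[of y x])

lemma norm_diff_sq: "(norm (x - y))\<^sup>2 = (norm x)\<^sup>2 - 2 * rinner x y + (norm y)\<^sup>2"
  by (simp add: norm_sq_rinner rinner_simps rinner_commute[of y x])

lemma rinner_self_nonneg: "0 \<le> rinner x x"
  by (simp add: norm_sq_rinner[symmetric])

lemma rinner_self_eq_0: "rinner x x = 0 \<longleftrightarrow> x = 0"
  by (simp add: norm_sq_rinner[symmetric])

lemma rinner_eq_0_imp: "(\<And>y. rinner x y = 0) \<Longrightarrow> x = 0"
  using rinner_self_eq_0 by blast

lemma rinner_right_eq_0_imp: "(\<And>y. rinner y x = 0) \<Longrightarrow> x = 0"
  using rinner_self_eq_0 by blast

text \<open>The imaginary part of the inner product is a real inner product with a rotated vector,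
  so for complex-linear operators the adjoint relation can be tested on real parts alone.\<close>

lemma Im_cinner: "Im (cinner x y) = rinner x (scaleC \<i> y)"
proof -
  have "cinner x (scaleC \<i> y) = cnj \<i> * cinner x y"
    by (metis cinner_commute cinner_scaleC_left complex_cnj_mult)
  then show ?thesis by (simp add: rinner_def)
qed

lemma cinner_eq_Complex: "cinner x y = Complex (rinner x y) (rinner x (scaleC \<i> y))"
  by (simp add: complex_eq_iff rinner_def Im_cinner[unfolded rinner_def])

lemma is_adjoint_rinnerD:
  fixes S T :: "'h::complex_hilbert \<Rightarrow>\<^sub>L 'h"
  shows "is_adjoint S T \<Longrightarrow> rinner (T x) y = rinner x (S y)"
  by (simp add: is_adjoint_def rinner_def)

lemma bounded_ops_scaleC:
  fixes T :: "'h::complex_hilbert \<Rightarrow>\<^sub>L 'h"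
  shows "T \<in> bounded_ops \<Longrightarrow> T (scaleC c x) = scaleC c (T x)"
  by (simp add: bounded_ops_def)

lemma is_adjointI:
  fixes S T :: "'h::complex_hilbert \<Rightarrow>\<^sub>L 'h"
  assumes "S \<in> bounded_ops" "\<And>x y. rinner (T x) y = rinner x (S y)"
  shows "is_adjoint S T"
  unfolding is_adjoint_def cinner_eq_Complex using assms by (simp add: bounded_ops_scaleC)

lemma is_adjoint_sym: "is_adjoint S T \<Longrightarrow> is_adjoint T S"
  unfolding is_adjoint_def by (metis cinner_commute)

text \<open>The closest point is the limit of a minimizing sequence, which is Cauchy by the
  parallelogram law.\<close>

lemma closest_point_exists:
  fixes x :: "'h::complex_hilbert"
  assumes S: "subspace S" "closed S"
  obtains y where "y \<in> S" "\<And>z. z \<in> S \<Longrightarrow> norm (x - y) \<le> norm (x - z)"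
proof -
  define d where "d = (INF z\<in>S. (norm (x - z))\<^sup>2)"
  have ne: "S \<noteq> {}" using subspace_0[OF S(1)] by auto
  have bdd: "bdd_below ((\<lambda>z. (norm (x - z))\<^sup>2) ` S)" by (intro bdd_belowI[of _ 0]) auto
  have dle: "d \<le> (norm (x - z))\<^sup>2" if "z \<in> S" for z
    unfolding d_def using cINF_lower[OF bdd that] .
  have "\<exists>z\<in>S. (norm (x - z))\<^sup>2 < d + 1 / real (Suc n)" for n
    using cInf_lessD[of "(\<lambda>z. (norm (x - z))\<^sup>2) ` S" "d + 1 / real (Suc n)"] ne
    by (auto simp: d_def)
  then obtain Y where Y: "\<And>n. Y n \<in> S" "\<And>n. (norm (x - Y n))\<^sup>2 < d + 1 / real (Suc n)"
    by metis
  have key: "(norm (Y m - Y n))\<^sup>2 \<le> 2 / real (Suc m) + 2 / real (Suc n)" for m n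
  proof -
    have "(1/2) *\<^sub>R (Y m + Y n) \<in> S"
      using Y(1) S(1) by (simp add: subspace_add subspace_scale)
    then have "d \<le> (norm (x - (1/2) *\<^sub>R (Y m + Y n)))\<^sup>2" by (rule dle)
    also have "4 * \<dots> + (norm (Y m - Y n))\<^sup>2 = 2 * (norm (x - Y m))\<^sup>2 + 2 * (norm (x - Y n))\<^sup>2"
      by (simp add: norm_sq_rinner rinner_simps rinner_commute algebra_simps)
    finally show ?thesis using Y(2)[of m] Y(2)[of n] by simp
  qed
  have "Cauchy Y"
  proof (rule CauchyI)
    fix e :: real assume "e > 0"
    then obtain N where N: "4 / real (Suc N) < e\<^sup>2"
      using reals_Archimedean[of "e\<^sup>2 / 4"] by (auto simp: field_simps inverse_eq_divide)
    have "norm (Y m - Y n) < e" if "m \<ge> N" "n \<ge> N" for m n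
    proof -
      have "2 / real (Suc m) \<le> 2 / real (Suc N)" "2 / real (Suc n) \<le> 2 / real (Suc N)"
        using that by (auto simp: field_simps)
      then have "(norm (Y m - Y n))\<^sup>2 < e\<^sup>2" using key[of m n] N by simp
      then show ?thesis using \<open>e > 0\<close> by (auto intro: power_less_imp_less_base[of _ 2])
    qed
    then show "\<exists>M. \<forall>m\<ge>M. \<forall>n\<ge>M. norm (Y m - Y n) < e" by blast
  qed
  then obtain y where y: "Y \<longlonglongrightarrow> y" using Cauchy_convergent convergent_def by blast
  have "y \<in> S" using closed_sequentially[OF S(2)] Y(1) y by blast
  moreover have "norm (x - y) \<le> norm (x - z)" if "z \<in> S" for z
  proof -
    have l: "(\<lambda>n. (norm (x - Y n))\<^sup>2) \<longlonglongrightarrow> (norm (x - y))\<^sup>2"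
      by (intro tendsto_intros y)
    have r: "(\<lambda>n. d + 1 / real (Suc n)) \<longlonglongrightarrow> d + 0"
      by (intro tendsto_intros LIMSEQ_Suc[OF lim_1_over_n])
    have "(norm (x - y))\<^sup>2 \<le> d"
      using LIMSEQ_le[OF l r] Y(2) by (auto intro: less_imp_le)
    then show ?thesis using dle[OF that]
      by (meson norm_ge_zero order.trans power2_le_imp_le)
  qed
  ultimately show ?thesis using that by blast
qed

text \<open>At a closest point the squared distance is stationary along every direction of the subspace.\<close>

lemma orthogonal_point_exists:
  fixes x :: "'h::complex_hilbert"
  assumes S: "subspace S" "closed S"
  obtains y where "y \<in> S" "\<And>z. z \<in> S \<Longrightarrow> rinner (x - y) z = 0"
proof -
  obtain y where y: "y \<in> S" "\<And>z. z \<in> S \<Longrightarrow> norm (x - y) \<le> norm (x - z)"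
    using closest_point_exists[OF S] by blast
  have "rinner (x - y) z = 0" if z: "z \<in> S" for z
  proof (cases "z = 0")
    case False
    define t where "t = rinner (x - y) z / (norm z)\<^sup>2"
    have "norm (x - y) \<le> norm (x - (y + t *\<^sub>R z))"
      using y S(1) z by (simp add: subspace_add subspace_scale)
    then have "(norm (x - y))\<^sup>2 \<le> (norm ((x - y) - t *\<^sub>R z))\<^sup>2"
      by (simp add: diff_diff_eq)
    then have "2 * t * rinner (x - y) z \<le> t\<^sup>2 * (norm z)\<^sup>2"
      by (simp add: norm_diff_sq rinner_scaleR_right power_mult_distrib)
    moreover have "t * rinner (x - y) z = t\<^sup>2 * (norm z)\<^sup>2"
      using False by (simp add: t_def power2_eq_square)
    ultimately have "t\<^sup>2 * (norm z)\<^sup>2 \<le> 0" by linarith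
    then have "t = 0" using False by (simp add: mult_le_0_iff)
    then show ?thesis using False by (simp add: t_def)
  qed (simp add: rinner.zero_right)
  then show ?thesis using y(1) that by blast
qed

text \<open>A vector orthogonal to the kernel of \<open>f\<close> represents \<open>f\<close> up to a scalar.\<close>

lemma riesz_representation:
  fixes f :: "'h::complex_hilbert \<Rightarrow> real"
  assumes f: "bounded_linear f"
  obtains z where "\<And>x. f x = rinner x z"
proof (cases "\<forall>x. f x = 0")
  case True
  then show ?thesis using that[of 0] by (simp add: rinner.zero_right)
next
  case False
  then obtain a where a: "f a \<noteq> 0" by blast
  interpret f: bounded_linear f by (rule f)
  define K where "K = {x. f x = 0}"
  have "subspace K" by (auto simp: K_def subspace_def f.add f.scaleR f.zero)
  moreover have "closed K" unfolding K_def
    by (intro closed_Collect_eq continuous_intros f.continuous_on)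
  ultimately obtain y where y: "y \<in> K" "\<And>z. z \<in> K \<Longrightarrow> rinner (a - y) z = 0"
    using orthogonal_point_exists[of K] by blast
  define w where "w = a - y"
  have fw: "f w = f a" using y(1) by (simp add: w_def f.diff K_def)
  then have w0: "w \<noteq> 0" using a f.zero by auto
  have "f x = rinner x ((f w / (norm w)\<^sup>2) *\<^sub>R w)" for x
  proof -
    have "f w *\<^sub>R x - f x *\<^sub>R w \<in> K" by (simp add: K_def f.diff f.scaleR)
    then have "rinner w (f w *\<^sub>R x - f x *\<^sub>R w) = 0" using y(2) by (simp add: w_def)
    then have "f w * rinner x w = f x * (norm w)\<^sup>2"
      by (simp add: rinner_simps norm_sq_rinner rinner_commute)
    then show ?thesis using w0 by (simp add: rinner_scaleR_right field_simps)
  qed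
  then show ?thesis using that by blast
qed

text \<open>A von Neumann algebra comes with adjoints of its own elements; this lemma is for the operators
  of its commutant.\<close>

lemma adjoint_exists:
  fixes T :: "'h::complex_hilbert \<Rightarrow>\<^sub>L 'h"
  assumes T: "T \<in> bounded_ops"
  obtains S where "S \<in> bounded_ops" "is_adjoint S T"
proof -
  have "\<exists>z. \<forall>x. rinner (T x) y = rinner x z" for y
  proof -
    have "bounded_linear (\<lambda>x. rinner (T x) y)"
      using bounded_linear_compose[OF rinner.bounded_linear_left blinfun.bounded_linear_right] .
    then show ?thesis using riesz_representation by blast
  qed
  then obtain s where s: "\<And>x y. rinner (T x) y = rinner x (s y)" by metis
  have eqI: "a = b" if "\<And>x. rinner x a = rinner x b" for a b :: 'h
    using that[of "a - b"] rinner_self_eq_0[of "a - b"] by (simp add: rinner_simps)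
  have bl: "bounded_linear s"
  proof (rule bounded_linear_intro[where K = "norm T"])
    show "s (x + y) = s x + s y" for x y
      by (rule eqI) (simp add: s[symmetric] rinner_simps)
    show "s (r *\<^sub>R x) = r *\<^sub>R s x" for r x
      by (rule eqI) (simp add: s[symmetric] rinner_simps)
    show "norm (s x) \<le> norm x * norm T" for x
    proof -
      have "(norm (s x))\<^sup>2 = rinner (T (s x)) x" by (simp add: norm_sq_rinner s)
      also have "\<dots> \<le> norm (T (s x)) * norm x" by (rule rinner_le_norm)
      also have "\<dots> \<le> norm T * norm (s x) * norm x"
        by (intro mult_right_mono norm_blinfun) auto
      finally have "norm (s x) * norm (s x) \<le> (norm x * norm T) * norm (s x)"
        by (simp add: power2_eq_square mult_ac)
      then show ?thesis by (cases "s x = 0") auto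
    qed
  qed
  define S where "S = Blinfun s"
  have S: "blinfun_apply S = s" using bl by (simp add: S_def bounded_linear_Blinfun_apply)
  have rot: "rinner x (scaleC c y) = rinner (scaleC (cnj c) x) y" for x y :: 'h and c
    by (metis (no_types, opaque_lifting) rinner_def cinner_commute cinner_scaleC_left
        complex_cnj_cnj complex_cnj_mult)
  have "S \<in> bounded_ops"
    unfolding bounded_ops_def mem_Collect_eq S
  proof (intro allI)
    fix c x show "s (scaleC c x) = scaleC c (s x)"
      by (rule eqI) (simp add: s[symmetric] rot bounded_ops_scaleC[OF T, symmetric])
  qed
  then show ?thesis using that[OF _ is_adjointI] s S by simp
qed

section \<open>Projections in a von Neumann algebra\<close>

text \<open>Stated pointwise and with the real inner product, so that both conditions serve as rewrite
  rules.\<close>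

definition is_proj :: "('h::complex_hilbert \<Rightarrow>\<^sub>L 'h) \<Rightarrow> bool" where
  "is_proj p \<longleftrightarrow> p \<in> bounded_ops \<and> (\<forall>x y. rinner (p x) y = rinner x (p y)) \<and> (\<forall>x. p (p x) = p x)"

lemma is_proj_rinner: "is_proj p \<Longrightarrow> rinner (p x) y = rinner x (p y)"
  and is_proj_idem: "is_proj p \<Longrightarrow> p (p x) = p x"
  and is_proj_bounded_ops: "is_proj p \<Longrightarrow> p \<in> bounded_ops"
  by (auto simp: is_proj_def)

lemma projs_iff:
  assumes "A \<subseteq> bounded_ops"
  shows "p \<in> projs A \<longleftrightarrow> p \<in> A \<and> is_proj p"
proof -
  have "p o\<^sub>L p = p \<longleftrightarrow> (\<forall>x. p (p x) = p x)"
    by (metis blinfun_apply_blinfun_compose blinfun_eqI)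
  moreover have "p \<in> A \<Longrightarrow> is_adjoint p p \<longleftrightarrow> (\<forall>x y. rinner (p x) y = rinner x (p y))"
    using assms by (auto simp: is_adjoint_rinnerD intro: is_adjointI)
  ultimately show ?thesis using assms unfolding projs_def is_proj_def by blast
qed

lemma is_proj_norm_sq: "is_proj p \<Longrightarrow> (norm (p x))\<^sup>2 = rinner (p x) x"
  by (simp add: norm_sq_rinner is_proj_rinner is_proj_idem)

lemma is_proj_pythagoras: "is_proj p \<Longrightarrow> (norm (x - p x))\<^sup>2 = (norm x)\<^sup>2 - (norm (p x))\<^sup>2"
  using norm_diff_sq[of x "p x"] is_proj_norm_sq[of p x] rinner_commute[of x "p x"] by linarith

lemma is_proj_norm_le: "is_proj p \<Longrightarrow> norm (p x) \<le> norm x"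
  using is_proj_pythagoras[of p x] zero_le_power2[of "norm (x - p x)"]
  by (auto intro: power2_le_imp_le[OF _ norm_ge_zero])

lemma is_proj_eq_iff_norm: "is_proj p \<Longrightarrow> p x = x \<longleftrightarrow> norm x \<le> norm (p x)"
proof
  assume p: "is_proj p" and "norm x \<le> norm (p x)"
  then have "(norm x)\<^sup>2 \<le> (norm (p x))\<^sup>2" by simp
  then have "(norm (x - p x))\<^sup>2 \<le> 0" using is_proj_pythagoras[OF p, of x] by simp
  then show "p x = x" by simp
qed simp

lemma is_proj_closest:
  assumes "is_proj p" "p y = y"
  shows "norm (x - p x) \<le> norm (x - y)"
proof -
  have "(x - y) - p (x - y) = x - p x" using assms by (simp add: blinfun.bilinear_simps)
  moreover have "norm ((x - y) - p (x - y)) \<le> norm (x - y)"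
    using is_proj_pythagoras[OF assms(1), of "x - y"] zero_le_power2[of "norm (p (x - y))"]
    by (auto intro: power2_le_imp_le[OF _ norm_ge_zero])
  ultimately show ?thesis by metis
qed

text \<open>For projections the operator order is the inclusion of ranges, and the range is the set of fixed
  vectors. All order arguments below are made in this form.\<close>

lemma op_le_proj_iff:
  assumes p: "is_proj p" and q: "is_proj q"
  shows "op_le q p \<longleftrightarrow> (\<forall>x. q x = x \<longrightarrow> p x = x)"
proof
  assume le: "op_le q p"
  show "\<forall>x. q x = x \<longrightarrow> p x = x"
  proof (intro allI impI)
    fix x assume x: "q x = x"
    have "0 \<le> rinner ((p - q) x) x"
      using le unfolding op_le_def rinner_def complex_nonneg_Reals_iff by blast
    moreover have "rinner ((p - q) x) x = rinner (p x) x - rinner x x"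
      by (simp add: blinfun.diff_left rinner.diff_left x)
    ultimately have "(norm x)\<^sup>2 \<le> (norm (p x))\<^sup>2"
      using is_proj_norm_sq[OF p, of x] norm_sq_rinner[of x] by linarith
    then have "norm x \<le> norm (p x)" by (rule power2_le_imp_le) simp
    then show "p x = x" using is_proj_eq_iff_norm[OF p] by blast
  qed
next
  assume le: "\<forall>x. q x = x \<longrightarrow> p x = x"
  have pq: "p (q x) = q x" for x using le is_proj_idem[OF q] by blast
  have qp: "q (p x) = q x" for x
  proof -
    have "rinner (q (p x) - q x) y = 0" for y
      by (simp add: rinner_simps is_proj_rinner[OF p] is_proj_rinner[OF q] pq)
    then show ?thesis using rinner_eq_0_imp by fastforce
  qed
  show "op_le q p"
    unfolding op_le_def
  proof
    fix x
    have sa: "rinner ((p - q) x) y = rinner x ((p - q) y)" for x y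
      by (simp add: blinfun.bilinear_simps rinner_simps is_proj_rinner[OF p] is_proj_rinner[OF q])
    have "(p - q) ((p - q) x) = (p - q) x"
      by (simp add: blinfun.bilinear_simps is_proj_idem[OF p] is_proj_idem[OF q] pq qp)
    then have "rinner ((p - q) x) x = rinner ((p - q) x) ((p - q) x)"
      using sa[of "(p - q) x" x] by simp
    then have re: "0 \<le> rinner ((p - q) x) x" using rinner_self_nonneg by metis
    have bo: "p - q \<in> bounded_ops"
      using is_proj_bounded_ops[OF p] is_proj_bounded_ops[OF q]
      by (auto simp: bounded_ops_def blinfun.bilinear_simps)
        (metis (no_types, opaque_lifting) add_diff_cancel_right' diff_add_cancel scaleC_add_right)
    have "is_adjoint (p - q) (p - q)" by (rule is_adjointI[OF bo sa])
    then have "cinner ((p - q) x) x = cnj (cinner ((p - q) x) x)"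
      using cinner_commute is_adjoint_def by metis
    then have "Im (cinner ((p - q) x) x) = 0" by (metis Reals_cnj_iff complex_is_Real_iff)
    then show "cinner ((p - q) x) x \<in> \<real>\<^sub>\<ge>\<^sub>0"
      using re by (simp add: complex_nonneg_Reals_iff rinner_def)
  qed
qed

text \<open>Meaningful for closed subspaces, on which the chosen point exists and is unique.\<close>

definition proj_on :: "'h::complex_hilbert set \<Rightarrow> 'h \<Rightarrow>\<^sub>L 'h" where
  "proj_on S = Blinfun (\<lambda>x. SOME y. y \<in> S \<and> (\<forall>z\<in>S. rinner (x - y) z = 0))"

lemma
  fixes S :: "'h::complex_hilbert set"
  assumes S: "subspace S" "closed S"
  shows proj_on_in: "proj_on S x \<in> S"
    and proj_on_orth: "z \<in> S \<Longrightarrow> rinner (x - proj_on S x) z = 0"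
    and proj_on_fix: "proj_on S x = x \<longleftrightarrow> x \<in> S"
    and proj_on_rinner: "rinner (proj_on S x) y = rinner x (proj_on S y)"
    and proj_on_unique: "y \<in> S \<Longrightarrow> (\<And>z. z \<in> S \<Longrightarrow> rinner (x - y) z = 0) \<Longrightarrow> proj_on S x = y"
proof -
  define P where "P = (\<lambda>x. SOME y. y \<in> S \<and> (\<forall>z\<in>S. rinner (x - y) z = 0))"
  have P: "P x \<in> S \<and> (\<forall>z\<in>S. rinner (x - P x) z = 0)" for x
    unfolding P_def by (rule someI_ex) (meson orthogonal_point_exists[OF S])
  have uniq: "P x = y" if "y \<in> S" "\<And>z. z \<in> S \<Longrightarrow> rinner (x - y) z = 0" for x y
  proof -
    have "P x - y \<in> S" using P that(1) S(1) by (simp add: subspace_diff)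
    then have "rinner (x - y) (P x - y) = 0" "rinner (x - P x) (P x - y) = 0"
      using P that(2) by auto
    then have "rinner (P x - y) (P x - y) = 0" by (simp add: rinner_simps)
    then show ?thesis by (simp add: rinner_self_eq_0)
  qed
  have "bounded_linear P"
  proof (rule bounded_linear_intro[where K = 1])
    show "P (x + y) = P x + P y" for x y
    proof (rule uniq)
      fix z assume "z \<in> S"
      then have "rinner (x - P x) z + rinner (y - P y) z = 0" using P by simp
      then show "rinner (x + y - (P x + P y)) z = 0" by (simp add: rinner_simps)
    qed (use P S in \<open>simp add: subspace_add\<close>)
    show "P (r *\<^sub>R x) = r *\<^sub>R P x" for r x
      by (rule uniq) (use P S in \<open>auto simp: subspace_scale rinner_scaleR_left
          simp flip: scaleR_diff_right\<close>)
    show "norm (P x) \<le> norm x * 1" for x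
    proof -
      have "rinner (x - P x) (P x) = 0" using P by blast
      then have "(norm x)\<^sup>2 = (norm (x - P x))\<^sup>2 + (norm (P x))\<^sup>2"
        using norm_add_sq[of "x - P x" "P x"] by simp
      then have "(norm (P x))\<^sup>2 \<le> (norm x)\<^sup>2" by simp
      then have "norm (P x) \<le> norm x" by (rule power2_le_imp_le) simp
      then show ?thesis by simp
    qed
  qed
  then have app: "blinfun_apply (proj_on S) = P"
    unfolding proj_on_def P_def by (rule bounded_linear_Blinfun_apply)
  show "proj_on S x \<in> S" using P by (simp add: app)
  show orth: "z \<in> S \<Longrightarrow> rinner (x - proj_on S x) z = 0" for x z using P by (simp add: app)
  show "y \<in> S \<Longrightarrow> (\<And>z. z \<in> S \<Longrightarrow> rinner (x - y) z = 0) \<Longrightarrow> proj_on S x = y"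
    using uniq by (simp add: app)
  show "proj_on S x = x \<longleftrightarrow> x \<in> S"
    using P uniq[of x x] by (auto simp: app rinner.zero_left) (metis P)
  show "rinner (proj_on S x) y = rinner x (proj_on S y)"
  proof -
    have "rinner (proj_on S x) (y - proj_on S y) = 0" "rinner (x - proj_on S x) (proj_on S y) = 0"
      using orth[of "proj_on S x" y] orth[of "proj_on S y" x] P by (auto simp: app rinner_commute)
    then show ?thesis by (simp add: rinner_simps)
  qed
qed

lemma scaleC_scaleR_commute: "scaleC c (r *\<^sub>R x) = r *\<^sub>R scaleC c x"
  by (simp add: scaleR_scaleC scaleC_scaleC mult.commute)

lemma bounded_linear_scaleC: "bounded_linear (scaleC c :: 'h::complex_inner \<Rightarrow> 'h)"
proof (rule bounded_linear_intro[where K = "norm c"])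
  fix x :: 'h
  have "cinner (scaleC c x) (scaleC c x) = (c * cnj c) * cinner x x"
    by (metis cinner_scaleC_left cinner_commute complex_cnj_mult mult.assoc)
  then have "Re (cinner (scaleC c x) (scaleC c x)) = (norm c)\<^sup>2 * Re (cinner x x)"
    by (simp add: complex_norm_square[symmetric])
  then show "norm (scaleC c x) \<le> norm x * norm c"
    by (simp add: norm_eq_sqrt_cinner real_sqrt_mult)
qed (auto simp: scaleC_add_right scaleC_scaleR_commute)

lemma bounded_ops_id: "id_blinfun \<in> bounded_ops"
  by (simp add: bounded_ops_def)

lemma bounded_ops_add: "S \<in> bounded_ops \<Longrightarrow> T \<in> bounded_ops \<Longrightarrow> S + T \<in> bounded_ops"
  by (simp add: bounded_ops_def blinfun.bilinear_simps scaleC_add_right)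

lemma bounded_ops_scaleR: "T \<in> bounded_ops \<Longrightarrow> r *\<^sub>R T \<in> bounded_ops"
  by (simp add: bounded_ops_def blinfun.bilinear_simps scaleC_scaleR_commute)

lemma bounded_ops_compose: "S \<in> bounded_ops \<Longrightarrow> T \<in> bounded_ops \<Longrightarrow> S o\<^sub>L T \<in> bounded_ops"
  by (simp add: bounded_ops_def)

lemma bounded_ops_lim:
  fixes T :: "'h::complex_hilbert \<Rightarrow>\<^sub>L 'h"
  assumes "\<And>n. X n \<in> bounded_ops" "\<And>x. (\<lambda>n. blinfun_apply (X n) x) \<longlonglongrightarrow> T x"
  shows "T \<in> bounded_ops"
proof -
  have "T (scaleC c x) = scaleC c (T x)" for c x
  proof (rule LIMSEQ_unique[OF assms(2)])
    have "(\<lambda>n. scaleC c (X n x)) \<longlonglongrightarrow> scaleC c (T x)"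
      by (intro bounded_linear.tendsto[OF bounded_linear_scaleC] assms(2))
    then show "(\<lambda>n. X n (scaleC c x)) \<longlonglongrightarrow> scaleC c (T x)"
      by (simp add: bounded_ops_scaleC[OF assms(1)])
  qed
  then show ?thesis by (simp add: bounded_ops_def)
qed

lemma commutantD: "R \<in> commutant A \<Longrightarrow> T \<in> A \<Longrightarrow> R (blinfun_apply T x) = T (R x)"
  unfolding commutant_def by (metis (mono_tags, lifting) blinfun_apply_blinfun_compose mem_Collect_eq)

lemma commutantI:
  "R \<in> bounded_ops \<Longrightarrow> (\<And>T x. T \<in> A \<Longrightarrow> R (blinfun_apply T x) = T (R x)) \<Longrightarrow> R \<in> commutant A"
  by (auto simp: commutant_def intro!: blinfun_eqI)

lemma is_adjoint_unique:
  fixes S :: "'h::complex_hilbert \<Rightarrow>\<^sub>L 'h"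
  assumes "is_adjoint S T" "is_adjoint S' T"
  shows "S = S'"
proof (rule blinfun_eqI)
  fix y
  have "rinner (S y - S' y) x = 0" for x
    using is_adjoint_rinnerD[OF assms(1), of x y] is_adjoint_rinnerD[OF assms(2), of x y]
    by (simp add: rinner_simps rinner_commute)
  then show "S y = S' y" using rinner_eq_0_imp by fastforce
qed

locale vna =
  fixes A :: "('h::complex_hilbert \<Rightarrow>\<^sub>L 'h) set"
  assumes vna: "von_neumann_algebra A"
begin

lemma A_bounded_ops: "T \<in> A \<Longrightarrow> T \<in> bounded_ops"
  using vna by (auto simp: von_neumann_algebra_def)

lemma A_memI:
  "T \<in> bounded_ops \<Longrightarrow> (\<And>R x. R \<in> commutant A \<Longrightarrow> T (blinfun_apply R x) = R (T x)) \<Longrightarrow> T \<in> A" for T :: "'h \<Rightarrow>\<^sub>L 'h"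
  using commutantI[of T "commutant A"] vna by (auto simp: von_neumann_algebra_def)

lemma A_commute: "T \<in> A \<Longrightarrow> R \<in> commutant A \<Longrightarrow> T (blinfun_apply R x) = R (T x)" for T R :: "'h \<Rightarrow>\<^sub>L 'h"
  using commutantD by metis

lemma A_id: "id_blinfun \<in> A"
  by (rule A_memI) (auto simp: bounded_ops_id)

lemma A_add: "S \<in> A \<Longrightarrow> T \<in> A \<Longrightarrow> S + T \<in> A"
  by (rule A_memI) (auto simp: bounded_ops_add A_bounded_ops blinfun.bilinear_simps A_commute)

lemma A_scaleR: "T \<in> A \<Longrightarrow> r *\<^sub>R T \<in> A"
  by (rule A_memI) (auto simp: bounded_ops_scaleR A_bounded_ops blinfun.bilinear_simps A_commute)

lemma A_0: "0 \<in> A"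
  using A_scaleR[OF A_id, of 0] by simp

lemma A_diff:
  assumes "S \<in> A" "T \<in> A"
  shows "S - T \<in> A"
proof -
  have "(-1) *\<^sub>R T \<in> A" by (rule A_scaleR) (rule assms)
  then have "S + (-1) *\<^sub>R T \<in> A" by (rule A_add[OF assms(1)])
  then show ?thesis by simp
qed

lemma A_compose: "S \<in> A \<Longrightarrow> T \<in> A \<Longrightarrow> S o\<^sub>L T \<in> A"
  by (rule A_memI) (auto simp: bounded_ops_compose A_bounded_ops A_commute)

lemma A_sum: "finite F \<Longrightarrow> (\<And>i. i \<in> F \<Longrightarrow> T i \<in> A) \<Longrightarrow> sum T F \<in> A"
  by (induction F rule: finite_induct) (auto simp: A_0 A_add)

lemma A_strong_lim:
  fixes T :: "'h \<Rightarrow>\<^sub>L 'h"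
  assumes "\<And>n. X n \<in> A" "\<And>x. (\<lambda>n. blinfun_apply (X n) x) \<longlonglongrightarrow> T x"
  shows "T \<in> A"
proof (rule A_memI)
  show "T \<in> bounded_ops" using bounded_ops_lim assms A_bounded_ops by blast
  fix R x assume R: "R \<in> commutant A"
  have "(\<lambda>n. R (X n x)) \<longlonglongrightarrow> R (T x)"
    by (intro bounded_linear.tendsto[OF blinfun.bounded_linear_right] assms(2))
  then have "(\<lambda>n. X n (R x)) \<longlonglongrightarrow> R (T x)" using A_commute[OF assms(1) R] by simp
  then show "T (R x) = R (T x)" using LIMSEQ_unique assms(2) by blast
qed

lemma A_closed: "closed A"
proof -
  have "T \<in> A" if "\<And>n. X n \<in> A" "X \<longlonglongrightarrow> T" for X T
    using A_strong_lim[of X T] that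
      bounded_linear.tendsto[OF blinfun.bounded_linear_left] by blast
  then show ?thesis by (auto simp: closed_sequential_limits)
qed

lemma A_adjoint_exists: "T \<in> A \<Longrightarrow> \<exists>S\<in>A. is_adjoint S T"
  using vna by (auto simp: von_neumann_algebra_def)

lemma commutant_adjoint:
  assumes R: "R \<in> commutant A"
  obtains R' where "R' \<in> commutant A" "is_adjoint R' R"
proof -
  have "R \<in> bounded_ops" using R by (simp add: commutant_def)
  then obtain R' where R': "R' \<in> bounded_ops" "is_adjoint R' R" using adjoint_exists by blast
  have "R' \<in> commutant A"
  proof (rule commutantI[OF R'(1)])
    fix T y assume T: "T \<in> A"
    obtain S where S: "S \<in> A" "is_adjoint S T" using A_adjoint_exists[OF T] by blast
    have "rinner (R' (T y) - T (R' y)) x = 0" for x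
    proof -
      have "rinner x (R' (T y)) = rinner (S (R x)) y"
        using is_adjoint_rinnerD[OF R'(2)] is_adjoint_rinnerD[OF is_adjoint_sym[OF S(2)]] by metis
      moreover have "rinner x (T (R' y)) = rinner (R (S x)) y"
        using is_adjoint_rinnerD[OF R'(2)] is_adjoint_rinnerD[OF is_adjoint_sym[OF S(2)]] by metis
      ultimately show ?thesis
        using commutantD[OF R S(1)] by (simp add: rinner_simps rinner_commute)
    qed
    then show "R' (T y) = T (R' y)" using rinner_eq_0_imp by fastforce
  qed
  then show ?thesis using that R'(2) by blast
qed

lemma commutant_scaleC: "Blinfun (scaleC c) \<in> commutant A"
  and Blinfun_scaleC_apply: "Blinfun (scaleC c) x = scaleC c (x :: 'h)"
proof -
  show *: "Blinfun (scaleC c) x = scaleC c (x :: 'h)" for x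
    by (simp add: bounded_linear_Blinfun_apply bounded_linear_scaleC)
  have "Blinfun (scaleC c :: 'h \<Rightarrow> 'h) \<in> bounded_ops"
    by (simp add: bounded_ops_def * scaleC_scaleC mult.commute)
  then show "Blinfun (scaleC c) \<in> commutant A"
    by (rule commutantI) (simp add: * bounded_ops_scaleC A_bounded_ops)
qed

lemma projs_A: "p \<in> projs A \<Longrightarrow> p \<in> A"
  by (simp add: projs_def)

lemma projs_is_proj: "p \<in> projs A \<Longrightarrow> is_proj p"
  using projs_iff[of A] A_bounded_ops by blast

lemma projsI: "p \<in> A \<Longrightarrow> is_proj p \<Longrightarrow> p \<in> projs A"
  using projs_iff[of A] A_bounded_ops by blast

text \<open>The commutant is closed under adjoints, so a closed subspace that it leaves invariant has an
  invariant orthogonal complement. Hence the projection commutes with the commutant and lies in the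
  algebra. Complex linearity is a special case, since the scalars belong to the commutant.\<close>

lemma proj_on_projs:
  assumes S: "subspace S" "closed S"
    and inv: "\<And>R x. R \<in> commutant A \<Longrightarrow> x \<in> S \<Longrightarrow> blinfun_apply R x \<in> S"
  shows "proj_on S \<in> projs A"
proof -
  have comm: "proj_on S (R x) = R (proj_on S x)" if R: "R \<in> commutant A" for R x
  proof (rule proj_on_unique[OF S])
    show "R (proj_on S x) \<in> S" using inv[OF R] proj_on_in[OF S] by blast
    obtain R' where R': "R' \<in> commutant A" "is_adjoint R' R" using commutant_adjoint[OF R] .
    fix z assume "z \<in> S"
    then have "rinner (x - proj_on S x) (R' z) = 0" using proj_on_orth[OF S] inv[OF R'(1)] by blast
    then show "rinner (R x - R (proj_on S x)) z = 0"
      by (simp add: is_adjoint_rinnerD[OF R'(2), symmetric] blinfun.diff_right)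
  qed
  have "proj_on S \<in> bounded_ops"
    using comm[OF commutant_scaleC] by (simp add: bounded_ops_def Blinfun_scaleC_apply)
  then have "proj_on S \<in> A" "is_proj (proj_on S)"
    using comm proj_on_rinner[OF S] proj_on_fix[OF S] proj_on_in[OF S]
    by (auto simp: is_proj_def intro: A_memI)
  then show ?thesis by (rule projsI)
qed

lemma id_projs: "id_blinfun \<in> projs A"
  by (rule projsI[OF A_id]) (simp add: is_proj_def bounded_ops_id)

lemma zero_projs: "0 \<in> projs A"
  by (rule projsI[OF A_0]) (simp add: is_proj_def A_bounded_ops[OF A_0] rinner.zero_left rinner.zero_right)

lemma le_iff: "p \<in> projs A \<Longrightarrow> q \<in> projs A \<Longrightarrow> op_le q p \<longleftrightarrow> (\<forall>x. q x = x \<longrightarrow> p x = x)" for p q :: "'h \<Rightarrow>\<^sub>L 'h"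
  using op_le_proj_iff projs_is_proj by blast

lemma le_trans: "p \<in> projs A \<Longrightarrow> q \<in> projs A \<Longrightarrow> r \<in> projs A \<Longrightarrow> op_le p q \<Longrightarrow> op_le q r \<Longrightarrow> op_le p r"
  by (simp add: le_iff)

lemma le_refl: "p \<in> projs A \<Longrightarrow> op_le p p"
  by (simp add: le_iff)

lemma le_absorb: "p \<in> projs A \<Longrightarrow> q \<in> projs A \<Longrightarrow> op_le q p \<Longrightarrow> p (q x) = q x" for p q :: "'h \<Rightarrow>\<^sub>L 'h"
  using le_iff is_proj_idem projs_is_proj by blast

lemma le_absorb': 
  fixes p q :: "'h \<Rightarrow>\<^sub>L 'h"
  assumes "p \<in> projs A" "q \<in> projs A" "op_le q p" 
  shows "q (p x) = q x"
proof -
  have "rinner (q (p x) - q x) y = 0" for y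
    by (simp add: rinner_simps is_proj_rinner[OF projs_is_proj] assms le_absorb)
  then show ?thesis using rinner_eq_0_imp by fastforce
qed

lemma le_norm:
  fixes p q :: "'h \<Rightarrow>\<^sub>L 'h"
  assumes "p \<in> projs A" "q \<in> projs A" "op_le q p" 
  shows "norm (q x) \<le> norm (p x)"
  using is_proj_norm_le[OF projs_is_proj[OF assms(2)], of "p x"] le_absorb'[OF assms] by simp

lemma orth_commute:
  fixes p q :: "'h \<Rightarrow>\<^sub>L 'h"
  assumes "p \<in> projs A" "q \<in> projs A" "p o\<^sub>L q = 0"
  shows "p (q x) = 0" "q (p x) = 0"
proof -
  show 1: "p (q x) = 0" for x
    using assms(3) by (metis blinfun_apply_blinfun_compose blinfun.zero_left)
  have "rinner (q (p x)) y = 0" for y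
    by (simp add: is_proj_rinner[OF projs_is_proj] assms 1 rinner.zero_right)
  then show "q (p x) = 0" using rinner_eq_0_imp by blast
qed

lemma orth_sym: "p \<in> projs A \<Longrightarrow> q \<in> projs A \<Longrightarrow> p o\<^sub>L q = 0 \<Longrightarrow> q o\<^sub>L p = 0"
  using orth_commute by (auto intro!: blinfun_eqI)

lemma diff_projs:
  fixes p q :: "'h \<Rightarrow>\<^sub>L 'h"
  assumes "p \<in> projs A" "q \<in> projs A" "op_le q p" 
  shows "p - q \<in> projs A"
  using assms is_proj_rinner[OF projs_is_proj] is_proj_idem[OF projs_is_proj] le_absorb le_absorb'
  by (intro projsI)
    (auto simp: is_proj_def A_diff projs_A A_bounded_ops blinfun.bilinear_simps rinner_simps)

lemma diff_le:
  fixes p q :: "'h \<Rightarrow>\<^sub>L 'h"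
  assumes "p \<in> projs A" "q \<in> projs A" "op_le q p" 
  shows "op_le (p - q) p"
  unfolding le_iff[OF assms(1) diff_projs[OF assms]] 
  by (metis assms(1) blinfun.diff_left blinfun.diff_right diff_projs[OF assms] is_proj_idem le_absorb[OF assms] projs_is_proj)

definition meet :: "('h \<Rightarrow>\<^sub>L 'h) \<Rightarrow> ('h \<Rightarrow>\<^sub>L 'h) \<Rightarrow> 'h \<Rightarrow>\<^sub>L 'h" where
  "meet p q = proj_on {x. p x = x \<and> q x = x}"

lemma
  fixes p q :: "'h \<Rightarrow>\<^sub>L 'h"
  assumes "p \<in> projs A" "q \<in> projs A"
  shows meet_projs: "meet p q \<in> projs A"
    and meet_fix: "meet p q x = x \<longleftrightarrow> p x = x \<and> q x = x"
proof -
  have S: "subspace {x. p x = x \<and> q x = x}"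
    by (auto simp: subspace_def blinfun.bilinear_simps)
  have C: "closed {x. p x = x \<and> q x = x}"
    by (intro closed_Collect_conj closed_Collect_eq continuous_intros)
  show "meet p q \<in> projs A" unfolding meet_def
    by (rule proj_on_projs[OF S C]) (auto simp: A_commute projs_A assms)
  show "meet p q x = x \<longleftrightarrow> p x = x \<and> q x = x"
    unfolding meet_def proj_on_fix[OF S C] by simp
qed

lemma meet_le1: "p \<in> projs A \<Longrightarrow> q \<in> projs A \<Longrightarrow> op_le (meet p q) p"
  and meet_le2: "p \<in> projs A \<Longrightarrow> q \<in> projs A \<Longrightarrow> op_le (meet p q) q"
  by (simp_all add: le_iff meet_projs meet_fix)

lemma subspace_closure:
  fixes U :: "'h set"
  assumes U: "subspace U"
  shows "subspace (closure U)"
  unfolding subspace_def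
proof (intro conjI ballI allI)
  show "0 \<in> closure U" using subspace_0[OF U] closure_subset by blast
  show "c *\<^sub>R x \<in> closure U" if x: "x \<in> closure U" for c x
  proof -
    obtain f where f: "\<And>n::nat. f n \<in> U" "f \<longlonglongrightarrow> x"
      using x unfolding closure_sequential by blast
    have "(\<lambda>n. c *\<^sub>R f n) \<longlonglongrightarrow> c *\<^sub>R x" by (intro tendsto_intros f)
    then show ?thesis unfolding closure_sequential
      by (intro exI[of _ "\<lambda>n. c *\<^sub>R f n"]) (simp add: f(1) subspace_scale[OF U])
  qed
  show "x + y \<in> closure U" if x: "x \<in> closure U" and y: "y \<in> closure U" for x y
  proof -
    obtain f where f: "\<And>n::nat. f n \<in> U" "f \<longlonglongrightarrow> x"
      using x unfolding closure_sequential by blast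
    obtain g where g: "\<And>n::nat. g n \<in> U" "g \<longlonglongrightarrow> y"
      using y unfolding closure_sequential by blast
    have "(\<lambda>n. f n + g n) \<longlonglongrightarrow> x + y" by (intro tendsto_intros f g)
    then show ?thesis unfolding closure_sequential
      by (intro exI[of _ "\<lambda>n. f n + g n"]) (simp add: f(1) g(1) subspace_add[OF U])
  qed
qed

lemma incseq_le:
  assumes "\<And>n. q n \<in> projs A" "\<And>n. op_le (q n) (q (Suc n))" "m \<le> n"
  shows "op_le (q m) (q n)"
  using assms(3)
  by (induction n rule: dec_induct) (use assms le_refl le_trans in blast)+

lemma lim_projs:
  fixes q :: "nat \<Rightarrow> 'h \<Rightarrow>\<^sub>L 'h" and p r :: "'h \<Rightarrow>\<^sub>L 'h"
  assumes q: "\<And>n. q n \<in> projs A" and lim: "\<And>x. (\<lambda>n. q n x) \<longlonglongrightarrow> blinfun_apply p x"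
    and inc: "\<And>n. op_le (q n) (q (Suc n))"
  shows "p \<in> projs A" "op_le (q n) p"
    "r \<in> projs A \<Longrightarrow> (\<And>n. op_le (q n) r) \<Longrightarrow> op_le p r"
proof -
  have pA: "p \<in> A" by (rule A_strong_lim[OF projs_A[OF q] lim])
  have absorb: "p (q m x) = q m x" for m x
  proof -
    have "\<forall>\<^sub>F n in sequentially. q n (q m x) = q m x"
      using incseq_le[of q m, OF q inc] le_absorb[OF q q]
      by (auto simp: eventually_sequentially intro!: exI[of _ m])
    then show ?thesis by (rule LIMSEQ_unique[OF lim tendsto_eventually])
  qed
  have "rinner (p x) y = rinner x (p y)" for x y
  proof (rule LIMSEQ_unique)
    show "(\<lambda>n. rinner (q n x) y) \<longlonglongrightarrow> rinner (p x) y"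
      by (intro rinner.tendsto lim tendsto_const)
    show "(\<lambda>n. rinner (q n x) y) \<longlonglongrightarrow> rinner x (p y)"
      unfolding is_proj_rinner[OF projs_is_proj[OF q]] by (intro rinner.tendsto lim tendsto_const)
  qed
  moreover have "p (p x) = p x" for x
  proof (rule LIMSEQ_unique)
    show "(\<lambda>n. p (q n x)) \<longlonglongrightarrow> p (p x)"
      by (intro bounded_linear.tendsto[OF blinfun.bounded_linear_right] lim)
    show "(\<lambda>n. p (q n x)) \<longlonglongrightarrow> p x" unfolding absorb by (rule lim)
  qed
  ultimately show p: "p \<in> projs A" using pA by (intro projsI) (auto simp: is_proj_def A_bounded_ops)
  show "op_le (q n) p" unfolding le_iff[OF p q] using absorb by metis
  show "op_le p r" if r: "r \<in> projs A" "\<And>n. op_le (q n) r"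
    unfolding le_iff[OF r(1) p]
  proof (intro allI impI)
    fix x assume x: "p x = x"
    have "(\<lambda>n. r (q n x)) \<longlonglongrightarrow> r (p x)"
      by (intro bounded_linear.tendsto[OF blinfun.bounded_linear_right] lim)
    then have "(\<lambda>n. q n x) \<longlonglongrightarrow> r x" using le_absorb[OF r(1) q r(2)] x by simp
    then show "r x = x" using lim[of x] x LIMSEQ_unique by metis
  qed
qed

text \<open>The limit is the projection onto the closure of the union of the ranges. It converges because
  \<open>q n x\<close> is the closest point to \<open>x\<close> in the range of \<open>q n\<close>.\<close>

lemma incseq_lim_exists:
  fixes q :: "nat \<Rightarrow> 'h \<Rightarrow>\<^sub>L 'h"
  assumes q: "\<And>n. q n \<in> projs A" and inc: "\<And>n. op_le (q n) (q (Suc n))"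
  obtains p where "p \<in> projs A" "\<And>x. (\<lambda>n. q n x) \<longlonglongrightarrow> blinfun_apply p x"
proof -
  define U where "U = (\<Union>n. {x. q n x = x})"
  define S where "S = closure U"
  have U: "subspace U"
    unfolding subspace_def
  proof (intro conjI ballI allI)
    show "0 \<in> U" by (auto simp: U_def blinfun.zero_right)
    show "c *\<^sub>R x \<in> U" if "x \<in> U" for c x
      using that by (auto simp: U_def blinfun.scaleR_right)
    fix x y assume "x \<in> U" "y \<in> U"
    then obtain m n where mn: "q m x = x" "q n y = y" by (auto simp: U_def)
    then have "q (max m n) x = x" "q (max m n) y = y"
      using incseq_le[of q m "max m n", OF q inc] incseq_le[of q n "max m n", OF q inc]
      by (auto simp: le_iff q)
    then have "q (max m n) (x + y) = x + y" by (simp add: blinfun.add_right)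
    then show "x + y \<in> U" by (auto simp: U_def)
  qed
  have S: "subspace S" "closed S" unfolding S_def using subspace_closure[OF U] by auto
  have p: "proj_on S \<in> projs A"
  proof (rule proj_on_projs[OF S])
    fix R x assume R: "R \<in> commutant A" and x: "x \<in> S"
    have "R ` U \<subseteq> U" by (auto simp: U_def A_commute[OF projs_A[OF q] R])
    then have "R ` closure U \<subseteq> closure U"
      by (intro image_closure_subset continuous_intros closed_closure) (use closure_subset in blast)
    then show "R x \<in> S" using x by (auto simp: S_def)
  qed
  have "(\<lambda>n. q n x) \<longlonglongrightarrow> proj_on S x" for x
  proof (rule LIMSEQ_I)
    fix e :: real assume "e > 0"
    have "proj_on S x \<in> closure U" using proj_on_in[OF S] by (simp add: S_def)
    then obtain y where y: "y \<in> U" "dist y (proj_on S x) < e"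
      using \<open>e > 0\<close> closure_approachable by blast
    then obtain N where N: "q N y = y" by (auto simp: U_def)
    have "norm (q n x - proj_on S x) < e" if "n \<ge> N" for n
    proof -
      have le: "op_le (q n) (proj_on S)"
        unfolding le_iff[OF p q] proj_on_fix[OF S]
      proof (intro allI impI)
        fix z assume "q n z = z"
        then have "z \<in> U" unfolding U_def by blast
        then show "z \<in> S" unfolding S_def using closure_subset by blast
      qed
      have "q n y = y" using N incseq_le[of q, OF q inc that] by (simp add: le_iff q)
      then have "norm (proj_on S x - q n (proj_on S x)) \<le> norm (proj_on S x - y)"
        by (rule is_proj_closest[OF projs_is_proj[OF q]])
      then show ?thesis using y(2) le_absorb'[OF p q le]
        by (simp add: dist_norm norm_minus_commute)
    qed
    then show "\<exists>no. \<forall>n\<ge>no. norm (q n x - proj_on S x) < e" by blast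
  qed
  then show ?thesis using that p by blast
qed

lemma sum_projs:
  fixes p r :: "'h \<Rightarrow>\<^sub>L 'h"
  assumes "finite F" "F \<subseteq> projs A" "pairwise (\<lambda>p q. p o\<^sub>L q = 0) F"
  shows "\<Sum>F \<in> projs A" "p \<in> F \<Longrightarrow> op_le p (\<Sum>F)"
    "r \<in> projs A \<Longrightarrow> (\<And>p. p \<in> F \<Longrightarrow> op_le p r) \<Longrightarrow> op_le (\<Sum>F) r"
    "p \<in> F \<Longrightarrow> blinfun_apply p (\<Sum>F x) = p x"
proof -
  have app: "(\<Sum>F) x = (\<Sum>q\<in>F. blinfun_apply q x)" for x by (simp add: blinfun.sum_left)
  have PF: "p \<in> projs A" if "p \<in> F" for p using that assms by blast
  show abs: "p (\<Sum>F x) = p x" if "p \<in> F" for p x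
  proof -
    have "p (q x) = (if q = p then p x else 0)" if "q \<in> F" for q
      using that \<open>p \<in> F\<close> assms(3) orth_commute(1)[OF PF PF, of p q]
        is_proj_idem[OF projs_is_proj[OF PF]]
      by (auto simp: pairwise_def)
    then have "p (\<Sum>F x) = (\<Sum>q\<in>F. if q = p then p x else 0)"
      unfolding app blinfun.sum_right by (intro sum.cong) auto
    then show ?thesis using that assms(1) by simp
  qed
  have "\<Sum>F (\<Sum>F x) = \<Sum>F x" for x
  proof -
    have "\<Sum>F (\<Sum>F x) = (\<Sum>q\<in>F. blinfun_apply q (\<Sum>F x))" by (rule app)
    also have "\<dots> = (\<Sum>q\<in>F. blinfun_apply q x)" by (intro sum.cong refl abs)
    finally show ?thesis by (simp only: app)
  qed
  moreover have "rinner (\<Sum>F x) y = rinner x (\<Sum>F y)" for x y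
    by (simp add: app rinner.sum_left rinner.sum_right is_proj_rinner[OF projs_is_proj[OF PF]])
  moreover have "\<Sum>F \<in> A" using A_sum[OF assms(1), of "\<lambda>x. x"] PF projs_A by auto
  ultimately show s: "\<Sum>F \<in> projs A" by (auto intro!: projsI simp: is_proj_def A_bounded_ops)
  show "op_le p (\<Sum>F)" if "p \<in> F"
    unfolding le_iff[OF s PF[OF that]]
  proof (intro allI impI)
    fix x assume x: "p x = x"
    have "q x = (if q = p then x else 0)" if q: "q \<in> F" for q
      using x q \<open>p \<in> F\<close> assms(3) orth_commute(1)[OF PF PF, of q p x]
      by (auto simp: pairwise_def)
    then have "\<Sum>F x = (\<Sum>q\<in>F. if q = p then x else 0)"
      unfolding app by (intro sum.cong) auto
    then show "\<Sum>F x = x" using that assms(1) by simp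
  qed
  show "op_le (\<Sum>F) r" if r: "r \<in> projs A" "\<And>p. p \<in> F \<Longrightarrow> op_le p r"
    unfolding le_iff[OF r(1) s]
  proof (intro allI impI)
    fix x assume "\<Sum>F x = x"
    moreover have "r (\<Sum>F x) = \<Sum>F x"
      unfolding app blinfun.sum_right by (intro sum.cong refl le_absorb[OF r(1) PF r(2)])
    ultimately show "r x = x" by simp
  qed
qed

text \<open>The sum over a finite set \<open>F\<close> of members maps \<open>x\<close> to the closest point in a subspace that grows with
  \<open>F\<close>. So one finite set with a small error already controls all larger ones.\<close>

lemma orth_has_sum:
  fixes e :: "'h \<Rightarrow>\<^sub>L 'h"
  assumes E: "E \<subseteq> projs A" "pairwise (\<lambda>p q. p o\<^sub>L q = 0) E"
    and e: "e \<in> projs A" "\<And>p. p \<in> E \<Longrightarrow> op_le p e"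
    and approx: "\<And>\<epsilon>. \<epsilon> > 0 \<Longrightarrow> \<exists>F. finite F \<and> F \<subseteq> E \<and> norm (e x - \<Sum>F x) < \<epsilon>"
  shows "((\<lambda>p. blinfun_apply p x) has_sum e x) E"
  unfolding has_sum_def tendsto_iff eventually_finite_subsets_at_top
proof (intro allI impI)
  fix \<epsilon> :: real assume "\<epsilon> > 0"
  then obtain F where F: "finite F" "F \<subseteq> E" "norm (e x - \<Sum>F x) < \<epsilon>" using approx by blast
  have "dist (\<Sum>p\<in>G. blinfun_apply p x) (e x) < \<epsilon>" if G: "finite G" "F \<subseteq> G" "G \<subseteq> E" for G
  proof -
    have PG: "G \<subseteq> projs A" "pairwise (\<lambda>p q. p o\<^sub>L q = 0) G"
      using E G pairwise_subset by blast+
    have PF: "F \<subseteq> projs A" "pairwise (\<lambda>p q. p o\<^sub>L q = 0) F"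
      using E F pairwise_subset by blast+
    note sG = sum_projs(1)[OF G(1) PG] and sF = sum_projs(1)[OF F(1) PF]
    have "op_le (\<Sum>F) (\<Sum>G)"
      by (rule sum_projs(3)[OF F(1) PF sG]) (use sum_projs(2)[OF G(1) PG] G in blast)
    then have "\<Sum>G (\<Sum>F x) = \<Sum>F x" by (rule le_absorb[OF sG sF])
    moreover have "op_le (\<Sum>G) e"
      by (rule sum_projs(3)[OF G(1) PG e(1)]) (use e(2) G in blast)
    then have "\<Sum>G (e x) = \<Sum>G x" by (rule le_absorb'[OF e(1) sG])
    ultimately have "norm (e x - \<Sum>G x) \<le> norm (e x - \<Sum>F x)"
      using is_proj_closest[OF projs_is_proj[OF sG], of "\<Sum>F x" "e x"] by simp
    then show ?thesis using F(3) by (simp add: dist_norm norm_minus_commute blinfun.sum_left)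
  qed
  then show "\<exists>F. finite F \<and> F \<subseteq> E \<and> (\<forall>G. finite G \<and> F \<subseteq> G \<and> G \<subseteq> E \<longrightarrow>
      dist (\<Sum>p\<in>G. blinfun_apply p x) (e x) < \<epsilon>)"
    using F(1,2) by blast
qed

end

text \<open>Unit vectors in the ranges of nonzero orthogonal projections have distance at least one,
  so a countable dense set separates them.\<close>

lemma (in vna) orth_family_countable:
  assumes sep: "separable_space (euclidean :: 'h topology)"
    and E: "E \<subseteq> projs A" "pairwise (\<lambda>p q. p o\<^sub>L q = 0) E"
  shows "countable E"
proof -
  obtain D :: "'h set" where D: "countable D" "closure D = UNIV"
    using sep by (auto simp: separable_space_def)
  have "\<exists>x. p x = x \<and> norm x = 1" if "p \<in> E - {0}" for p
  proof -
    have "\<not> (\<forall>y. p y = 0)" using that blinfun_eqI[of p 0] by (auto simp: blinfun.zero_left)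
    then obtain y where y: "p y \<noteq> 0" by blast
    have "p (p y) = p y" using that E is_proj_idem projs_is_proj by blast
    then show ?thesis using y
      by (intro exI[of _ "inverse (norm (p y)) *\<^sub>R p y"]) (simp add: blinfun.scaleR_right)
  qed
  then obtain v where v: "\<And>p. p \<in> E - {0} \<Longrightarrow> blinfun_apply p (v p) = v p"
    "\<And>p. p \<in> E - {0} \<Longrightarrow> norm (v p) = 1" by metis
  have "\<exists>d\<in>D. dist d (v p) < 1/2" for p
    using D(2) closure_approachable[of "v p" D] by (metis UNIV_I half_gt_zero zero_less_one)
  then obtain f where f: "\<And>p. f p \<in> D" "\<And>p. dist (f p) (v p) < 1/2" by metis
  have "inj_on f (E - {0})"
  proof (rule inj_onI, rule ccontr)
    fix p q assume pq: "p \<in> E - {0}" "q \<in> E - {0}" "f p = f q" "p \<noteq> q"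
    have "dist (v p) (v q) < 1"
      using f(2)[of p] f(2)[of q] pq(3) dist_triangle3[of "v p" "v q" "f p"] by simp
    moreover have "p (q (v q)) = 0"
      using orth_commute(1)[of p q "v q"] pq E by (auto simp: pairwise_def)
    then have "p (v q) = 0" using v(1)[OF pq(2)] by simp
    then have "p (v p - v q) = v p" using v(1)[OF pq(1)] by (simp add: blinfun.diff_right)
    then have "norm (v p) \<le> norm (v p - v q)"
      using is_proj_norm_le[of p "v p - v q"] pq(1) E projs_is_proj by force
    ultimately show False using v(2)[OF pq(1)] by (simp add: dist_norm)
  qed
  then have "countable (E - {0})"
    using countable_image_inj_on countable_subset[OF _ D(1)] f(1) by (metis image_subsetI)
  then show ?thesis by simp
qed

section \<open>Square roots and spectral projections\<close>

instance complex_hilbert \<subseteq> banach ..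

definition self_adjoint :: "('h::complex_hilbert \<Rightarrow>\<^sub>L 'h) \<Rightarrow> bool" where
  "self_adjoint T \<longleftrightarrow> (\<forall>x y. rinner (T x) y = rinner x (T y))"

lemma self_adjointD:
  fixes T :: "'h::complex_hilbert \<Rightarrow>\<^sub>L 'h"
  shows "self_adjoint T \<Longrightarrow> rinner (T x) y = rinner x (T y)"
  by (simp add: self_adjoint_def)

lemma self_adjoint_compose:
  assumes "self_adjoint S" "self_adjoint T" "S o\<^sub>L T = T o\<^sub>L S"
  shows "self_adjoint (S o\<^sub>L T)"
  using assms unfolding self_adjoint_def by (metis blinfun_apply_blinfun_compose)

lemma self_adjoint_add: "self_adjoint S \<Longrightarrow> self_adjoint T \<Longrightarrow> self_adjoint (S + T)"
  by (simp add: self_adjoint_def blinfun.bilinear_simps rinner_simps)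

lemma self_adjoint_diff: "self_adjoint S \<Longrightarrow> self_adjoint T \<Longrightarrow> self_adjoint (S - T)"
  by (simp add: self_adjoint_def blinfun.bilinear_simps rinner_simps)

lemma self_adjoint_scaleR: "self_adjoint T \<Longrightarrow> self_adjoint (r *\<^sub>R T)"
  by (simp add: self_adjoint_def blinfun.bilinear_simps rinner_simps)

lemma self_adjoint_id: "self_adjoint id_blinfun"
  by (simp add: self_adjoint_def)

lemma self_adjoint_0: "self_adjoint 0"
  by (simp add: self_adjoint_def rinner.zero_left rinner.zero_right)

lemma is_proj_self_adjoint: "is_proj p \<Longrightarrow> self_adjoint p"
  by (simp add: is_proj_def self_adjoint_def)

lemma closed_self_adjoint: "closed {T. self_adjoint T}"
  unfolding self_adjoint_def
  by (intro closed_Collect_all closed_Collect_eq rinner.continuous_on continuous_intros)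

interpretation compose: bounded_bilinear "(o\<^sub>L)"
  by (rule bounded_bilinear_blinfun_compose)

lemmas blinfun_compose_simps = compose.add_left compose.add_right compose.diff_left
  compose.diff_right compose.scaleR_left compose.scaleR_right

lemma blinfun_compose_id [simp]: "id_blinfun o\<^sub>L T = T" "T o\<^sub>L id_blinfun = T"
  by (auto intro!: blinfun_eqI)

lemma blinfun_compose_assoc: "(R o\<^sub>L S) o\<^sub>L T = R o\<^sub>L (S o\<^sub>L T)"
  by (auto intro!: blinfun_eqI)

text \<open>Square roots and inverses of \<open>X\<close> are constructed inside this norm-closed set. That gives
  at once that they lie in \<open>A\<close>, are self-adjoint, and commute with each other and with whatever
  commutes with \<open>X\<close>.\<close>

definition sa_bicommutant ::
  "('h::complex_hilbert \<Rightarrow>\<^sub>L 'h) set \<Rightarrow> ('h \<Rightarrow>\<^sub>L 'h) \<Rightarrow> ('h \<Rightarrow>\<^sub>L 'h) set" where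
  "sa_bicommutant A X = A \<inter> {B. self_adjoint B} \<inter> {B. \<forall>R. R o\<^sub>L X = X o\<^sub>L R \<longrightarrow> R o\<^sub>L B = B o\<^sub>L R}"

lemma sa_bicommutant_commute: "B \<in> sa_bicommutant A X \<Longrightarrow> R o\<^sub>L X = X o\<^sub>L R \<Longrightarrow> R o\<^sub>L B = B o\<^sub>L R"
  and sa_bicommutant_A: "B \<in> sa_bicommutant A X \<Longrightarrow> B \<in> A"
  and sa_bicommutant_self_adjoint: "B \<in> sa_bicommutant A X \<Longrightarrow> self_adjoint B"
  by (auto simp: sa_bicommutant_def)

lemma sa_bicommutant_commute2:
  assumes "B \<in> sa_bicommutant A X" "C \<in> sa_bicommutant A X"
  shows "B o\<^sub>L C = C o\<^sub>L B"
  using assms sa_bicommutant_commute[OF assms(1), of X] sa_bicommutant_commute[of C A X B] by simp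

lemma (in vna) closed_sa_bicommutant: "closed (sa_bicommutant A X)"
proof -
  have "closed {B. R o\<^sub>L X = X o\<^sub>L R \<longrightarrow> R o\<^sub>L B = B o\<^sub>L R}" for R :: "'h \<Rightarrow>\<^sub>L 'h"
    by (cases "R o\<^sub>L X = X o\<^sub>L R")
      (auto intro!: closed_Collect_eq compose.continuous_on continuous_intros)
  then show ?thesis unfolding sa_bicommutant_def
    by (intro closed_Int A_closed closed_self_adjoint closed_Collect_all)
qed

lemma (in vna)
  assumes "X \<in> A" "self_adjoint X"
  shows sa_bicommutant_self: "X \<in> sa_bicommutant A X"
    and sa_bicommutant_id: "id_blinfun \<in> sa_bicommutant A X"
    and sa_bicommutant_0: "0 \<in> sa_bicommutant A X"
  using assms by (auto simp: sa_bicommutant_def self_adjoint_id self_adjoint_0 A_id A_0)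

lemma (in vna)
  assumes "B \<in> sa_bicommutant A X" "C \<in> sa_bicommutant A X"
  shows sa_bicommutant_add: "B + C \<in> sa_bicommutant A X"
    and sa_bicommutant_diff: "B - C \<in> sa_bicommutant A X"
    and sa_bicommutant_compose: "B o\<^sub>L C \<in> sa_bicommutant A X"
proof -
  show "B + C \<in> sa_bicommutant A X"  "B - C \<in> sa_bicommutant A X"
    using assms by (auto simp: sa_bicommutant_def A_add A_diff self_adjoint_add self_adjoint_diff
        blinfun_compose_simps)
  have "R o\<^sub>L (B o\<^sub>L C) = (B o\<^sub>L C) o\<^sub>L R" if R: "R o\<^sub>L X = X o\<^sub>L R" for R
    using sa_bicommutant_commute[OF assms(1) R] sa_bicommutant_commute[OF assms(2) R]
    by (metis blinfun_compose_assoc)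
  moreover have "B o\<^sub>L C \<in> A" using assms by (auto intro: A_compose sa_bicommutant_A)
  moreover have "self_adjoint (B o\<^sub>L C)"
    using assms sa_bicommutant_commute2 by (blast intro: self_adjoint_compose sa_bicommutant_self_adjoint)
  ultimately show "B o\<^sub>L C \<in> sa_bicommutant A X" unfolding sa_bicommutant_def by blast
qed

lemma (in vna) sa_bicommutant_scaleR:
  "B \<in> sa_bicommutant A X \<Longrightarrow> r *\<^sub>R B \<in> sa_bicommutant A X"
  by (auto simp: sa_bicommutant_def A_scaleR self_adjoint_scaleR blinfun_compose_simps)

text \<open>The iteration \<open>B \<mapsto> (X + B\<^sup>2) / 2\<close> for \<open>B\<close> with \<open>(1 - B)\<^sup>2 = 1 - X\<close> is dominated, increment by
  increment, by the same iteration for the number \<open>1\<close> in place of \<open>X\<close>, which increases to \<open>1\<close>.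
  Hence it converges in norm even in the borderline case of a norm equal to one.\<close>

lemma quadratic_iteration_converges:
  fixes X :: "'h::banach \<Rightarrow>\<^sub>L 'h"
  assumes X: "norm X \<le> 1"
    and C: "closed C" "0 \<in> C" "\<And>B. B \<in> C \<Longrightarrow> (1/2) *\<^sub>R (X + (B o\<^sub>L B)) \<in> C"
  obtains B where "B \<in> C" "norm B \<le> 1" "B + B = X + (B o\<^sub>L B)"
proof -
  define b where "b = rec_nat 0 (\<lambda>_ B. (1/2) *\<^sub>R (X + (B o\<^sub>L B)))"
  define r where "r = rec_nat (0::real) (\<lambda>_ t. (1 + t\<^sup>2) / 2)"
  have b: "b 0 = 0" "b (Suc n) = (1/2) *\<^sub>R (X + (b n o\<^sub>L b n))" for n by (simp_all add: b_def)
  have r: "r 0 = 0" "r (Suc n) = (1 + (r n)\<^sup>2) / 2" for n by (simp_all add: r_def)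
  have r01: "0 \<le> r n \<and> r n \<le> 1" for n
    by (induction n) (auto simp: r power_le_one)
  have rinc: "r n \<le> r (Suc n)" for n
    using zero_le_power2[of "1 - r n"] by (simp add: r power2_diff)
  have step: "norm (b n) \<le> r n \<and> norm (b (Suc n) - b n) \<le> r (Suc n) - r n" for n
  proof (induction n)
    case 0
    then show ?case using X by (simp add: b r compose.zero_left)
  next
    case (Suc n)
    have n1: "norm (b (Suc n)) \<le> r (Suc n)"
      using Suc norm_triangle_ineq[of "b n" "b (Suc n) - b n"] by simp
    define D where "D = b (Suc n) - b n"
    have "b (Suc (Suc n)) - b (Suc n) = (1/2) *\<^sub>R ((b (Suc n) o\<^sub>L D) + (D o\<^sub>L b n))"
      unfolding b(2)[of "Suc n"] D_def
      by (subst (3) b(2)) (simp add: blinfun_compose_simps algebra_simps flip: scaleR_diff_right)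
    also have "norm \<dots> \<le> (1/2) * (norm (b (Suc n)) * norm D + norm D * norm (b n))"
      using norm_triangle_ineq[of "b (Suc n) o\<^sub>L D" "D o\<^sub>L b n"]
        norm_blinfun_compose[of "b (Suc n)" D] norm_blinfun_compose[of D "b n"] by simp
    also have "\<dots> \<le> (1/2) * (r (Suc n) * (r (Suc n) - r n) + (r (Suc n) - r n) * r n)"
      using Suc n1 r01[of n] r01[of "Suc n"] rinc[of n] unfolding D_def
      by (intro mult_left_mono add_mono mult_mono) auto
    also have "\<dots> = r (Suc (Suc n)) - r (Suc n)"
      by (simp add: r(2)[of "Suc n"]) (simp add: r(2)[of n] field_simps power2_eq_square)
    finally show ?case using n1 by simp
  qed
  have mono: "norm (b n - b m) \<le> r n - r m" if "m \<le> n" for m n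
    using that
  proof (induction n rule: dec_induct)
    case (step k)
    have "norm (b (Suc k) - b m) \<le> norm (b (Suc k) - b k) + norm (b k - b m)"
      using norm_triangle_ineq[of "b (Suc k) - b k" "b k - b m"] by simp
    then show ?case using step.IH \<open>\<And>n. norm (b n) \<le> r n \<and> norm (b (Suc n) - b n) \<le> r (Suc n) - r n\<close>[of k] by linarith
  qed simp
  have "incseq r" using rinc by (rule incseq_SucI)
  then obtain l where "r \<longlonglongrightarrow> l" using incseq_convergent[of r 1] r01 by blast
  then have Cr: "Cauchy r" by (rule LIMSEQ_imp_Cauchy)
  have "Cauchy b"
  proof (rule CauchyI)
    fix e :: real assume "e > 0"
    then obtain M where M: "\<And>m n. m \<ge> M \<Longrightarrow> n \<ge> M \<Longrightarrow> norm (r m - r n) < e"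
      using CauchyD[OF Cr] by blast
    have "norm (b m - b n) < e" if mn: "m \<ge> M" "n \<ge> M" for m n
    proof (cases "m \<le> n")
      case True
      then show ?thesis using mono[OF True] M[OF mn(2,1)] by (simp add: norm_minus_commute)
    next
      case False
      then show ?thesis using mono[of n m] M[OF mn] by simp
    qed
    then show "\<exists>M. \<forall>m\<ge>M. \<forall>n\<ge>M. norm (b m - b n) < e" by blast
  qed
  then obtain B where B: "b \<longlonglongrightarrow> B" using Cauchy_convergent convergent_def by blast
  have bC: "b n \<in> C" for n by (induction n) (auto simp: b C)
  have "B \<in> C" using closed_sequentially[OF C(1)] bC B by blast
  moreover have "norm B \<le> 1"
    by (rule LIMSEQ_le_const2[OF tendsto_norm[OF B]]) (use step r01 order_trans in blast)
  moreover have "B = (1/2) *\<^sub>R (X + (B o\<^sub>L B))"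
  proof (rule LIMSEQ_unique)
    show "(\<lambda>n. b (Suc n)) \<longlonglongrightarrow> B" by (rule LIMSEQ_Suc[OF B])
    show "(\<lambda>n. b (Suc n)) \<longlonglongrightarrow> (1/2) *\<^sub>R (X + (B o\<^sub>L B))"
      unfolding b by (intro tendsto_intros compose.tendsto B)
  qed
  then have "2 *\<^sub>R B = X + (B o\<^sub>L B)" by (metis scaleR_half_double scaleR_2 scaleR_right_distrib)
  ultimately show ?thesis using that by (simp add: scaleR_2)
qed

text \<open>Writing \<open>T = 1 - X\<close>, the square root is \<open>1 - B\<close> for the limit \<open>B\<close> of the quadratic iteration. It is
  positive because \<open>B\<close> has norm at most one.\<close>

lemma (in vna) positive_sqrt_exists:
  assumes T: "T \<in> A" "self_adjoint T" "norm (id_blinfun - T) \<le> 1"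
  obtains P where "P \<in> sa_bicommutant A T" "P o\<^sub>L P = T" "\<And>x. 0 \<le> rinner (blinfun_apply P x) x"
proof -
  define X where "X = id_blinfun - T"
  note mem = sa_bicommutant_self[OF T(1,2)] sa_bicommutant_id[OF T(1,2)]
  have X: "X \<in> sa_bicommutant A T" unfolding X_def by (rule sa_bicommutant_diff[OF mem(2,1)])
  have "\<And>B. B \<in> sa_bicommutant A T \<Longrightarrow> (1/2) *\<^sub>R (X + (B o\<^sub>L B)) \<in> sa_bicommutant A T"
    by (intro sa_bicommutant_scaleR sa_bicommutant_add sa_bicommutant_compose X)
  then obtain B where B: "B \<in> sa_bicommutant A T" "norm B \<le> 1" "B + B = X + (B o\<^sub>L B)"
    using quadratic_iteration_converges[of X "sa_bicommutant A T"] T(3) closed_sa_bicommutant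
      sa_bicommutant_0[OF T(1,2)] unfolding X_def by blast
  define P where "P = id_blinfun - B"
  have "P \<in> sa_bicommutant A T" unfolding P_def by (rule sa_bicommutant_diff[OF mem(2) B(1)])
  moreover have "P o\<^sub>L P = T"
  proof -
    have "P o\<^sub>L P = id_blinfun - (B + B) + (B o\<^sub>L B)"
      by (simp add: P_def blinfun_compose_simps algebra_simps)
    then show ?thesis by (simp add: B(3) X_def)
  qed
  moreover have "0 \<le> rinner (P x) x" for x
  proof -
    have "rinner (B x) x \<le> norm (B x) * norm x" by (rule rinner_le_norm)
    also have "\<dots> \<le> (norm B * norm x) * norm x" by (intro mult_right_mono norm_blinfun) auto
    also have "\<dots> \<le> (1 * norm x) * norm x" by (intro mult_right_mono B(2)) auto
    finally have "rinner (B x) x \<le> (norm x)\<^sup>2" by (simp add: power2_eq_square)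
    then show ?thesis by (simp add: P_def blinfun.diff_left rinner_simps norm_sq_rinner)
  qed
  ultimately show ?thesis using that by blast
qed

text \<open>The form of \<open>B\<close> is nonnegative at \<open>x - t B x\<close>; the choice \<open>t = 1 / m\<close> turns this into the norm
  estimate.\<close>

lemma norm_positive_le:
  fixes B :: "'h::complex_hilbert \<Rightarrow>\<^sub>L 'h"
  assumes B: "self_adjoint B" and m: "m > 0"
    and pos: "\<And>x. 0 \<le> rinner (B x) x" and le: "\<And>x. rinner (B x) x \<le> m * (norm x)\<^sup>2"
  shows "norm B \<le> m"
proof (rule norm_blinfun_bound)
  show "0 \<le> m" using m by simp
  fix x
  define t where "t = 1 / m"
  define n where "n = (norm (B x))\<^sup>2"
  have n: "rinner (B x) (B x) = n" by (simp add: n_def norm_sq_rinner)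
  have "0 \<le> rinner (B (x - t *\<^sub>R B x)) (x - t *\<^sub>R B x)" by (rule pos)
  also have "\<dots> = rinner (B x) x - 2 * t * n + t\<^sup>2 * rinner (B (B x)) (B x)"
    by (simp add: blinfun.bilinear_simps rinner_simps power2_eq_square n
        self_adjointD[OF B, of "B x" x] algebra_simps)
  also have "\<dots> \<le> m * (norm x)\<^sup>2 - 2 * t * n + t\<^sup>2 * (m * n)"
    using le[of x] le[of "B x"] by (intro add_mono mult_left_mono) (auto simp: n_def)
  also have "t\<^sup>2 * (m * n) = t * n" using m by (simp add: t_def power2_eq_square)
  finally have "t * n \<le> m * (norm x)\<^sup>2" by (simp add: mult_ac)
  then have "n \<le> m * (m * (norm x)\<^sup>2)" using m by (simp add: t_def field_simps)
  then have "(norm (B x))\<^sup>2 \<le> (m * norm x)\<^sup>2" by (simp add: n_def power2_eq_square mult_ac)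
  then show "norm (B x) \<le> m * norm x" by (rule power2_le_imp_le) (use m in simp)
qed

text \<open>Let \<open>P\<close> be the absolute value of \<open>S\<close>, the square root of \<open>S\<^sup>2\<close>, and let \<open>e\<close> project onto the kernel of
  \<open>P + S\<close>. On that kernel \<open>S = - P\<close> is negative. Since \<open>(P + S) (P - S) = 0\<close>, the operator \<open>P - S\<close>
  vanishes on the orthogonal complement, where therefore \<open>S = P\<close> is positive.\<close>

lemma (in vna) spectral_cut:
  fixes S :: "'h \<Rightarrow>\<^sub>L 'h"
  assumes S: "S \<in> A" "self_adjoint S"
  obtains e where "e \<in> projs A"
    "\<And>x. e x = x \<Longrightarrow> rinner (S x) x \<le> 0"
    "\<And>x. blinfun_apply e x = 0 \<Longrightarrow> 0 \<le> rinner (S x) x"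
    "\<And>R x. self_adjoint R \<Longrightarrow> (\<And>x. R (S x) = S (R x)) \<Longrightarrow> e (blinfun_apply R x) = R (e x)"
proof -
  \<comment> \<open>Rescaling to norm at most one makes the square root of \<open>S\<^sup>2\<close> available; signs are unaffected.\<close>
  define c where "c = 1 / (norm S + 1)"
  have N: "norm S + 1 > 0" by (simp add: add_nonneg_pos)
  then have c: "c > 0" by (simp add: c_def)
  have cN: "c * norm S \<le> 1" using N by (simp add: c_def divide_le_eq)
  define S' where "S' = c *\<^sub>R S"
  have S': "S' \<in> A" "self_adjoint S'" using S by (auto simp: S'_def A_scaleR self_adjoint_scaleR)
  have nS': "norm (S' x) \<le> norm x" for x
  proof -
    have "norm (S' x) \<le> c * (norm S * norm x)"
      using norm_blinfun[of S x] c by (simp add: S'_def blinfun.scaleR_left)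
    also have "\<dots> = (c * norm S) * norm x" by simp
    also have "\<dots> \<le> 1 * norm x" by (intro mult_right_mono cN) simp
    finally show ?thesis by simp
  qed
  define T where "T = S' o\<^sub>L S'"
  have T: "T \<in> A" "self_adjoint T"
    using S' by (auto simp: T_def A_compose self_adjoint_compose)
  have TT: "rinner (T x) x = (norm (S' x))\<^sup>2" for x
    by (simp add: T_def self_adjointD[OF S'(2), of "S' x" x] norm_sq_rinner)
  have "norm (id_blinfun - T) \<le> 1"
  proof (rule norm_positive_le)
    show "self_adjoint (id_blinfun - T)" by (intro self_adjoint_diff self_adjoint_id T)
    fix x
    have *: "rinner ((id_blinfun - T) x) x = (norm x)\<^sup>2 - (norm (S' x))\<^sup>2"
      using TT[of x] by (simp add: blinfun.diff_left rinner.diff_left norm_sq_rinner)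
    show "0 \<le> rinner ((id_blinfun - T) x) x" unfolding * using nS'[of x] by simp
    show "rinner ((id_blinfun - T) x) x \<le> 1 * (norm x)\<^sup>2" unfolding * by simp
  qed simp
  then obtain P where P: "P \<in> sa_bicommutant A T" "P o\<^sub>L P = T"
    "\<And>x. 0 \<le> rinner (blinfun_apply P x) x" using positive_sqrt_exists[OF T] by blast
  note PA = sa_bicommutant_A[OF P(1)] and Psa = sa_bicommutant_self_adjoint[OF P(1)]
  have comm: "P (R x) = R (P x)" if "\<And>x. R (S x) = S (blinfun_apply R x)" for R :: "'h \<Rightarrow>\<^sub>L 'h" and x
  proof -
    have "R o\<^sub>L T = T o\<^sub>L R"
      by (rule blinfun_eqI) (simp add: T_def S'_def blinfun.bilinear_simps that)
    from sa_bicommutant_commute[OF P(1) this] show ?thesis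
      by (metis blinfun_apply_blinfun_compose)
  qed
  have PS0: "P (S x) = S (P x)" for x by (rule comm) simp
  have PS: "P (S' x) = S' (P x)" for x by (simp add: S'_def blinfun.bilinear_simps PS0)
  have PP: "P (P x) = S' (S' x)" for x using P(2) T_def by (metis blinfun_apply_blinfun_compose)
  define D where "D = P + S'"
  have D: "D \<in> A" "\<And>x. D x = P x + S' x"
    by (auto simp: D_def A_add PA S'(1) blinfun.add_left)
  define K where "K = {x. D x = 0}"
  have K: "subspace K" by (auto simp: K_def subspace_def blinfun.bilinear_simps)
  have Kc: "closed K" unfolding K_def by (intro closed_Collect_eq continuous_intros)
  define e where "e = proj_on K"
  have e: "e \<in> projs A" unfolding e_def
    by (rule proj_on_projs[OF K Kc]) (simp add: K_def A_commute[OF D(1)] blinfun.zero_right)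
  have efix: "e x = x \<longleftrightarrow> P x + S' x = 0" for x
    unfolding e_def proj_on_fix[OF K Kc] by (simp add: K_def D(2))
  have ecomm: "e (R x) = R (e x)"
    if R: "self_adjoint R" "\<And>x. R (S x) = S (blinfun_apply R x)" for R :: "'h \<Rightarrow>\<^sub>L 'h" and x
  proof -
    have ere: "e (R (e x)) = R (e x)" for x
    proof -
      have "P (e x) + S' (e x) = 0" using efix is_proj_idem[OF projs_is_proj[OF e]] by blast
      then have "R (P (e x)) + R (S' (e x)) = 0" by (simp flip: blinfun.add_right)
      then show ?thesis unfolding efix by (simp add: comm[OF R(2)] S'_def blinfun.bilinear_simps R(2))
    qed
    have "rinner (e (R x) - R (e x)) y = 0" for y
    proof -
      have "rinner (e (R x)) y = rinner x (e (R (e y)))"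
        by (simp add: ere is_proj_rinner[OF projs_is_proj[OF e]] self_adjointD[OF R(1)])
      also have "\<dots> = rinner (e (R (e x))) y"
        by (simp only: is_proj_rinner[OF projs_is_proj[OF e]] self_adjointD[OF R(1)])
      finally show ?thesis by (simp add: ere rinner.diff_left)
    qed
    then show ?thesis using rinner_eq_0_imp by fastforce
  qed
  have "rinner (S x) x \<le> 0" if "e x = x" for x
  proof -
    have "S' x = - P x" using that efix by (metis add.commute eq_neg_iff_add_eq_0)
    then have "c * rinner (S x) x \<le> 0"
      using P(3)[of x] by (simp add: S'_def blinfun.scaleR_left flip: rinner_scaleR_left)
        (simp add: rinner.minus_left)
    then show ?thesis using c by (simp add: mult_le_0_iff)
  qed
  moreover have "0 \<le> rinner (S x) x" if "e x = 0" for x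
  proof -
    define y where "y = P x - S' x"
    have "P y + S' y = 0" by (simp add: y_def blinfun.diff_right PP PS)
    then have "e y = y" using efix by blast
    moreover have "e y = P (e x) - S' (e x)"
      unfolding y_def blinfun.diff_right
      using ecomm[OF Psa PS0] ecomm[OF S(2)] by (simp add: S'_def blinfun.bilinear_simps)
    ultimately have "y = 0" using that by (simp add: blinfun.zero_right)
    then have "c * rinner (S x) x = rinner (P x) x"
      by (simp add: y_def S'_def blinfun.scaleR_left flip: rinner_scaleR_left)
    then have "0 \<le> c * rinner (S x) x" using P(3)[of x] by simp
    then show ?thesis using c by (simp add: zero_le_mult_iff)
  qed
  ultimately show ?thesis using that e ecomm by blast
qed

section \<open>Polar decomposition of operators bounded below\<close>

text \<open>The inverse is the fixed point of the contraction \<open>Y \<mapsto> 1 + (1 - T) Y\<close>.\<close>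

lemma (in vna) inverse_exists:
  assumes T: "T \<in> A" "self_adjoint T" "norm (id_blinfun - T) < 1"
  obtains Y where "Y \<in> sa_bicommutant A T" "T o\<^sub>L Y = id_blinfun"
proof -
  define X where "X = id_blinfun - T"
  note mem = sa_bicommutant_self[OF T(1,2)] sa_bicommutant_id[OF T(1,2)]
  have X: "X \<in> sa_bicommutant A T" unfolding X_def by (rule sa_bicommutant_diff[OF mem(2,1)])
  have "\<exists>!Y\<in>sa_bicommutant A T. id_blinfun + (X o\<^sub>L Y) = Y"
  proof (rule Banach_fix)
    show "complete (sa_bicommutant A T)" using closed_sa_bicommutant complete_eq_closed by blast
    show "sa_bicommutant A T \<noteq> {}" using mem by blast
    show "0 \<le> norm X" "norm X < 1" using T(3) by (auto simp: X_def)
    show "(\<lambda>Y. id_blinfun + (X o\<^sub>L Y)) ` sa_bicommutant A T \<subseteq> sa_bicommutant A T"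
      using sa_bicommutant_add[OF mem(2) sa_bicommutant_compose[OF X]] by blast
    have "norm ((id_blinfun + (X o\<^sub>L Y)) - (id_blinfun + (X o\<^sub>L Z))) \<le> norm X * norm (Y - Z)" for Y Z
      using norm_blinfun_compose[of X "Y - Z"] by (simp add: compose.diff_right)
    then show "dist (id_blinfun + (X o\<^sub>L Y)) (id_blinfun + (X o\<^sub>L Z)) \<le> norm X * dist Y Z" for Y Z
      by (simp only: dist_norm)
  qed
  then obtain Y where Y: "Y \<in> sa_bicommutant A T" "id_blinfun + (X o\<^sub>L Y) = Y" by blast
  have "T o\<^sub>L Y = Y - (X o\<^sub>L Y)" by (simp add: X_def blinfun_compose_simps)
  also have "\<dots> = id_blinfun" using Y(2) by (metis add_diff_cancel_right')
  finally show ?thesis using that Y(1) by blast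
qed

text \<open>Up to the factor \<open>c\<close>, the operator \<open>S\<close> is \<open>K* K\<close> on the range of \<open>r\<close> and the identity on its complement. It is
  bounded below, so it has an inverse square root \<open>Q\<close>, and \<open>u = K Q r / sqrt c\<close> is isometric on the range
  of \<open>r\<close>. The last conclusion records that the range of \<open>u\<close> is contained in that of \<open>K\<close>.\<close>

lemma (in vna) polar_decomposition:
  fixes K :: "'h \<Rightarrow>\<^sub>L 'h"
  assumes K: "K \<in> A" "K o\<^sub>L r = K" and r: "r \<in> projs A"
    and \<delta>: "\<delta> > 0" "\<And>x. r x = x \<Longrightarrow> \<delta> * norm x \<le> norm (K x)"
  obtains u u' W where "u \<in> A" "u' \<in> A" "is_adjoint u' u" "u' o\<^sub>L u = r" "u = K o\<^sub>L W"
proof -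
  obtain K' where K': "K' \<in> A" "is_adjoint K' K" using A_adjoint_exists[OF K(1)] by blast
  note adj = is_adjoint_rinnerD[OF K'(2)]
  note rp = projs_is_proj[OF r] and rA = projs_A[OF r]
  define c where "c = max ((norm K)\<^sup>2) (\<delta>\<^sup>2)"
  have c: "c > 0" "(norm K)\<^sup>2 \<le> c" "\<delta>\<^sup>2 \<le> c" using \<delta>(1) by (auto simp: c_def less_max_iff_disj)
  define T where "T = (1/c) *\<^sub>R (K' o\<^sub>L K)"
  define S where "S = T + (id_blinfun - r)"
  have Kr: "K (r x) = K x" for x using K(2) by (metis blinfun_apply_blinfun_compose)
  have rK': "r (K' x) = K' x" for x
  proof -
    have "rinner (r (K' x) - K' x) y = 0" for y
    proof -
      have "rinner (r (K' x)) y = rinner y (r (K' x))" by (rule rinner_commute)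
      also have "\<dots> = rinner (K (r y)) x" by (simp add: adj is_proj_rinner[OF rp])
      also have "\<dots> = rinner (K' x) y" unfolding Kr by (metis adj rinner_commute)
      finally show ?thesis by (simp add: rinner.diff_left)
    qed
    then show ?thesis using rinner_eq_0_imp by fastforce
  qed
  have Tsa: "self_adjoint T" unfolding self_adjoint_def
  proof (intro allI)
    fix x y
    have "rinner (K' (K x)) y = rinner (K x) (K y)" by (metis adj rinner_commute)
    moreover have "rinner x (K' (K y)) = rinner (K x) (K y)" by (simp add: adj)
    ultimately show "rinner (T x) y = rinner x (T y)"
      by (simp add: T_def blinfun.scaleR_left rinner_simps)
  qed
  have SA: "S \<in> A" unfolding S_def T_def
    by (intro A_add A_scaleR A_compose K K' A_diff A_id rA)
  have Ssa: "self_adjoint S" unfolding S_def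
    by (intro self_adjoint_add Tsa self_adjoint_diff self_adjoint_id is_proj_self_adjoint[OF rp])
  have rS: "r o\<^sub>L S = S o\<^sub>L r"
    by (rule blinfun_eqI) (simp add: S_def T_def blinfun.bilinear_simps Kr rK' is_proj_idem[OF rp])
  have S: "rinner (S x) x = (norm (K x))\<^sup>2 / c + (norm (x - r x))\<^sup>2" for x
  proof -
    have "rinner (K' (K x)) x = (norm (K x))\<^sup>2" by (metis adj rinner_commute norm_sq_rinner)
    moreover have "rinner (x - r x) x = (norm (x - r x))\<^sup>2"
      using is_proj_pythagoras[OF rp, of x] is_proj_norm_sq[OF rp, of x] norm_sq_rinner[of x]
        rinner.diff_left[of x "r x" x] by linarith
    ultimately show ?thesis
      by (simp add: S_def T_def blinfun.bilinear_simps rinner.add_left rinner_scaleR_left)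
  qed
  have lower: "(\<delta>\<^sup>2 / c) * (norm x)\<^sup>2 \<le> rinner (S x) x" for x
  proof -
    have "\<delta> * norm (r x) \<le> norm (K x)" using \<delta>(2)[of "r x"] is_proj_idem[OF rp] Kr by simp
    then have "(\<delta> * norm (r x))\<^sup>2 \<le> (norm (K x))\<^sup>2" using \<delta>(1) by (intro power_mono) auto
    then have a: "(\<delta>\<^sup>2 / c) * (norm (r x))\<^sup>2 \<le> (norm (K x))\<^sup>2 / c"
      using c(1) by (simp add: power_mult_distrib divide_right_mono)
    have b: "(\<delta>\<^sup>2 / c) * (norm (x - r x))\<^sup>2 \<le> 1 * (norm (x - r x))\<^sup>2"
      using c by (intro mult_right_mono) auto
    have "(norm x)\<^sup>2 = (norm (r x))\<^sup>2 + (norm (x - r x))\<^sup>2" by (simp add: is_proj_pythagoras[OF rp])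
    then show ?thesis using a b unfolding S by (simp only: distrib_left)
  qed
  have upper: "rinner (S x) x \<le> (norm x)\<^sup>2" for x
  proof -
    have "norm (K x) \<le> norm K * norm (r x)" using norm_blinfun[of K "r x"] Kr by simp
    then have "(norm (K x))\<^sup>2 \<le> (norm K)\<^sup>2 * (norm (r x))\<^sup>2"
      by (metis norm_ge_zero power_mono power_mult_distrib)
    also have "\<dots> \<le> c * (norm (r x))\<^sup>2" by (intro mult_right_mono c) simp
    finally have "(norm (K x))\<^sup>2 / c \<le> (norm (r x))\<^sup>2" using c(1) by (simp add: divide_le_eq mult.commute)
    then show ?thesis unfolding S by (simp add: is_proj_pythagoras[OF rp])
  qed
  define m where "m = max (1 - \<delta>\<^sup>2 / c) (1/2)"
  have m: "m > 0" "m < 1" using \<delta>(1) c(1) by (auto simp: m_def)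
  have nS: "norm (id_blinfun - S) \<le> m"
  proof (rule norm_positive_le[OF _ m(1)])
    show "self_adjoint (id_blinfun - S)" by (intro self_adjoint_diff self_adjoint_id Ssa)
    fix x
    have *: "rinner ((id_blinfun - S) x) x = (norm x)\<^sup>2 - rinner (S x) x"
      by (simp add: blinfun.diff_left rinner.diff_left norm_sq_rinner)
    show "0 \<le> rinner ((id_blinfun - S) x) x" unfolding * using upper by simp
    have "(1 - \<delta>\<^sup>2 / c) * (norm x)\<^sup>2 \<le> m * (norm x)\<^sup>2"
      by (intro mult_right_mono) (auto simp: m_def)
    then show "rinner ((id_blinfun - S) x) x \<le> m * (norm x)\<^sup>2"
      unfolding * using lower[of x] by (simp add: left_diff_distrib)
  qed
  then have nS1: "norm (id_blinfun - S) < 1" using m(2) by simp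
  obtain P where P: "P \<in> sa_bicommutant A S" "P o\<^sub>L P = S"
    using positive_sqrt_exists[OF SA Ssa less_imp_le[OF nS1]] by blast
  obtain Y where Y: "Y \<in> sa_bicommutant A S" "S o\<^sub>L Y = id_blinfun"
    using inverse_exists[OF SA Ssa nS1] by blast
  define Q where "Q = Y o\<^sub>L P"
  have Q: "Q \<in> sa_bicommutant A S" unfolding Q_def by (rule sa_bicommutant_compose[OF Y(1) P(1)])
  have QSQ: "Q o\<^sub>L (S o\<^sub>L Q) = id_blinfun"
  proof -
    have PY: "P o\<^sub>L Y = Y o\<^sub>L P" by (rule sa_bicommutant_commute2[OF P(1) Y(1)])
    have SY: "Y o\<^sub>L S = id_blinfun"
      using sa_bicommutant_commute2[OF Y(1) sa_bicommutant_self[OF SA Ssa]] Y(2) by simp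
    have "Q o\<^sub>L (S o\<^sub>L Q) = Y o\<^sub>L (P o\<^sub>L ((S o\<^sub>L Y) o\<^sub>L P))"
      by (simp only: Q_def blinfun_compose_assoc)
    also have "\<dots> = id_blinfun" by (simp add: Y(2) P(2) SY)
    finally show ?thesis .
  qed
  have rQ: "r (Q x) = Q (r x)" for x
    using sa_bicommutant_commute[OF Q rS] by (metis blinfun_apply_blinfun_compose)
  have Qsa: "rinner (Q x) y = rinner x (Q y)" for x y
    by (rule self_adjointD[OF sa_bicommutant_self_adjoint[OF Q]])
  define W where "W = (1 / sqrt c) *\<^sub>R (Q o\<^sub>L r)"
  define u where "u = K o\<^sub>L W"
  define u' where "u' = (1 / sqrt c) *\<^sub>R (r o\<^sub>L (Q o\<^sub>L K'))"
  have uA: "u \<in> A" "u' \<in> A" unfolding u_def W_def u'_def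
    by (intro A_compose A_scaleR K K' rA sa_bicommutant_A[OF Q])+
  moreover have "is_adjoint u' u"
  proof (rule is_adjointI[OF A_bounded_ops[OF uA(2)]])
    fix x y
    have "rinner (K (Q (r x))) y = rinner x (r (Q (K' y)))"
      by (simp add: adj Qsa is_proj_rinner[OF rp])
    then show "rinner (u x) y = rinner x (u' y)"
      by (simp add: u_def u'_def W_def blinfun.bilinear_simps rinner_simps)
  qed
  moreover have "u' o\<^sub>L u = r"
  proof (rule blinfun_eqI)
    fix x
    define y where "y = Q (r x)"
    have y: "r y = y" by (simp add: y_def rQ is_proj_idem[OF rp])
    have QSy: "Q (S y) = r x"
      unfolding y_def using QSQ by (metis blinfun_apply_blinfun_compose blinfun_apply_id_blinfun)
    have Sy: "S y = (1/c) *\<^sub>R K' (K y)" by (simp add: S_def T_def blinfun.bilinear_simps y)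
    have "(u' o\<^sub>L u) x = (1 / sqrt c) *\<^sub>R (1 / sqrt c) *\<^sub>R r (Q (K' (K y)))"
      by (simp add: u'_def u_def W_def blinfun.bilinear_simps y_def)
    also have "\<dots> = r (Q (S y))" using c(1) by (simp add: Sy blinfun.bilinear_simps)
    also have "\<dots> = r x" by (simp add: QSy is_proj_idem[OF rp])
    finally show "(u' o\<^sub>L u) x = r x" .
  qed
  ultimately show ?thesis using that u_def by blast
qed

section \<open>No infinite families of equivalent orthogonal projections\<close>

lemma norm_sum_orth:
  assumes "finite I" "\<And>i j. i \<in> I \<Longrightarrow> j \<in> I \<Longrightarrow> i \<noteq> j \<Longrightarrow> rinner (v i) (v j) = 0"
  shows "(norm (\<Sum>i\<in>I. v i))\<^sup>2 = (\<Sum>i\<in>I. (norm (v i))\<^sup>2)"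
  using assms
proof (induction I rule: finite_induct)
  case (insert i I)
  have "rinner (v i) (\<Sum>j\<in>I. v j) = (\<Sum>j\<in>I. rinner (v i) (v j))" by (rule rinner.sum_right)
  also have "\<dots> = 0" using insert.prems insert.hyps by (intro sum.neutral) auto
  finally show ?case using insert by (simp add: norm_add_sq)
qed simp

lemma bessel_inequality:
  assumes I: "finite I" and orth: "\<And>i j. i \<in> I \<Longrightarrow> j \<in> I \<Longrightarrow> i \<noteq> j \<Longrightarrow> rinner (v i) (v j) = 0"
    and x: "\<And>i. i \<in> I \<Longrightarrow> rinner (v i) x = (norm (v i))\<^sup>2"
  shows "(\<Sum>i\<in>I. (norm (v i))\<^sup>2) \<le> (norm x)\<^sup>2"
proof -
  define n where "n = norm (\<Sum>i\<in>I. v i)"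
  have n2: "n\<^sup>2 = (\<Sum>i\<in>I. (norm (v i))\<^sup>2)" unfolding n_def by (rule norm_sum_orth[OF I orth])
  also have "\<dots> = rinner (\<Sum>i\<in>I. v i) x" by (simp add: rinner.sum_left x)
  also have "\<dots> \<le> n * norm x" unfolding n_def by (rule rinner_le_norm)
  finally have "n * n \<le> n * norm x" by (simp add: power2_eq_square)
  moreover have "n \<ge> 0" by (simp add: n_def)
  ultimately have "n \<le> norm x" by (cases "n = 0") auto
  then have "n\<^sup>2 \<le> (norm x)\<^sup>2" using \<open>n \<ge> 0\<close> by (rule power_mono)
  then show ?thesis by (simp only: n2)
qed

text \<open>The operators \<open>u n\<close> are partial isometries with common initial projection \<open>r\<close> and orthogonal
  ranges. The terms of the series are orthogonal, and their squared norms are those of the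
  components of \<open>x\<close> in the ranges of the \<open>u (b n)\<close>, so Bessel's inequality gives convergence. Different
  index maps \<open>a\<close> and \<open>b\<close> yield the shift along the ranges, its adjoint, and the projection onto
  their span.\<close>

lemma (in vna) matrix_unit_sum_exists:
  fixes u u' :: "nat \<Rightarrow> 'h \<Rightarrow>\<^sub>L 'h"
  assumes u: "\<And>n. u n \<in> A" "\<And>n. u' n \<in> A" "\<And>n. is_adjoint (u' n) (u n)"
    and r: "r \<in> projs A" "\<And>m n x. u' m (u n x) = (if m = n then blinfun_apply r x else 0)"
    and ab: "inj a" "inj b"
  obtains V where "V \<in> A" "\<And>x. (\<lambda>N. \<Sum>n<N. u (a n) (u' (b n) x)) \<longlonglongrightarrow> blinfun_apply V x"
proof -
  have adj: "rinner (u n x) y = rinner x (u' n y)" for n x y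
    by (rule is_adjoint_rinnerD[OF u(3)])
  have u_orth: "rinner (u m x) (u n y) = 0" if "m \<noteq> n" for m n x y
    using that by (simp add: adj r(2) rinner.zero_right)
  have norm_u: "(norm (u n x))\<^sup>2 = (norm (r x))\<^sup>2" for n x
    by (simp add: norm_sq_rinner adj r(2) is_proj_rinner[OF projs_is_proj[OF r(1)]]
        is_proj_idem[OF projs_is_proj[OF r(1)]])
  have ru': "r (u' n x) = u' n x" for n x
  proof -
    have "norm (u n (y - r y)) = 0" for y
      using norm_u[of n "y - r y"]
      by (simp add: blinfun.diff_right is_proj_idem[OF projs_is_proj[OF r(1)]])
    then have ur: "u n (r y) = u n y" for y by (simp add: blinfun.diff_right)
    have "rinner y (r (u' n x) - u' n x) = 0" for y
      by (simp add: rinner_simps ur flip: adj is_proj_rinner[OF projs_is_proj[OF r(1)]])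
    from rinner_right_eq_0_imp[OF this] show ?thesis by simp
  qed
  define t where "t n x = u (a n) (u' (b n) x)" for n x
  have t_norm: "(norm (t n x))\<^sup>2 = (norm (u' (b n) x))\<^sup>2" for n x
    by (simp add: t_def norm_u ru')
  have t_orth: "rinner (t m x) (t n x) = 0" if "m \<noteq> n" for m n x
    unfolding t_def using ab(1) that by (intro u_orth) (auto dest: injD)
  have bound: "(\<Sum>n\<in>I. (norm (t n x))\<^sup>2) \<le> (norm x)\<^sup>2" if "finite I" for I x
  proof -
    have "(norm (u (b n) (u' (b n) x)))\<^sup>2 = (norm (t n x))\<^sup>2" for n
      by (simp add: t_norm norm_u ru')
    moreover have "rinner (u (b n) (u' (b n) x)) x = (norm (t n x))\<^sup>2" for n
      unfolding t_norm by (simp add: adj norm_sq_rinner)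
    ultimately show ?thesis
      using bessel_inequality[OF that, of "\<lambda>n. u (b n) (u' (b n) x)" x] u_orth ab(2)
      by (auto simp: inj_eq)
  qed
  have sum_norm: "(norm (\<Sum>n\<in>I. t n x))\<^sup>2 = (\<Sum>n\<in>I. (norm (t n x))\<^sup>2)" if "finite I" for I x
    by (rule norm_sum_orth[OF that t_orth])
  have conv: "convergent (\<lambda>N. \<Sum>n<N. t n x)" for x
  proof -
    have "summable (\<lambda>n. (norm (t n x))\<^sup>2)"
      by (rule bounded_imp_summable[of _ "(norm x)\<^sup>2"]) (use bound in auto)
    then have C: "\<exists>N. \<forall>m\<ge>N. \<forall>n. norm (\<Sum>k=m..<n. (norm (t k x))\<^sup>2) < e" if "e > 0" for e
      using that by (simp add: summable_Cauchy)
    have "summable (\<lambda>n. t n x)"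
      unfolding summable_Cauchy
    proof (intro allI impI)
      fix e :: real assume "e > 0"
      then obtain N where N: "\<And>m n. m \<ge> N \<Longrightarrow> norm (\<Sum>k=m..<n. (norm (t k x))\<^sup>2) < e\<^sup>2"
        using C[of "e\<^sup>2"] by auto
      have "norm (\<Sum>k=m..<n. t k x) < e" if "m \<ge> N" for m n
      proof -
        have "(norm (\<Sum>k=m..<n. t k x))\<^sup>2 < e\<^sup>2" using N[OF that, of n] by (simp add: sum_norm)
        then show ?thesis using \<open>e > 0\<close> by (auto intro: power_less_imp_less_base[of _ 2])
      qed
      then show "\<exists>N. \<forall>m\<ge>N. \<forall>n. norm (\<Sum>k=m..<n. t k x) < e" by blast
    qed
    then show ?thesis by (simp add: summable_iff_convergent)
  qed
  then obtain g where g: "\<And>x. (\<lambda>N. \<Sum>n<N. t n x) \<longlonglongrightarrow> g x" unfolding convergent_def by metis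
  have "bounded_linear g"
  proof (rule bounded_linear_intro[where K = 1])
    show "g (x + y) = g x + g y" for x y
    proof (rule LIMSEQ_unique[OF g])
      have "(\<lambda>N. (\<Sum>n<N. t n x) + (\<Sum>n<N. t n y)) \<longlonglongrightarrow> g x + g y" by (intro tendsto_intros g)
      then show "(\<lambda>N. \<Sum>n<N. t n (x + y)) \<longlonglongrightarrow> g x + g y"
        by (simp add: t_def blinfun.add_right sum.distrib)
    qed
    show "g (c *\<^sub>R x) = c *\<^sub>R g x" for c x
    proof (rule LIMSEQ_unique[OF g])
      have "(\<lambda>N. c *\<^sub>R (\<Sum>n<N. t n x)) \<longlonglongrightarrow> c *\<^sub>R g x" by (intro tendsto_intros g)
      then show "(\<lambda>N. \<Sum>n<N. t n (c *\<^sub>R x)) \<longlonglongrightarrow> c *\<^sub>R g x"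
        by (simp add: t_def blinfun.scaleR_right scaleR_sum_right)
    qed
    fix x
    have "norm (\<Sum>n<N. t n x) \<le> norm x" for N
      by (rule power2_le_imp_le) (simp_all add: sum_norm bound)
    then show "norm (g x) \<le> norm x * 1"
      using LIMSEQ_le_const2[OF tendsto_norm[OF g[of x]]] by auto
  qed
  then have V: "blinfun_apply (Blinfun g) = g" by (rule bounded_linear_Blinfun_apply)
  have "Blinfun g \<in> A"
  proof (rule A_strong_lim)
    show "(\<Sum>n<N. u (a n) o\<^sub>L u' (b n)) \<in> A" for N
      by (intro A_sum A_compose u) simp
    show "(\<lambda>N. (\<Sum>n<N. u (a n) o\<^sub>L u' (b n)) x) \<longlonglongrightarrow> Blinfun g x" for x
      using g[of x] by (simp add: V blinfun.sum_left t_def)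
  qed
  then show ?thesis using that g unfolding t_def by (simp add: V)
qed

lemma (in vna) finite_algebra_isometry:
  assumes "finite_algebra A" "V \<in> A" "W \<in> A" "is_adjoint W V" "W o\<^sub>L V = id_blinfun"
  shows "V o\<^sub>L W = id_blinfun"
proof -
  have WV: "W (V x) = x" for x
    using assms(5) by (metis blinfun_apply_blinfun_compose blinfun_apply_id_blinfun)
  have "is_proj (V o\<^sub>L W)"
    using is_adjoint_rinnerD[OF assms(4)] is_adjoint_rinnerD[OF is_adjoint_sym[OF assms(4)]]
    by (simp add: is_proj_def WV A_bounded_ops A_compose assms(2,3))
  then have p: "V o\<^sub>L W \<in> projs A" by (intro projsI A_compose assms)
  moreover have "mvn_equiv A id_blinfun (V o\<^sub>L W)" using assms(2-5) by (auto simp: mvn_equiv_def)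
  moreover have "op_le (V o\<^sub>L W) id_blinfun" by (simp add: le_iff id_projs p)
  ultimately show ?thesis using assms(1) by (auto simp: finite_algebra_def finite_proj_def)
qed

text \<open>Given infinitely many orthogonal copies of a projection, the operator that shifts each copy
  to the next one and is the identity on the complement of their sum is an isometry that
  misses the first copy.\<close>

lemma (in vna) no_infinite_orthogonal_copies:
  fixes u u' :: "nat \<Rightarrow> 'h \<Rightarrow>\<^sub>L 'h"
  assumes fin: "finite_algebra A"
    and u: "\<And>n. u n \<in> A" "\<And>n. u' n \<in> A" "\<And>n. is_adjoint (u' n) (u n)"
    and r: "r \<in> projs A" "\<And>m n x. u' m (u n x) = (if m = n then blinfun_apply r x else 0)"
  shows "r = 0"
proof -
  have adj: "rinner (u n x) y = rinner x (u' n y)" for n x y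
    by (rule is_adjoint_rinnerD[OF u(3)])
  have norm_u: "(norm (u n x))\<^sup>2 = (norm (r x))\<^sup>2" for n x
    by (simp add: norm_sq_rinner adj r(2) is_proj_rinner[OF projs_is_proj[OF r(1)]]
        is_proj_idem[OF projs_is_proj[OF r(1)]])
  have ur: "u n (r y) = u n y" for n y
    using norm_u[of n "y - r y"]
    by (simp add: blinfun.diff_right is_proj_idem[OF projs_is_proj[OF r(1)]])
  note ex = matrix_unit_sum_exists[OF u r]
  obtain F where F: "F \<in> A" "\<And>x. (\<lambda>N. \<Sum>n<N. u n (u' n x)) \<longlonglongrightarrow> blinfun_apply F x"
    using ex[of "\<lambda>n. n" "\<lambda>n. n"] by auto
  obtain L where L: "L \<in> A" "\<And>x. (\<lambda>N. \<Sum>n<N. u (Suc n) (u' n x)) \<longlonglongrightarrow> blinfun_apply L x"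
    using ex[of Suc "\<lambda>n. n"] by auto
  obtain B where B: "B \<in> A" "\<And>x. (\<lambda>N. \<Sum>n<N. u n (u' (Suc n) x)) \<longlonglongrightarrow> blinfun_apply B x"
    using ex[of "\<lambda>n. n" Suc] by auto
  have Fu: "F (u k y) = u k y" for k y
  proof (rule LIMSEQ_unique[OF F(2)])
    have "(\<Sum>n<N. u n (u' n (u k y))) = u k y" if "N \<ge> Suc k" for N
    proof -
      have "(\<Sum>n<N. u n (u' n (u k y))) = (\<Sum>n<N. if n = k then u k y else 0)"
        by (intro sum.cong) (auto simp: r(2) ur blinfun.zero_right)
      then show ?thesis using that by simp
    qed
    then show "(\<lambda>N. \<Sum>n<N. u n (u' n (u k y))) \<longlonglongrightarrow> u k y"
      by (intro tendsto_eventually) (auto simp: eventually_sequentially)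
  qed
  have Bu: "B (u (Suc k) y) = u k y" for k y
  proof (rule LIMSEQ_unique[OF B(2)])
    have "(\<Sum>n<N. u n (u' (Suc n) (u (Suc k) y))) = u k y" if "N \<ge> Suc k" for N
    proof -
      have "(\<Sum>n<N. u n (u' (Suc n) (u (Suc k) y))) = (\<Sum>n<N. if n = k then u k y else 0)"
        by (intro sum.cong) (auto simp: r(2) ur blinfun.zero_right)
      then show ?thesis using that by simp
    qed
    then show "(\<lambda>N. \<Sum>n<N. u n (u' (Suc n) (u (Suc k) y))) \<longlonglongrightarrow> u k y"
      by (intro tendsto_eventually) (auto simp: eventually_sequentially)
  qed
  have Bu0: "B (u 0 y) = 0" for y
    using B(2)[of "u 0 y"] LIMSEQ_unique[OF _ tendsto_const]
    by (simp add: r(2) blinfun.zero_right) blast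
  have Fsa: "rinner (F x) y = rinner x (F y)" for x y
  proof (rule LIMSEQ_unique)
    show "(\<lambda>N. rinner (\<Sum>n<N. u n (u' n x)) y) \<longlonglongrightarrow> rinner (F x) y"
      by (intro rinner.tendsto F(2) tendsto_const)
    have "(\<lambda>N. rinner x (\<Sum>n<N. u n (u' n y))) \<longlonglongrightarrow> rinner x (F y)"
      by (intro rinner.tendsto F(2) tendsto_const)
    moreover have "rinner x (u n (u' n y)) = rinner (u n (u' n x)) y" for n
      by (metis adj rinner_commute)
    ultimately show "(\<lambda>N. rinner (\<Sum>n<N. u n (u' n x)) y) \<longlonglongrightarrow> rinner x (F y)"
      by (simp add: rinner.sum_left rinner.sum_right)
  qed
  have BL_adj: "rinner (L x) y = rinner x (B y)" for x y
  proof (rule LIMSEQ_unique)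
    show "(\<lambda>N. rinner (\<Sum>n<N. u (Suc n) (u' n x)) y) \<longlonglongrightarrow> rinner (L x) y"
      by (intro rinner.tendsto L(2) tendsto_const)
    have "(\<lambda>N. rinner x (\<Sum>n<N. u n (u' (Suc n) y))) \<longlonglongrightarrow> rinner x (B y)"
      by (intro rinner.tendsto B(2) tendsto_const)
    moreover have "rinner x (u n (u' (Suc n) y)) = rinner (u (Suc n) (u' n x)) y" for n
      by (metis adj rinner_commute)
    ultimately show "(\<lambda>N. rinner (\<Sum>n<N. u (Suc n) (u' n x)) y) \<longlonglongrightarrow> rinner x (B y)"
      by (simp add: rinner.sum_left rinner.sum_right)
  qed
  have u'F: "u' k (F x) = u' k x" for k x
  proof -
    have "rinner y (u' k (F x) - u' k x) = 0" for y
      by (simp add: rinner_simps Fu flip: adj Fsa)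
    from rinner_right_eq_0_imp[OF this] show ?thesis by simp
  qed
  have BF: "B (F x) = B x" for x
    using B(2)[of "F x"] B(2)[of x] LIMSEQ_unique by (simp add: u'F) blast
  have FL: "F (L x) = L x" for x
  proof (rule LIMSEQ_unique)
    show "(\<lambda>N. F (\<Sum>n<N. u (Suc n) (u' n x))) \<longlonglongrightarrow> F (L x)"
      by (intro bounded_linear.tendsto[OF blinfun.bounded_linear_right] L(2))
    show "(\<lambda>N. F (\<Sum>n<N. u (Suc n) (u' n x))) \<longlonglongrightarrow> L x"
      using L(2)[of x] by (simp add: blinfun.sum_right Fu)
  qed
  have FF: "F (F x) = F x" for x
  proof (rule LIMSEQ_unique)
    show "(\<lambda>N. F (\<Sum>n<N. u n (u' n x))) \<longlonglongrightarrow> F (F x)"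
      by (intro bounded_linear.tendsto[OF blinfun.bounded_linear_right] F(2))
    show "(\<lambda>N. F (\<Sum>n<N. u n (u' n x))) \<longlonglongrightarrow> F x"
      using F(2)[of x] by (simp add: blinfun.sum_right Fu)
  qed
  have BL: "B (L x) = F x" for x
  proof (rule LIMSEQ_unique)
    show "(\<lambda>N. B (\<Sum>n<N. u (Suc n) (u' n x))) \<longlonglongrightarrow> B (L x)"
      by (intro bounded_linear.tendsto[OF blinfun.bounded_linear_right] L(2))
    show "(\<lambda>N. B (\<Sum>n<N. u (Suc n) (u' n x))) \<longlonglongrightarrow> F x"
      using F(2)[of x] by (simp add: blinfun.sum_right Bu)
  qed
  define V where "V = L + (id_blinfun - F)"
  define W where "W = B + (id_blinfun - F)"
  have VW: "V \<in> A" "W \<in> A" unfolding V_def W_def by (intro A_add A_diff A_id F L B)+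
  have "is_adjoint W V"
    by (rule is_adjointI[OF A_bounded_ops[OF VW(2)]])
      (simp add: V_def W_def blinfun.bilinear_simps rinner_simps BL_adj Fsa)
  moreover have "W o\<^sub>L V = id_blinfun"
    by (rule blinfun_eqI)
      (simp add: V_def W_def blinfun.bilinear_simps BL BF FL FF)
  ultimately have VWid: "V o\<^sub>L W = id_blinfun" by (rule finite_algebra_isometry[OF fin VW])
  have "u 0 y = 0" for y
  proof -
    have "W (u 0 y) = 0" by (simp add: W_def blinfun.bilinear_simps Bu0 Fu)
    then have "(V o\<^sub>L W) (u 0 y) = 0" by (simp add: blinfun.zero_right)
    then show ?thesis by (simp add: VWid)
  qed
  then have "r y = 0" for y using r(2)[of 0 0 y] by (simp add: blinfun.zero_right)
  then show ?thesis by (intro blinfun_eqI) (simp add: blinfun.zero_left)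
qed

section \<open>Continuity of the projection lattice\<close>

text \<open>The spectral projection of \<open>r (1 - q) r - \<delta>\<close> splits \<open>r\<close> into a part \<open>e\<close> close to \<open>q\<close> and a part \<open>f\<close>
  far from \<open>q\<close>. It commutes with \<open>r (1 - q) r\<close>, so the squared distance to \<open>q\<close> is additive over the
  two parts, whence the last inequality.\<close>

lemma (in vna) angle_cut:
  fixes q r :: "'h \<Rightarrow>\<^sub>L 'h"
  assumes q: "q \<in> projs A" and r: "r \<in> projs A"
  obtains e f where "e \<in> projs A" "f \<in> projs A" "op_le e r" "op_le f r" "f = r - e"
    "\<And>x. e x = x \<Longrightarrow> (norm (x - q x))\<^sup>2 \<le> \<delta> * (norm x)\<^sup>2"
    "\<And>x. f x = x \<Longrightarrow> \<delta> * (norm x)\<^sup>2 \<le> (norm (x - q x))\<^sup>2"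
    "\<And>x. r x = x \<Longrightarrow> (norm (f x - q (f x)))\<^sup>2 \<le> (norm (x - q x))\<^sup>2"
proof -
  note qp = projs_is_proj[OF q] and rp = projs_is_proj[OF r]
  define T where "T = (r o\<^sub>L (id_blinfun - q)) o\<^sub>L r"
  have TA: "T \<in> A" unfolding T_def by (intro A_compose A_diff A_id projs_A q r)
  have T: "T x = r (r x - q (r x))" for x by (simp add: T_def blinfun.diff_left)
  have Tsa: "self_adjoint T" unfolding self_adjoint_def
    by (simp add: T is_proj_rinner[OF rp] rinner_simps is_proj_rinner[OF qp] blinfun.diff_right)
  have form: "rinner (T x) x = (norm (x - q x))\<^sup>2" if "r x = x" for x
    unfolding is_proj_pythagoras[OF qp] is_proj_norm_sq[OF qp]
    by (simp add: T is_proj_rinner[OF rp] that rinner_simps norm_sq_rinner)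
  define S where "S = T - \<delta> *\<^sub>R id_blinfun"
  have SA: "S \<in> A" unfolding S_def by (intro A_diff A_scaleR A_id TA)
  have Ssa: "self_adjoint S" unfolding S_def
    by (intro self_adjoint_diff self_adjoint_scaleR self_adjoint_id Tsa)
  have S: "rinner (S x) x = rinner (T x) x - \<delta> * (norm x)\<^sup>2" for x
    by (simp add: S_def blinfun.bilinear_simps rinner_simps norm_sq_rinner)
  obtain e where e: "e \<in> projs A"
    "\<And>x. e x = x \<Longrightarrow> rinner (S x) x \<le> 0"
    "\<And>x. blinfun_apply e x = 0 \<Longrightarrow> 0 \<le> rinner (S x) x"
    "\<And>R x. self_adjoint R \<Longrightarrow> (\<And>x. R (S x) = S (R x)) \<Longrightarrow> e (blinfun_apply R x) = R (e x)"
    using spectral_cut[OF SA Ssa] by blast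
  note ep = projs_is_proj[OF e(1)]
  have er: "e (r x) = r (e x)" for x
    by (rule e(4)[OF is_proj_self_adjoint[OF rp]])
      (simp add: S_def T blinfun.bilinear_simps is_proj_idem[OF rp])
  have eT: "e (T x) = T (e x)" for x
    by (rule e(4)[OF Tsa]) (simp add: S_def blinfun.bilinear_simps)
  define g where "g = e o\<^sub>L r"
  have g: "g x = e (r x)" for x by (simp add: g_def)
  have "is_proj g" unfolding is_proj_def
  proof (intro conjI allI)
    show "g \<in> bounded_ops" unfolding g_def
      by (intro A_bounded_ops A_compose projs_A e(1) r)
    show "rinner (g x) y = rinner x (g y)" for x y
      by (simp add: g is_proj_rinner[OF rp] is_proj_rinner[OF ep] er)
    show "g (g x) = g x" for x
      by (simp add: g er is_proj_idem[OF rp] is_proj_idem[OF ep])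
  qed
  moreover have "g \<in> A" unfolding g_def by (intro A_compose projs_A e(1) r)
  ultimately have gP: "g \<in> projs A" by (intro projsI)
  have gle: "op_le g r" unfolding le_iff[OF r gP]
    by (metis g er is_proj_idem[OF rp])
  have fP: "r - g \<in> projs A" and fle: "op_le (r - g) r"
    by (rule diff_projs[OF r gP gle], rule diff_le[OF r gP gle])
  have f: "(r - g) x = r x - e (r x)" for x by (simp add: blinfun.diff_left g)
  have f_fix: "r x = x \<and> e x = 0" if "(r - g) x = x" for x
  proof -
    have "r x = x" using that fle le_iff[OF r fP] by blast
    moreover from this have "e x = 0" using that by (simp add: f)
    ultimately show ?thesis by blast
  qed
  have g_fix: "r x = x \<and> e x = x" if "g x = x" for x
  proof -
    have "r x = x" using that gle le_iff[OF r gP] by blast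
    then show ?thesis using that g[of x] by simp
  qed
  show ?thesis
  proof (rule that[OF gP fP gle fle refl])
    show "(norm (x - q x))\<^sup>2 \<le> \<delta> * (norm x)\<^sup>2" if "g x = x" for x
      using e(2)[of x] S[of x] form[of x] g_fix[OF that] by simp
    show "\<delta> * (norm x)\<^sup>2 \<le> (norm (x - q x))\<^sup>2" if "(r - g) x = x" for x
      using e(3)[of x] S[of x] form[of x] f_fix[OF that] by simp
    show "(norm ((r - g) x - q ((r - g) x)))\<^sup>2 \<le> (norm (x - q x))\<^sup>2" if x: "r x = x" for x
    proof -
      define z where "z = (r - g) x"
      define y where "y = e x"
      have xz: "x = y + z" and ez: "e z = 0" and ey: "e y = y"
        by (simp_all add: y_def z_def f x blinfun.diff_right is_proj_idem[OF ep])
      have ry: "r y = y" using er[of x] x by (simp add: y_def)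
      then have rz: "r z = z" using x xz by (metis add_left_cancel blinfun.add_right)
      have cross: "rinner (T y) z = 0" 
      proof -
        have "rinner (T y) z = rinner (e (T y)) z" by (simp add: eT ey)
        then show ?thesis by (simp add: is_proj_rinner[OF ep] ez rinner.zero_right)
      qed
      have "rinner (T x) x = rinner (T y) y + rinner (T z) z"
        using cross self_adjointD[OF Tsa, of z y]
        by (simp add: xz blinfun.add_right rinner_simps rinner_commute)
      then show ?thesis using form[OF x] form[OF ry] form[OF rz] unfolding z_def[symmetric] by simp
    qed
  qed
qed

text \<open>If \<open>r\<close> and \<open>q\<close> have no common vector then the parts of \<open>r\<close> far from \<open>q\<close> exhaust \<open>r\<close>. Indeed, let
  \<open>z\<close> be the component of \<open>\<xi>\<close> in the part close to \<open>q\<close>. It is almost orthogonal to every vector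
  \<open>r (y - q y)\<close>, and these vectors are dense in the range of \<open>r\<close>, so \<open>z\<close> is almost orthogonal to \<open>\<xi>\<close>.\<close>

lemma (in vna) cut_apart:
  fixes q r :: "'h \<Rightarrow>\<^sub>L 'h"
  assumes q: "q \<in> projs A" and r: "r \<in> projs A"
    and disj: "\<And>x. r x = x \<Longrightarrow> q x = x \<Longrightarrow> x = 0"
    and \<xi>: "r \<xi> = \<xi>" and "\<epsilon> > 0"
  obtains f \<delta> where "f \<in> projs A" "op_le f r" "\<delta> > 0" "norm (\<xi> - f \<xi>) < \<epsilon>"
    "\<And>x. f x = x \<Longrightarrow> \<delta> * (norm x)\<^sup>2 \<le> (norm (x - q x))\<^sup>2"
proof -
  note qp = projs_is_proj[OF q] and rp = projs_is_proj[OF r]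
  define U where "U = range (\<lambda>y. r (y - q y))"
  have "subspace U" unfolding U_def subspace_def
  proof (intro conjI ballI allI)
    show "0 \<in> range (\<lambda>y. r (y - q y))" by (auto intro!: image_eqI[of _ _ 0] simp: blinfun.zero_right)
    fix a b assume "a \<in> range (\<lambda>y. r (y - q y))"
    then obtain y where y: "a = r (y - q y)" by blast
    show "c *\<^sub>R a \<in> range (\<lambda>y. r (y - q y))" for c
      by (rule image_eqI[of _ _ "c *\<^sub>R y"])
        (simp_all add: y blinfun.bilinear_simps scaleR_diff_right)
    assume "b \<in> range (\<lambda>y. r (y - q y))"
    then obtain z where z: "b = r (z - q z)" by blast
    show "a + b \<in> range (\<lambda>y. r (y - q y))"
      by (rule image_eqI[of _ _ "y + z"]) (simp_all add: y z blinfun.bilinear_simps)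
  qed
  then have Uc: "subspace (closure U)" "closed (closure U)" using subspace_closure by auto
  \<comment> \<open>Vectors \<open>r (y - q y)\<close> are dense in the range of \<open>r\<close>.\<close>
  have dense: "\<xi> \<in> closure U"
  proof -
    obtain \<zeta> where \<zeta>: "\<zeta> \<in> closure U" "\<And>z. z \<in> closure U \<Longrightarrow> rinner (\<xi> - \<zeta>) z = 0"
      using orthogonal_point_exists[OF Uc] by blast
    have "closed {x. r x = x}" by (intro closed_Collect_eq continuous_intros)
    moreover have "U \<subseteq> {x. r x = x}" by (auto simp: U_def is_proj_idem[OF rp])
    ultimately have "r \<zeta> = \<zeta>" using closure_minimal \<zeta>(1) by blast
    define x where "x = \<xi> - \<zeta>"
    have x: "r x = x" by (simp add: x_def blinfun.diff_right \<xi> \<open>r \<zeta> = \<zeta>\<close>)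
    have "rinner (x - q x) y = 0" for y
    proof -
      have "r (y - q y) \<in> U" by (simp add: U_def)
      then have "r (y - q y) \<in> closure U" using closure_subset by blast
      then have "rinner x (r (y - q y)) = 0" using \<zeta>(2) by (simp add: x_def)
      then have "rinner x (y - q y) = 0" using x by (simp flip: is_proj_rinner[OF rp])
      then show ?thesis by (simp add: rinner_simps is_proj_rinner[OF qp])
    qed
    then have "q x = x" using rinner_eq_0_imp by fastforce
    then have "x = 0" using disj x by blast
    then show ?thesis using \<zeta>(1) by (simp add: x_def)
  qed
  \<comment> \<open>\<open>\<eta>\<close> and \<open>s\<close> are chosen so that the two error terms \<open>a * \<eta>\<close> and \<open>s * a * b\<close> of the final
    estimate of \<open>(norm z)\<^sup>2\<close> are below \<open>\<epsilon>\<^sup>2 / 2\<close>.\<close>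
  define a where "a = norm \<xi>"
  have "a \<ge> 0" by (simp add: a_def)
  define \<eta> where "\<eta> = \<epsilon>\<^sup>2 / (2 * (a + 1))"
  have \<eta>: "\<eta> > 0" "a * \<eta> < \<epsilon>\<^sup>2 / 2"
    using \<open>\<epsilon> > 0\<close> \<open>a \<ge> 0\<close> by (auto simp: \<eta>_def field_simps add_pos_nonneg)
  obtain y where y: "norm (\<xi> - r (y - q y)) < \<eta>"
    using dense \<eta>(1) closure_approachable[of \<xi> U] by (auto simp: U_def dist_norm norm_minus_commute)
  define b where "b = norm y"
  have "b \<ge> 0" by (simp add: b_def)
  define s where "s = \<epsilon>\<^sup>2 / (2 * (a * b + 1))"
  have "a * b \<ge> 0" using \<open>a \<ge> 0\<close> \<open>b \<ge> 0\<close> by simp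
  then have s: "s > 0" "s * a * b < \<epsilon>\<^sup>2 / 2"
    using \<open>\<epsilon> > 0\<close> by (auto simp: s_def field_simps add_pos_nonneg)
  obtain e f where ef: "e \<in> projs A" "f \<in> projs A" "op_le e r" "op_le f r" "f = r - e"
    "\<And>x. e x = x \<Longrightarrow> (norm (x - q x))\<^sup>2 \<le> s\<^sup>2 * (norm x)\<^sup>2"
    "\<And>x. f x = x \<Longrightarrow> s\<^sup>2 * (norm x)\<^sup>2 \<le> (norm (x - q x))\<^sup>2"
    by (rule angle_cut[OF q r, where \<delta> = "s\<^sup>2"]) (rule that)
  note ep = projs_is_proj[OF ef(1)]
  define z where "z = e \<xi>"
  have z: "\<xi> - f \<xi> = z" "norm z \<le> a" "e z = z" "r z = z"
    using le_absorb[OF r ef(1,3)] is_proj_norm_le[OF ep]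
    by (simp_all add: ef(5) blinfun.diff_left \<xi> z_def a_def is_proj_idem[OF ep])
  have "(norm (z - q z))\<^sup>2 \<le> (s * norm z)\<^sup>2" using ef(6)[OF z(3)] by (simp add: power_mult_distrib)
  then have "norm (z - q z) \<le> s * norm z" by (rule power2_le_imp_le) (use s(1) in simp)
  also have "\<dots> \<le> s * a" using z(2) s(1) by simp
  finally have zq: "norm (z - q z) \<le> s * a" .
  have "(norm z)\<^sup>2 = rinner z \<xi>" unfolding z_def is_proj_norm_sq[OF ep] ..
  also have "\<dots> = rinner z (\<xi> - r (y - q y)) + rinner z (r (y - q y))"
    by (simp add: rinner_simps)
  also have "rinner z (r (y - q y)) = rinner (z - q z) y"
    using z(4) by (simp add: rinner_simps is_proj_rinner[OF qp] flip: is_proj_rinner[OF rp])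
  also have "rinner z (\<xi> - r (y - q y)) + rinner (z - q z) y
      \<le> norm z * norm (\<xi> - r (y - q y)) + norm (z - q z) * norm y"
    by (intro add_mono rinner_le_norm)
  also have "\<dots> \<le> a * \<eta> + s * a * b"
    using y z(2) zq \<open>a \<ge> 0\<close> s(1) unfolding b_def by (intro add_mono mult_mono) auto
  also have "\<dots> < \<epsilon>\<^sup>2" using \<eta>(2) s(2) by simp
  finally have "norm z < \<epsilon>" using \<open>\<epsilon> > 0\<close> by (auto intro: power_less_imp_less_base[of _ 2])
  then show ?thesis using that[OF ef(2,4) _ _ ef(7)] s(1) z(1) by simp
qed

text \<open>A first cut moves \<open>r\<close> away from \<open>q m\<close>. For large \<open>n\<close> a second cut then makes it much closer to \<open>q n\<close>
  than it is far from \<open>q m\<close>, and the difference \<open>q n - q m\<close> is bounded below on what remains. Both cuts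
  move \<open>\<xi>\<close> only a little.\<close>

lemma (in vna) cut_step:
  fixes q :: "nat \<Rightarrow> 'h \<Rightarrow>\<^sub>L 'h"
  assumes q: "\<And>n. q n \<in> projs A" "\<And>n. op_le (q n) (q (Suc n))"
    and r: "r \<in> projs A"
    and disj: "\<And>x. r x = x \<Longrightarrow> q m x = x \<Longrightarrow> x = 0"
    and lim: "\<And>x. r x = x \<Longrightarrow> (\<lambda>n. q n x) \<longlonglongrightarrow> x"
    and \<xi>: "blinfun_apply r \<xi> = \<xi>" and "\<epsilon> > 0"
  obtains n r' \<delta> where "m < n" "r' \<in> projs A" "op_le r' r" "\<delta> > 0" "norm (\<xi> - r' \<xi>) < \<epsilon>"
    "\<And>x. r' x = x \<Longrightarrow> \<delta> * (norm x)\<^sup>2 \<le> (norm ((q n - q m) x))\<^sup>2"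
proof -
  obtain f \<delta> where f: "f \<in> projs A" "op_le f r" "\<delta> > 0" "norm (\<xi> - f \<xi>) < \<epsilon> / 2"
    "\<And>x. f x = x \<Longrightarrow> \<delta> * (norm x)\<^sup>2 \<le> (norm (x - q m x))\<^sup>2"
    by (rule cut_apart[OF q(1)[of m] r disj \<xi>, where \<epsilon> = "\<epsilon> / 2"]) (use \<open>\<epsilon> > 0\<close> that in auto)
  define \<zeta> where "\<zeta> = f \<xi>"
  have f\<zeta>: "f \<zeta> = \<zeta>" by (simp add: \<zeta>_def is_proj_idem[OF projs_is_proj[OF f(1)]])
  then have "r \<zeta> = \<zeta>" using f(2) le_iff[OF r f(1)] by blast
  then have "(\<lambda>n. q n \<zeta>) \<longlonglongrightarrow> \<zeta>" by (rule lim)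
  then have "(\<lambda>n. (norm (\<zeta> - q n \<zeta>))\<^sup>2) \<longlonglongrightarrow> (norm (\<zeta> - \<zeta>))\<^sup>2"
    by (intro tendsto_intros)
  then have "(\<lambda>n. (norm (\<zeta> - q n \<zeta>))\<^sup>2) \<longlonglongrightarrow> 0" by simp
  moreover have "0 < (\<epsilon> / 2)\<^sup>2 * (\<delta> / 2)" using \<open>\<epsilon> > 0\<close> f(3) by simp
  ultimately have "\<forall>\<^sub>F n in sequentially. (norm (\<zeta> - q n \<zeta>))\<^sup>2 < (\<epsilon> / 2)\<^sup>2 * (\<delta> / 2)"
    by (rule order_tendstoD(2))
  then have "\<forall>\<^sub>F n in sequentially. (norm (\<zeta> - q n \<zeta>))\<^sup>2 < (\<epsilon> / 2)\<^sup>2 * (\<delta> / 2) \<and> m < n"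
    using eventually_gt_at_top by (rule eventually_conj)
  then obtain n where n: "(norm (\<zeta> - q n \<zeta>))\<^sup>2 < (\<epsilon> / 2)\<^sup>2 * (\<delta> / 2)" "m < n"
    using eventually_happens' sequentially_bot by blast
  obtain e g where eg: "e \<in> projs A" "g \<in> projs A" "op_le e f" "op_le g f" "g = f - e"
    "\<And>x. e x = x \<Longrightarrow> (norm (x - q n x))\<^sup>2 \<le> \<delta> / 2 * (norm x)\<^sup>2"
    "\<And>x. g x = x \<Longrightarrow> \<delta> / 2 * (norm x)\<^sup>2 \<le> (norm (x - q n x))\<^sup>2"
    "\<And>x. f x = x \<Longrightarrow> (norm (g x - q n (g x)))\<^sup>2 \<le> (norm (x - q n x))\<^sup>2"
    by (rule angle_cut[OF q(1)[of n] f(1), where \<delta> = "\<delta> / 2"]) (rule that)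
  note ep = projs_is_proj[OF eg(1)]
  have "norm (\<xi> - e \<xi>) < \<epsilon>"
  proof -
    have "g \<zeta> = \<zeta> - e \<zeta>" by (simp add: eg(5) blinfun.diff_left f\<zeta>)
    moreover have "\<delta> / 2 * (norm (g \<zeta>))\<^sup>2 < (\<epsilon> / 2)\<^sup>2 * (\<delta> / 2)"
      using eg(7)[OF is_proj_idem[OF projs_is_proj[OF eg(2)]], of \<zeta>] eg(8)[OF f\<zeta>] n(1) by linarith
    ultimately have "(norm (\<zeta> - e \<zeta>))\<^sup>2 < (\<epsilon> / 2)\<^sup>2" using f(3) by simp
    then have "norm (\<zeta> - e \<zeta>) < \<epsilon> / 2"
      by (rule power_less_imp_less_base) (use \<open>\<epsilon> > 0\<close> in simp)
    moreover have "norm (\<xi> - e \<xi>) \<le> norm (\<xi> - e \<zeta>)"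
      by (rule is_proj_closest[OF ep is_proj_idem[OF ep]])
    moreover have "norm (\<xi> - e \<zeta>) \<le> norm (\<xi> - \<zeta>) + norm (\<zeta> - e \<zeta>)"
      using norm_triangle_ineq[of "\<xi> - \<zeta>" "\<zeta> - e \<zeta>"] by simp
    ultimately show ?thesis using f(4) by (simp add: \<zeta>_def)
  qed
  moreover have "\<delta> / 2 * (norm x)\<^sup>2 \<le> (norm ((q n - q m) x))\<^sup>2" if "e x = x" for x
  proof -
    have "f x = x" using that eg(3) le_iff[OF f(1) eg(1)] by blast
    then have 1: "\<delta> * (norm x)\<^sup>2 \<le> (norm (x - q m x))\<^sup>2" by (rule f(5))
    have 2: "(norm (x - q n x))\<^sup>2 \<le> \<delta> / 2 * (norm x)\<^sup>2" by (rule eg(6)[OF that])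
    have le: "op_le (q m) (q n)" using incseq_le[of q, OF q] n(2) by simp
    have "(norm ((q n - q m) x))\<^sup>2 = (norm (q n x))\<^sup>2 - (norm (q m x))\<^sup>2"
      using is_proj_pythagoras[OF projs_is_proj[OF q(1)[of m]], of "q n x"] le_absorb'[OF q(1) q(1) le]
      by (simp add: blinfun.diff_left)
    then show ?thesis using 1 2
      unfolding is_proj_pythagoras[OF projs_is_proj[OF q(1)]] by simp
  qed
  moreover have "op_le e r" by (rule le_trans[OF eg(1) f(1) r eg(3) f(2)])
  ultimately show ?thesis using that[of n e "\<delta> / 2"] n(2) eg(1) f(3) by simp
qed

text \<open>Repeated cutting produces indices \<open>m 0 < m 1 < \<dots>\<close> and one nonzero projection \<open>e\<close> below \<open>r\<close> on which all
  the orthogonal projections \<open>d k = q (m (k + 1)) - q (m k)\<close> are bounded below. By polar decomposition each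
  \<open>d k\<close> then dominates a copy of \<open>e\<close>, which a finite algebra does not allow. What keeps \<open>e\<close> from vanishing is
  a vector that is carried along: it is projected at every step but loses only a summable
  amount of its norm.\<close>

lemma (in vna) disjoint_from_exhausting_sequence:
  fixes q :: "nat \<Rightarrow> 'h \<Rightarrow>\<^sub>L 'h"
  assumes fin: "finite_algebra A"
    and q: "\<And>n. q n \<in> projs A" "\<And>n. op_le (q n) (q (Suc n))"
    and r: "r \<in> projs A"
    and disj: "\<And>n x. r x = x \<Longrightarrow> q n x = x \<Longrightarrow> x = 0"
    and lim: "\<And>x. blinfun_apply r x = x \<Longrightarrow> (\<lambda>n. q n x) \<longlonglongrightarrow> x"
  shows "r = 0"
proof (rule ccontr)
  assume "r \<noteq> 0"
  have "\<exists>\<xi>. r \<xi> = \<xi> \<and> norm \<xi> = 1"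
  proof -
    have "\<not> (\<forall>y. r y = 0)" using \<open>r \<noteq> 0\<close> blinfun_eqI[of r 0] by (auto simp: blinfun.zero_left)
    then obtain y where "r y \<noteq> 0" by blast
    then show ?thesis using is_proj_idem[OF projs_is_proj[OF r]]
      by (intro exI[of _ "inverse (norm (r y)) *\<^sub>R r y"]) (simp add: blinfun.scaleR_right)
  qed
  then obtain \<xi>0 where \<xi>0: "r \<xi>0 = \<xi>0" "norm \<xi>0 = 1" by blast
  \<comment> \<open>A state consists of an index, the projection left after the cuts, and a vector in its range.\<close>
  define P where "P k st \<longleftrightarrow> (case st of (m, \<rho>, \<xi>) \<Rightarrow>
     \<rho> \<in> projs A \<and> op_le \<rho> r \<and> blinfun_apply \<rho> \<xi> = \<xi> \<and> (k = 0 \<longrightarrow> \<xi> = \<xi>0))"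
    for k :: nat and st :: "nat \<times> ('h \<Rightarrow>\<^sub>L 'h) \<times> 'h"
  define Q where "Q k st st' \<longleftrightarrow> (case st of (m, \<rho>, \<xi>) \<Rightarrow> case st' of (n, \<rho>', \<xi>') \<Rightarrow>
     m < n \<and> op_le \<rho>' \<rho> \<and> norm (\<xi> - \<xi>') < (1/2) ^ (k + 2) \<and>
     (\<exists>\<delta>>0. \<forall>x. blinfun_apply \<rho>' x = x \<longrightarrow> \<delta> * (norm x)\<^sup>2 \<le> (norm ((q n - q m) x))\<^sup>2))"
    for k :: nat and st st' :: "nat \<times> ('h \<Rightarrow>\<^sub>L 'h) \<times> 'h"
  have "\<exists>st. \<forall>k. P k (st k) \<and> Q k (st k) (st (Suc k))"
  proof (rule dependent_nat_choice)
    show "\<exists>st. P 0 st"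
      by (intro exI[of _ "(0, r, \<xi>0)"]) (simp add: P_def r le_refl \<xi>0)
  next
    fix st k assume st: "P k st"
    obtain m \<rho> \<xi> where st_eq: "st = (m, \<rho>, \<xi>)" by (cases st)
    have \<rho>: "\<rho> \<in> projs A" "op_le \<rho> r" "\<rho> \<xi> = \<xi>" using st by (auto simp: P_def st_eq)
    have r_fix: "r x = x" if "\<rho> x = x" for x using that \<rho>(2) le_iff[OF r \<rho>(1)] by blast
    obtain n \<rho>' \<delta> where n: "m < n" "\<rho>' \<in> projs A" "op_le \<rho>' \<rho>" "\<delta> > 0"
      "norm (\<xi> - \<rho>' \<xi>) < (1/2) ^ (k + 2)"
      "\<And>x. \<rho>' x = x \<Longrightarrow> \<delta> * (norm x)\<^sup>2 \<le> (norm ((q n - q m) x))\<^sup>2"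
      using cut_step[of q \<rho> m \<xi> "(1/2) ^ (k + 2)", OF q \<rho>(1)] disj lim r_fix \<rho>(3) by auto
    have "op_le \<rho>' r" by (rule le_trans[OF n(2) \<rho>(1) r n(3) \<rho>(2)])
    then have "P (Suc k) (n, \<rho>', \<rho>' \<xi>)"
      using n(2) is_proj_idem[OF projs_is_proj[OF n(2)]] by (simp add: P_def)
    moreover have "Q k st (n, \<rho>', \<rho>' \<xi>)" using n unfolding Q_def st_eq by auto
    ultimately show "\<exists>st'. P (Suc k) st' \<and> Q k st st'" by blast
  qed
  then obtain st where st: "\<And>k. P k (st k)" "\<And>k. Q k (st k) (st (Suc k))" by blast
  define m where "m k = fst (st k)" for k
  define \<rho> where "\<rho> k = fst (snd (st k))" for k
  define \<xi> where "\<xi> k = snd (snd (st k))" for k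
  have st_eq: "st k = (m k, \<rho> k, \<xi> k)" for k by (simp add: m_def \<rho>_def \<xi>_def)
  have \<rho>: "\<rho> k \<in> projs A" "\<rho> k (\<xi> k) = \<xi> k" "\<xi> 0 = \<xi>0" "op_le (\<rho> (Suc k)) (\<rho> k)"
    "m k < m (Suc k)" "norm (\<xi> k - \<xi> (Suc k)) < (1/2) ^ (k + 2)" for k
    using st(1)[of k] st(1)[of 0] st(2)[of k] by (auto simp: P_def Q_def st_eq)
  have "\<exists>\<delta>>0. \<forall>x. \<rho> (Suc k) x = x \<longrightarrow> \<delta> * (norm x)\<^sup>2 \<le> (norm ((q (m (Suc k)) - q (m k)) x))\<^sup>2" for k
    using st(2)[of k] by (auto simp: Q_def st_eq)
  then obtain \<delta> where \<delta>: "\<And>k. \<delta> k > 0"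
    "\<And>k x. \<rho> (Suc k) x = x \<Longrightarrow> \<delta> k * (norm x)\<^sup>2 \<le> (norm ((q (m (Suc k)) - q (m k)) x))\<^sup>2"
    by metis
  \<comment> \<open>The vectors \<open>\<xi> k\<close> move by at most \<open>1/2\<close> in total, so their limit is not zero.\<close>
  define g where "g k = \<xi> (Suc k) - \<xi> k" for k
  have gb: "norm (g k) \<le> (1/4) * (1/2) ^ k" for k
    using \<rho>(6)[of k] by (simp add: g_def norm_minus_commute)
  have sg: "summable (\<lambda>k. (1/4) * (1/2 :: real) ^ k)" by (intro summable_mult summable_geometric) simp
  have ng: "summable (\<lambda>k. norm (g k))" by (rule summable_comparison_test'[OF sg, of 0]) (use gb in simp)
  have "(\<lambda>n. \<Sum>k<n. g k) \<longlonglongrightarrow> suminf g" by (rule summable_LIMSEQ[OF summable_norm_cancel[OF ng]])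
  moreover have "(\<Sum>k<n. g k) = \<xi> n - \<xi>0" for n
    unfolding g_def sum_lessThan_telescope by (simp add: \<rho>(3))
  ultimately have "(\<lambda>n. (\<xi> n - \<xi>0) + \<xi>0) \<longlonglongrightarrow> suminf g + \<xi>0" by (intro tendsto_intros) simp
  then obtain \<xi>' where \<xi>': "\<xi> \<longlonglongrightarrow> \<xi>'" "\<xi>' = suminf g + \<xi>0" by simp
  have "norm (suminf g) \<le> (\<Sum>k. norm (g k))" by (rule summable_norm[OF ng])
  also have "\<dots> \<le> (\<Sum>k. (1/4) * (1/2 :: real) ^ k)" by (rule suminf_le[OF gb ng sg])
  also have "\<dots> = 1/2" by (subst suminf_mult) (auto simp: suminf_geometric)
  finally have "norm (suminf g) \<le> 1/2" .
  then have "\<xi>' \<noteq> 0" using \<xi>'(2) \<xi>0(2) norm_triangle_ineq4[of \<xi>' "suminf g"] by auto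
  have \<rho>_fix: "\<rho> k x = x" if "\<rho> j x = x" "k \<le> j" for k j x
    using that(2,1)
  proof (induction j rule: dec_induct)
    case (step i)
    then show ?case using le_iff[OF \<rho>(1) \<rho>(1)] \<rho>(4) by blast
  qed
  have "\<rho> k \<xi>' = \<xi>'" for k
  proof (rule LIMSEQ_unique)
    show "(\<lambda>n. \<rho> k (\<xi> n)) \<longlonglongrightarrow> \<rho> k \<xi>'"
      by (intro bounded_linear.tendsto[OF blinfun.bounded_linear_right] \<xi>')
    have "\<xi> n = \<rho> k (\<xi> n)" if "k \<le> n" for n using \<rho>_fix[OF \<rho>(2) that] by simp
    then have "\<forall>\<^sub>F n in sequentially. \<xi> n = \<rho> k (\<xi> n)"
      unfolding eventually_sequentially by blast
    then show "(\<lambda>n. \<rho> k (\<xi> n)) \<longlonglongrightarrow> \<xi>'" by (rule Lim_transform_eventually[OF \<xi>'(1)])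
  qed
  define S where "S = {x. \<forall>k. \<rho> k x = x}"
  have S: "subspace S" "closed S"
    by (auto simp: S_def subspace_def blinfun.bilinear_simps
        intro!: closed_Collect_all closed_Collect_eq continuous_intros)
  define e where "e = proj_on S"
  have e: "e \<in> projs A" unfolding e_def
    by (rule proj_on_projs[OF S]) (simp add: S_def A_commute[OF projs_A[OF \<rho>(1)]])
  note ep = projs_is_proj[OF e]
  have efix: "e x = x \<longleftrightarrow> (\<forall>k. \<rho> k x = x)" for x
    unfolding e_def proj_on_fix[OF S] by (simp add: S_def)
  define d where "d k = q (m (Suc k)) - q (m k)" for k
  have mle: "op_le (q (m k)) (q (m j))" if "k \<le> j" for k j
  proof -
    have "m k \<le> m j" using that \<rho>(5) by (simp add: less_imp_le lift_Suc_mono_le)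
    then show ?thesis by (rule incseq_le[of q, OF q])
  qed
  have dA: "d k \<in> projs A" for k unfolding d_def by (rule diff_projs[OF q(1) q(1) mle]) simp
  have d_orth_less: "d j (d k x) = 0" if "k < j" for j k x
  proof -
    have "q (m j) (d k x) = d k x" "q (m (Suc j)) (d k x) = d k x"
      using that le_absorb[OF q(1) q(1) mle]
      by (simp_all add: d_def blinfun.diff_left blinfun.diff_right)
    then show ?thesis by (simp add: d_def[of j] blinfun.diff_left)
  qed
  have d_orth: "rinner (d j x) (d k y) = 0" if "j \<noteq> k" for j k x y
  proof (cases "k < j")
    case True
    then show ?thesis
      by (simp add: is_proj_rinner[OF projs_is_proj[OF dA]] d_orth_less rinner.zero_right)
  next
    case False
    then have "rinner (d j x) (d k y) = rinner (d k (d j x)) y"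
      by (simp add: is_proj_rinner[OF projs_is_proj[OF dA], of k])
    then show ?thesis using False that by (simp add: d_orth_less rinner.zero_left)
  qed
  have "\<exists>u u'. u \<in> A \<and> u' \<in> A \<and> is_adjoint u' u \<and> u' o\<^sub>L u = e \<and> (\<exists>W. u = (d k o\<^sub>L e) o\<^sub>L W)" for k
  proof -
    have "sqrt (\<delta> k) * norm x \<le> norm ((d k o\<^sub>L e) x)" if "e x = x" for x
    proof -
      have "(sqrt (\<delta> k) * norm x)\<^sup>2 \<le> (norm (d k x))\<^sup>2"
        using \<delta>(2)[of k x] \<delta>(1)[of k] that efix
        by (simp add: d_def power_mult_distrib less_imp_le)
      then show ?thesis using that by (auto intro: power2_le_imp_le)
    qed
    moreover have "(d k o\<^sub>L e) o\<^sub>L e = d k o\<^sub>L e" by (rule blinfun_eqI) (simp add: is_proj_idem[OF ep])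
    moreover have "d k o\<^sub>L e \<in> A" by (intro A_compose projs_A dA e)
    ultimately show ?thesis
      using polar_decomposition[of "d k o\<^sub>L e" e "sqrt (\<delta> k)"] e \<delta>(1)[of k]
      by (metis real_sqrt_gt_0_iff)
  qed
  then obtain u u' W where u: "\<And>k. u k \<in> A" "\<And>k. u' k \<in> A" "\<And>k. is_adjoint (u' k) (u k)"
    "\<And>k. u' k o\<^sub>L u k = e" "\<And>k. u k = (d k o\<^sub>L e) o\<^sub>L W k" by metis
  have "u' j (u k x) = (if j = k then e x else 0)" for j k x
  proof (cases "j = k")
    case True
    then show ?thesis using u(4) by (metis blinfun_apply_blinfun_compose)
  next
    case False
    have "rinner y (u' j (u k x)) = 0" for y
      using d_orth[OF False] u(5) by (simp flip: is_adjoint_rinnerD[OF u(3)])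
    from rinner_right_eq_0_imp[OF this] show ?thesis using False by simp
  qed
  then have "e = 0" by (intro no_infinite_orthogonal_copies[where u = u and u' = u', OF fin u(1-3) e])
  moreover have "e \<xi>' = \<xi>'" using efix \<open>\<And>k. \<rho> k \<xi>' = \<xi>'\<close> by blast
  ultimately show False using \<open>\<xi>' \<noteq> 0\<close> by (simp add: blinfun.zero_left)
qed

text \<open>Let \<open>s\<close> be the limit of the meets. The projection \<open>r - s\<close> has no common vector with any \<open>q n\<close>, although the
  \<open>q n\<close> exhaust it, so it vanishes.\<close>

theorem (in vna) meet_continuous:
  fixes q :: "nat \<Rightarrow> 'h \<Rightarrow>\<^sub>L 'h" and p r :: "'h \<Rightarrow>\<^sub>L 'h"
  assumes fin: "finite_algebra A"
    and q: "\<And>n. q n \<in> projs A" "\<And>n. op_le (q n) (q (Suc n))"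
    and lim: "\<And>x. (\<lambda>n. q n x) \<longlonglongrightarrow> p x"
    and r: "r \<in> projs A" "op_le r p"
  shows "(\<lambda>n. meet r (q n) x) \<longlonglongrightarrow> r x"
proof -
  have p: "p \<in> projs A" by (rule lim_projs(1)[where q = q, OF q(1) lim q(2)])
  have mP: "meet r (q n) \<in> projs A" for n by (rule meet_projs[OF r(1) q(1)])
  have minc: "op_le (meet r (q n)) (meet r (q (Suc n)))" for n
    using q(2)[of n] by (simp add: le_iff mP q(1) meet_fix[OF r(1) q(1)])
  obtain s where s: "s \<in> projs A" "\<And>x. (\<lambda>n. meet r (q n) x) \<longlonglongrightarrow> blinfun_apply s x"
    using incseq_lim_exists[of "\<lambda>n. meet r (q n)", OF mP minc] by blast
  have sle: "op_le s r"
    by (rule lim_projs(3)[where q = "\<lambda>n. meet r (q n)", OF mP s(2) minc r(1)]) (rule meet_le1[OF r(1) q(1)])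
  have sub: "op_le (meet r (q n)) s" for n by (rule lim_projs(2)[where q = "\<lambda>n. meet r (q n)", OF mP s(2) minc])
  have d: "r - s \<in> projs A" by (rule diff_projs[OF r(1) s(1) sle])
  have dfix: "r x = x \<and> s x = 0" if "(r - s) x = x" for x
  proof -
    have "r x = x" using that diff_le[OF r(1) s(1) sle] le_iff[OF r(1) d] by blast
    then show ?thesis using that by (simp add: blinfun.diff_left)
  qed
  have "r - s = 0"
  proof (rule disjoint_from_exhausting_sequence[where q = q, OF fin q d])
    fix n x assume x: "(r - s) x = x" "q n x = x"
    then have "meet r (q n) x = x" using meet_fix[OF r(1) q(1)] dfix by blast
    then have "s x = x" using sub[of n] le_iff[OF s(1) mP] by blast
    then show "x = 0" using dfix[OF x(1)] by simp
  next
    fix x assume "(r - s) x = x"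
    then have "p x = x" using dfix r(2) le_iff[OF p r(1)] by blast
    then show "(\<lambda>n. q n x) \<longlonglongrightarrow> x" using lim[of x] by simp
  qed
  then show ?thesis using s(2) by simp
qed

section \<open>Exhaustion by the projections of an ideal\<close>

lemma is_proj_sup_upper: "is_proj_sup A E p \<Longrightarrow> q \<in> E \<Longrightarrow> op_le q p"
  and is_proj_sup_least: "is_proj_sup A E p \<Longrightarrow> r \<in> projs A \<Longrightarrow> (\<And>q. q \<in> E \<Longrightarrow> op_le q r) \<Longrightarrow> op_le p r"
  by (auto simp: is_proj_sup_def)

lemma countable_finite_exhaustion:
  assumes "countable E"
  obtains F :: "nat \<Rightarrow> 'a set" where "\<And>n. finite (F n)" "\<And>n. F n \<subseteq> E" "\<And>n. F n \<subseteq> F (Suc n)"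
    "filterlim F (finite_subsets_at_top E) sequentially"
proof -
  define F where "F n = {p \<in> E. to_nat_on E p < n}" for n
  have inj: "inj_on (to_nat_on E) E" using assms by (rule inj_on_to_nat_on)
  have fin: "finite (F n)" for n
  proof (rule finite_imageD)
    show "finite (to_nat_on E ` F n)" by (rule finite_subset[of _ "{..<n}"]) (auto simp: F_def)
    show "inj_on (to_nat_on E) (F n)" by (rule inj_on_subset[OF inj]) (auto simp: F_def)
  qed
  have cover: "\<exists>n. \<forall>m\<ge>n. G \<subseteq> F m" if G: "finite G" "G \<subseteq> E" for G
  proof -
    obtain k where "to_nat_on E ` G \<subseteq> {..<k}" using finite_nat_bounded[OF finite_imageI[OF G(1)]] by blast
    then show ?thesis using G(2) by (intro exI[of _ k]) (force simp: F_def)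
  qed
  have "filterlim F (finite_subsets_at_top E) sequentially"
    unfolding filterlim_iff eventually_finite_subsets_at_top eventually_sequentially
  proof (intro allI impI)
    fix P assume "\<exists>X. finite X \<and> X \<subseteq> E \<and> (\<forall>Y. finite Y \<and> X \<subseteq> Y \<and> Y \<subseteq> E \<longrightarrow> P Y)"
    then obtain X where X: "finite X" "X \<subseteq> E" "\<forall>Y. finite Y \<and> X \<subseteq> Y \<and> Y \<subseteq> E \<longrightarrow> P Y"
      by blast
    obtain n where n: "\<forall>m\<ge>n. X \<subseteq> F m" using cover[OF X(1,2)] by blast
    moreover have "F m \<subseteq> E" for m by (auto simp: F_def)
    ultimately have "P (F m)" if "m \<ge> n" for m using X(3) fin n that by simp
    then show "\<exists>N. \<forall>n\<ge>N. P (F n)" by blast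
  qed
  moreover have "F n \<subseteq> E" "F n \<subseteq> F (Suc n)" for n by (auto simp: F_def)
  ultimately show ?thesis using that[of F] fin by blast
qed

context vna
begin

lemma incseq_partial_sums:
  assumes "\<And>n. finite (F n)" "\<And>n. F n \<subseteq> E" "\<And>n. F n \<subseteq> F (Suc n)"
    and "E \<subseteq> projs A" "pairwise (\<lambda>p q. p o\<^sub>L q = 0) E"
  shows "\<Sum>(F n) \<in> projs A" "op_le (\<Sum>(F n)) (\<Sum>(F (Suc n)))"
proof -
  have P: "F n \<subseteq> projs A" "pairwise (\<lambda>p q. p o\<^sub>L q = 0) (F n)" for n
    using assms pairwise_subset by blast+
  note s = sum_projs[OF assms(1) P]
  show "\<Sum>(F n) \<in> projs A" by (rule s(1))
  show "op_le (\<Sum>(F n)) (\<Sum>(F (Suc n)))"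
    by (rule s(3)[OF s(1)]) (use s(2) assms(3) in blast)
qed

lemma ideal_projs: "projection_ideal A M \<Longrightarrow> p \<in> M \<Longrightarrow> p \<in> projs A"
  by (auto simp: projection_ideal_def)

lemma ideal_downward:
  "projection_ideal A M \<Longrightarrow> p \<in> projs A \<Longrightarrow> q \<in> M \<Longrightarrow> op_le p q \<Longrightarrow> p \<in> M"
  by (auto simp: projection_ideal_def)

text \<open>Orthogonal projections have product zero, so the ideal contains their join, which is their sum.\<close>

lemma ideal_sum:
  assumes M: "projection_ideal A M" "0 \<in> M"
    and F: "finite F" "F \<subseteq> M" "pairwise (\<lambda>p q. p o\<^sub>L q = 0) F"
  shows "\<Sum>F \<in> M"
  using F
proof (induction F rule: finite_induct)
  case empty
  then show ?case using M(2) by simp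
next
  case (insert p F)
  have P: "insert p F \<subseteq> projs A" using insert.prems(1) ideal_projs[OF M(1)] by blast
  have F: "F \<subseteq> projs A" "pairwise (\<lambda>p q. p o\<^sub>L q = 0) F"
    using P insert.prems(2) by (auto simp: pairwise_insert)
  have sM: "\<Sum>F \<in> M" using insert F by auto
  have "p o\<^sub>L q = 0" if "q \<in> F" for q
    using that insert.prems(2) insert.hyps(2) by (auto simp: pairwise_insert)
  then have "p o\<^sub>L \<Sum>F = 0" by (simp add: compose.sum_right)
  then have "norm (p o\<^sub>L \<Sum>F) < 1" by simp
  then obtain r where r: "r \<in> M" "is_proj_sup A {p, \<Sum>F} r"
    using M(1) sM insert.prems(1) unfolding projection_ideal_def by blast
  have rP: "r \<in> projs A" using r(1) ideal_projs[OF M(1)] by blast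
  note s = sum_projs[OF finite.insertI[OF insert.hyps(1)] P insert.prems(2)]
  have "op_le (\<Sum>(insert p F)) r"
  proof (rule s(3)[OF rP])
    fix q assume "q \<in> insert p F"
    then consider "q = p" | "q \<in> F" by blast
    then show "op_le q r"
    proof cases
      case 1
      then show ?thesis using is_proj_sup_upper[OF r(2)] by simp
    next
      case 2
      then have "op_le q (\<Sum>F)" by (rule sum_projs(2)[OF insert.hyps(1) F])
      moreover have "op_le (\<Sum>F) r" using is_proj_sup_upper[OF r(2)] by simp
      ultimately show ?thesis using le_trans 2 P rP ideal_projs[OF M(1) sM] by blast
    qed
  qed
  then show ?case by (rule ideal_downward[OF M(1) s(1) r(1)])
qed

lemma maximal_orthogonal_family:
  assumes M: "M \<subseteq> projs A"
  obtains E where "E \<subseteq> M - {0}" "pairwise (\<lambda>p q. p o\<^sub>L q = 0) E"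
    "\<And>m. m \<in> M \<Longrightarrow> (\<And>p. p \<in> E \<Longrightarrow> m o\<^sub>L p = 0) \<Longrightarrow> m = 0"
proof -
  define \<C> where "\<C> = {E. E \<subseteq> M - {0} \<and> pairwise (\<lambda>p q. p o\<^sub>L q = 0) E}"
  have "\<Union>C \<in> \<C>" if C: "subset.chain \<C> C" for C
  proof -
    have "C \<subseteq> \<C>" "chain\<^sub>\<subseteq> C" using C by (auto simp: subset_chain_def chain_subset_def)
    then show ?thesis using pairwise_chain_Union[of C] unfolding \<C>_def by blast
  qed
  then obtain E where E: "E \<in> \<C>" "\<And>X. X \<in> \<C> \<Longrightarrow> E \<subseteq> X \<Longrightarrow> X = E"
    using subset_Zorn'[of \<C>] by blast
  show ?thesis
  proof (rule that)
    show "E \<subseteq> M - {0}" "pairwise (\<lambda>p q. p o\<^sub>L q = 0) E" using E(1) by (auto simp: \<C>_def)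
    fix m assume m: "m \<in> M" "\<And>p. p \<in> E \<Longrightarrow> m o\<^sub>L p = 0"
    show "m = 0"
    proof (rule ccontr)
      assume "m \<noteq> 0"
      have "p o\<^sub>L m = 0" if "p \<in> E" for p
        by (rule orth_sym[OF _ _ m(2)[OF that]]) (use that E(1) M m(1) in \<open>auto simp: \<C>_def\<close>)
      then have "insert m E \<in> \<C>"
        using E(1) m \<open>m \<noteq> 0\<close> by (auto simp: \<C>_def pairwise_insert)
      then have "m \<in> E" using E(2) by blast
      then have "m o\<^sub>L m = 0" by (rule m(2))
      moreover have "m o\<^sub>L m = m" using m(1) M by (auto simp: projs_def)
      ultimately show False using \<open>m \<noteq> 0\<close> by simp
    qed
  qed
qed

text \<open>Take a maximal orthogonal family in \<open>M\<close> with sum \<open>s\<close>; its finite partial sums \<open>q n\<close> lie in \<open>M\<close>. If \<open>s\<close> were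
  not the identity, some element of \<open>M\<close> would not lie below \<open>s\<close>, and cutting it would give a nonzero
  \<open>f\<close> in \<open>M\<close> that is uniformly far from \<open>s\<close>. Then the product of \<open>q n\<close> and \<open>f\<close> has norm less than one, so
  the joins \<open>w n\<close> of \<open>q n\<close> and \<open>f\<close> belong to \<open>M\<close>. They increase to a projection \<open>t\<close> strictly above \<open>s\<close>, and by
  continuity \<open>t - s\<close> has a nonzero meet with some \<open>w n\<close>. That meet lies in \<open>M\<close> and is orthogonal to the family,
  against maximality.\<close>

theorem ideal_exhaustion:
  assumes sep: "separable_space (euclidean :: 'h topology)" and fin: "finite_algebra A"
    and M: "projection_ideal A M" "0 \<in> M"
  obtains q :: "nat \<Rightarrow> 'h \<Rightarrow>\<^sub>L 'h" where "\<And>n. q n \<in> M" "\<And>n. op_le (q n) (q (Suc n))"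
    "\<And>x. (\<lambda>n. q n x) \<longlonglongrightarrow> x"
proof -
  have MP: "M \<subseteq> projs A" using M(1) by (simp add: projection_ideal_def)
  obtain E where E: "E \<subseteq> M - {0}" "pairwise (\<lambda>p q. p o\<^sub>L q = 0) E"
    "\<And>m. m \<in> M \<Longrightarrow> (\<And>p. p \<in> E \<Longrightarrow> m o\<^sub>L p = 0) \<Longrightarrow> m = 0"
    using maximal_orthogonal_family[OF MP] by blast
  have EP: "E \<subseteq> projs A" using E(1) MP by blast
  obtain F where F: "\<And>n. finite (F n)" "\<And>n. F n \<subseteq> E" "\<And>n. F n \<subseteq> F (Suc n)"
    "filterlim F (finite_subsets_at_top E) sequentially"
    using countable_finite_exhaustion[OF orth_family_countable[OF sep EP E(2)]] by blast
  define q where "q n = \<Sum>(F n)" for n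
  have qP: "q n \<in> projs A" and qinc: "op_le (q n) (q (Suc n))" for n
    unfolding q_def by (rule incseq_partial_sums[where F = F, OF F(1-3) EP E(2)])+
  have qM: "q n \<in> M" for n unfolding q_def
    by (rule ideal_sum[OF M F(1)]) (use F(2) E(1) pairwise_subset[OF E(2)] in blast)+
  obtain s where s: "s \<in> projs A" "\<And>x. (\<lambda>n. q n x) \<longlonglongrightarrow> blinfun_apply s x"
    using incseq_lim_exists[of q, OF qP qinc] by blast
  have qs: "op_le (q n) s" for n by (rule lim_projs(2)[where q = q, OF qP s(2) qinc])
  have Es: "op_le p s" if p: "p \<in> E" for p
  proof -
    have "\<forall>\<^sub>F G in finite_subsets_at_top E. p \<in> G"
      unfolding eventually_finite_subsets_at_top using p by (intro exI[of _ "{p}"]) auto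
    then have "\<forall>\<^sub>F n in sequentially. p \<in> F n" using F(4) by (auto simp: filterlim_iff)
    then obtain n where "p \<in> F n" using eventually_happens' sequentially_bot by blast
    then have "op_le p (q n)" unfolding q_def
      by (intro sum_projs(2)[OF F(1)]) (use F(2) EP pairwise_subset[OF E(2)] in blast)+
    then show ?thesis using le_trans[OF _ qP s(1) _ qs] p EP by blast
  qed
  \<comment> \<open>By maximality the complement of \<open>s\<close> contains no nonzero element of \<open>M\<close>.\<close>
  have none: "m = 0" if m: "m \<in> M" "\<And>x. m x = x \<Longrightarrow> s x = 0" for m
  proof (rule E(3)[OF m(1)])
    fix p assume p: "p \<in> E"
    have mP: "m \<in> projs A" using m(1) MP by blast
    show "m o\<^sub>L p = 0"
    proof (rule blinfun_eqI)
      fix x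
      have sp: "s (p x) = p x" using le_absorb[OF s(1) _ Es[OF p]] p EP by blast
      have sm: "s (m y) = 0" for y by (rule m(2)[OF is_proj_idem[OF projs_is_proj[OF mP]]])
      have "rinner (m (p x)) y = 0" for y
      proof -
        have "rinner (m (p x)) y = rinner (s (p x)) (m y)"
          by (simp add: sp is_proj_rinner[OF projs_is_proj[OF mP]])
        also have "\<dots> = 0"
          unfolding is_proj_rinner[OF projs_is_proj[OF s(1)]] sm by (rule rinner.zero_right)
        finally show ?thesis .
      qed
      from rinner_eq_0_imp[OF this] show "(m o\<^sub>L p) x = blinfun_apply 0 x"
        by (simp add: blinfun.zero_left)
    qed
  qed
  have "s = id_blinfun"
  proof (rule ccontr)
    assume "s \<noteq> id_blinfun"
    have "\<not> (\<forall>p\<in>M. op_le p s)"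
    proof
      assume "\<forall>p\<in>M. op_le p s"
      then have "op_le id_blinfun s"
        using M(1) s(1) unfolding projection_ideal_def is_proj_sup_def by blast
      then have "\<forall>x. s x = x" using le_iff[OF s(1) id_projs] by simp
      then show False using \<open>s \<noteq> id_blinfun\<close> by (auto intro!: blinfun_eqI)
    qed
    then obtain p where p: "p \<in> M" "\<not> op_le p s" by blast
    have pP: "p \<in> projs A" using p(1) MP by blast
    obtain x where x: "p x = x" "s x \<noteq> x" using p(2) le_iff[OF s(1) pP] by blast
    have "x \<noteq> 0" using x(2) by (auto simp: blinfun.zero_right)
    define \<delta> where "\<delta> = (norm (x - s x))\<^sup>2 / (2 * (norm x)\<^sup>2)"
    have \<delta>: "\<delta> > 0" "\<delta> * (norm x)\<^sup>2 < (norm (x - s x))\<^sup>2"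
      using x(2) \<open>x \<noteq> 0\<close> by (auto simp: \<delta>_def)
    \<comment> \<open>The part \<open>f\<close> of \<open>p\<close> that is far from \<open>s\<close>, hence uniformly far from every \<open>q n\<close>.\<close>
    obtain e f where ef: "e \<in> projs A" "f \<in> projs A" "op_le e p" "op_le f p" "f = p - e"
      "\<And>x. e x = x \<Longrightarrow> (norm (x - s x))\<^sup>2 \<le> \<delta> * (norm x)\<^sup>2"
      "\<And>x. f x = x \<Longrightarrow> \<delta> * (norm x)\<^sup>2 \<le> (norm (x - s x))\<^sup>2"
      by (rule angle_cut[OF s(1) pP, where \<delta> = \<delta>]) (rule that)
    note fp = projs_is_proj[OF ef(2)]
    have "f \<noteq> 0"
    proof
      assume "f = 0"
      then have "e x = x" using ef(5) x(1) by simp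
      then show False using ef(6)[of x] \<delta>(2) by simp
    qed
    have fM: "f \<in> M" by (rule ideal_downward[OF M(1) ef(2) p(1) ef(4)])
    have "norm (q n o\<^sub>L f) < 1" for n
    proof -
      have "norm (q n o\<^sub>L f) \<le> sqrt (max 0 (1 - \<delta>))"
      proof (rule norm_blinfun_bound)
        fix y
        have "(norm (q n (f y)))\<^sup>2 \<le> (norm (s (f y)))\<^sup>2"
          using le_norm[OF s(1) qP qs] by simp
        also have "\<dots> \<le> (1 - \<delta>) * (norm (f y))\<^sup>2"
          using ef(7)[OF is_proj_idem[OF fp], of y] is_proj_pythagoras[OF projs_is_proj[OF s(1)], of "f y"]
          by (simp add: left_diff_distrib)
        also have "\<dots> \<le> max 0 (1 - \<delta>) * (norm (f y))\<^sup>2" by (intro mult_right_mono) auto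
        also have "\<dots> \<le> max 0 (1 - \<delta>) * (norm y)\<^sup>2"
          using is_proj_norm_le[OF fp] by (intro mult_left_mono power_mono) auto
        also have "\<dots> = (sqrt (max 0 (1 - \<delta>)) * norm y)\<^sup>2" by (simp add: power_mult_distrib)
        finally show "norm ((q n o\<^sub>L f) y) \<le> sqrt (max 0 (1 - \<delta>)) * norm y"
          unfolding blinfun_apply_blinfun_compose by (rule power2_le_imp_le) simp
      qed simp
      also have "\<dots> < 1" using \<delta>(1) by (simp add: real_sqrt_lt_1_iff)
      finally show ?thesis .
    qed
    then have "\<exists>w\<in>M. is_proj_sup A {q n, f} w" for n
      using M(1) qM fM unfolding projection_ideal_def by blast
    then obtain w where w: "\<And>n. w n \<in> M" "\<And>n. is_proj_sup A {q n, f} (w n)" by metis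
    have wP: "w n \<in> projs A" for n using w(1) MP by blast
    have qw: "op_le (q n) (w n)" and fw: "op_le f (w n)" for n
      using is_proj_sup_upper[OF w(2)] by auto
    have winc: "op_le (w n) (w (Suc n))" for n
    proof (rule is_proj_sup_least[OF w(2) wP])
      fix g assume "g \<in> {q n, f}"
      then show "op_le g (w (Suc n))"
        using fw le_trans[OF qP qP wP qinc qw] by blast
    qed
    obtain t where t: "t \<in> projs A" "\<And>x. (\<lambda>n. w n x) \<longlonglongrightarrow> blinfun_apply t x"
      using incseq_lim_exists[of w, OF wP winc] by blast
    have wt: "op_le (w n) t" for n by (rule lim_projs(2)[where q = w, OF wP t(2) winc])
    have st: "op_le s t"
      by (rule lim_projs(3)[where q = q, OF qP s(2) qinc t(1)]) (rule le_trans[OF qP wP t(1) qw wt])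
    have ft: "op_le f t" by (rule le_trans[OF ef(2) wP t(1) fw wt])
    define u where "u = t - s"
    have u: "u \<in> projs A" "op_le u t"
      unfolding u_def by (rule diff_projs[OF t(1) s(1) st], rule diff_le[OF t(1) s(1) st])
    have us: "s y = 0" if "u y = y" for y
    proof -
      have "t y = y" using that u le_iff[OF t(1) u(1)] by blast
      then show ?thesis using that by (simp add: u_def blinfun.diff_left)
    qed
    have "meet u (w n) = 0" for n
    proof (rule none)
      show "meet u (w n) \<in> M"
        by (rule ideal_downward[OF M(1) meet_projs[OF u(1) wP] w(1) meet_le2[OF u(1) wP]])
      show "s y = 0" if "meet u (w n) y = y" for y
        using that us meet_fix[OF u(1) wP] by blast
    qed
    moreover have "(\<lambda>n. meet u (w n) y) \<longlonglongrightarrow> u y" for y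
      by (rule meet_continuous[where q = w, OF fin wP winc t(2) u])
    ultimately have "u y = 0" for y
      using LIMSEQ_unique[OF _ tendsto_const] by (simp add: blinfun.zero_left) blast
    then have "t y = s y" for y by (simp add: u_def blinfun.diff_left)
    then have fs: "s y = y" if "f y = y" for y using that ft le_iff[OF t(1) ef(2)] by simp
    have "f y = 0" for y
    proof -
      have "\<delta> * (norm (f y))\<^sup>2 \<le> 0"
        using ef(7)[OF is_proj_idem[OF fp], of y] fs[OF is_proj_idem[OF fp], of y] by simp
      then show ?thesis using \<delta>(1) by (simp add: mult_le_0_iff)
    qed
    then show False using \<open>f \<noteq> 0\<close> by (auto intro!: blinfun_eqI simp: blinfun.zero_left)
  qed
  then have "(\<lambda>n. q n x) \<longlonglongrightarrow> x" for x using s(2)[of x] by simp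
  then show ?thesis using that qM qinc by blast
qed

text \<open>Meets with an exhausting sequence of \<open>M\<close> converge to \<open>r\<close>, so they are not all zero.\<close>

corollary ideal_dense:
  assumes sep: "separable_space (euclidean :: 'h topology)" and fin: "finite_algebra A"
    and M: "projection_ideal A M" "0 \<in> M"
    and r: "r \<in> projs A" "r \<noteq> 0"
  obtains m where "m \<in> M" "m \<noteq> 0" "op_le m r"
proof -
  obtain q :: "nat \<Rightarrow> 'h \<Rightarrow>\<^sub>L 'h" where q: "\<And>n. q n \<in> M" "\<And>n. op_le (q n) (q (Suc n))"
    "\<And>x. (\<lambda>n. q n x) \<longlonglongrightarrow> x"
    using ideal_exhaustion[OF sep fin M] by blast
  have qP: "q n \<in> projs A" for n using q(1) ideal_projs[OF M(1)] by blast
  have lim: "(\<lambda>n. meet r (q n) x) \<longlonglongrightarrow> r x" for x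
    by (rule meet_continuous[where q = q and p = id_blinfun, OF fin qP q(2)]) (simp_all add: q(3) r le_iff id_projs)
  have "\<exists>n. meet r (q n) \<noteq> 0"
  proof (rule ccontr)
    assume "\<not> ?thesis"
    then have "r x = 0" for x
      using lim[of x] LIMSEQ_unique[OF _ tendsto_const] by (simp add: blinfun.zero_left) blast
    then show False using r(2) by (auto intro!: blinfun_eqI simp: blinfun.zero_left)
  qed
  then obtain n where "meet r (q n) \<noteq> 0" by blast
  moreover have "meet r (q n) \<in> M"
    by (rule ideal_downward[OF M(1) meet_projs[OF r(1) qP] q(1) meet_le2[OF r(1) qP]])
  ultimately show ?thesis using that meet_le1[OF r(1) qP] by blast
qed

corollary ideal_is_proj_sup_below:
  assumes sep: "separable_space (euclidean :: 'h topology)" and fin: "finite_algebra A"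
    and M: "projection_ideal A M" "0 \<in> M"
    and s: "s \<in> projs A"
  shows "is_proj_sup A (below M s) s"
  unfolding is_proj_sup_def
proof (intro conjI ballI impI s)
  show "op_le q s" if "q \<in> below M s" for q using that by (simp add: below_def)
  fix r assume r: "r \<in> projs A" "\<forall>q\<in>below M s. op_le q r"
  note m = meet_projs[OF s r(1)] and m1 = meet_le1[OF s r(1)] and m2 = meet_le2[OF s r(1)]
  have d: "s - meet s r \<in> projs A" by (rule diff_projs[OF s m m1])
  have dle: "op_le (s - meet s r) s" by (rule diff_le[OF s m m1])
  have "s - meet s r = 0"
  proof (rule ccontr)
    assume "s - meet s r \<noteq> 0"
    then obtain k where k: "k \<in> M" "k \<noteq> 0" "op_le k (s - meet s r)"
      using ideal_dense[OF sep fin M d] by blast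
    have kP: "k \<in> projs A" using k(1) ideal_projs[OF M(1)] by blast
    have ks: "op_le k s" by (rule le_trans[OF kP d s k(3) dle])
    then have kr: "op_le k r" using r(2) k(1) by (simp add: below_def)
    have "k x = 0" for x
    proof -
      have kk: "k (k x) = k x" by (rule is_proj_idem[OF projs_is_proj[OF kP]])
      then have "s (k x) = k x" "r (k x) = k x" "(s - meet s r) (k x) = k x"
        using ks kr k(3) le_iff[OF s kP] le_iff[OF r(1) kP] le_iff[OF d kP] by blast+
      moreover from this have "meet s r (k x) = k x" using meet_fix[OF s r(1)] by blast
      ultimately show ?thesis by (simp add: blinfun.diff_left)
    qed
    then show False using k(2) by (auto intro!: blinfun_eqI simp: blinfun.zero_left)
  qed
  then have "s = meet s r" by simp
  then show "op_le s r" using m2 by simp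
qed

section \<open>Measures on ideals\<close>

lemma ennreal_sum_le_infsum:
  fixes f :: "'a \<Rightarrow> ennreal"
  assumes "finite F" "F \<subseteq> E"
  shows "sum f F \<le> infsum f E"
proof -
  have "infsum f E = (SUP G\<in>{G. finite G \<and> G \<subseteq> E}. sum f G)" by (rule nonneg_infsum_complete) simp
  then show ?thesis using assms by (auto intro: SUP_upper)
qed

lemma proj_measureD:
  "proj_measure M \<mu> \<Longrightarrow> e \<in> M \<Longrightarrow> E \<subseteq> M \<Longrightarrow> pairwise (\<lambda>p q. p o\<^sub>L q = 0) E \<Longrightarrow>
    (\<And>x. ((\<lambda>p. blinfun_apply p x) has_sum blinfun_apply e x) E) \<Longrightarrow> \<mu> e = (\<Sum>\<^sub>\<infinity>p\<in>E. \<mu> p)"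
  by (simp add: proj_measure_def)

lemma proj_measure_finite_sum:
  assumes "proj_measure M \<mu>" "finite F" "F \<subseteq> M" "pairwise (\<lambda>p q. p o\<^sub>L q = 0) F" "\<Sum>F \<in> M"
  shows "\<mu> (\<Sum>F) = (\<Sum>p\<in>F. \<mu> p)"
  using proj_measureD[OF assms(1,5,3,4)] assms(2) by (simp add: has_sum_finiteI blinfun.sum_left)

lemma proj_measure_0: "proj_measure M \<mu> \<Longrightarrow> 0 \<in> M \<Longrightarrow> \<mu> 0 = 0"
  using proj_measure_finite_sum[of M \<mu> "{}"] by simp

lemma proj_measure_mono:
  assumes M: "projection_ideal A M" "0 \<in> M" and \<mu>: "proj_measure M \<mu>"
    and pq: "p \<in> M" "q \<in> M" "op_le p q"
  shows "\<mu> p \<le> \<mu> q"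
proof (cases "p = 0")
  case False
  have P: "p \<in> projs A" "q \<in> projs A" using pq ideal_projs[OF M(1)] by auto
  have d: "q - p \<in> projs A" by (rule diff_projs[OF P(2,1) pq(3)])
  have dM: "q - p \<in> M" by (rule ideal_downward[OF M(1) d pq(2) diff_le[OF P(2,1) pq(3)]])
  have "p o\<^sub>L (q - p) = 0"
    by (rule blinfun_eqI)
      (simp add: blinfun.bilinear_simps le_absorb'[OF P(2,1) pq(3)] is_proj_idem[OF projs_is_proj[OF P(1)]])
  moreover from this have "(q - p) o\<^sub>L p = 0" by (rule orth_sym[OF P(1) d])
  moreover have "p \<noteq> q - p"
  proof
    assume "p = q - p"
    then have "p o\<^sub>L p = 0" using \<open>p o\<^sub>L (q - p) = 0\<close> by simp
    then show False using P(1) False by (simp add: projs_def)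
  qed
  ultimately have "\<mu> q = \<mu> p + \<mu> (q - p)"
    using proj_measure_finite_sum[OF \<mu>, of "{p, q - p}"] pq(1,2) dM by (simp add: pairwise_insert)
  then show ?thesis by simp
qed (use proj_measure_0[OF \<mu> M(2)] in simp)

text \<open>The differences of successive terms form an orthogonal family with sum \<open>e\<close>. Only the zero
  projection can occur among them more than once, so passing from the sequence to its range
  changes no sum.\<close>

lemma proj_measure_bound_limit:
  fixes q :: "nat \<Rightarrow> 'h \<Rightarrow>\<^sub>L 'h"
  assumes M: "projection_ideal A M" and \<mu>: "proj_measure M \<mu>"
    and q: "\<And>n. q n \<in> M" "\<And>n. op_le (q n) (q (Suc n))"
    and e: "e \<in> M" "\<And>x. (\<lambda>n. q n x) \<longlonglongrightarrow> blinfun_apply e x"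
    and bound: "\<And>n. \<mu> (q n) \<le> c"
  shows "\<mu> e \<le> c"
proof -
  have qP: "q n \<in> projs A" for n using q(1) ideal_projs[OF M] by blast
  have eP: "e \<in> projs A" using e(1) ideal_projs[OF M] by blast
  define D where "D n = (case n of 0 \<Rightarrow> q 0 | Suc m \<Rightarrow> q (Suc m) - q m)" for n
  have D: "D 0 = q 0" "D (Suc m) = q (Suc m) - q m" for m by (simp_all add: D_def)
  have DP: "D n \<in> projs A" and Dle: "op_le (D n) (q n)" for n
    by (cases n, simp_all add: D qP le_refl diff_projs diff_le q(2))+
  have DM: "D n \<in> M" for n by (rule ideal_downward[OF M DP q(1) Dle])
  have "D n o\<^sub>L D m = 0" if "m < n" for m n
  proof -
    obtain k where n: "n = Suc k" "m \<le> k" using \<open>m < n\<close> by (cases n) auto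
    show ?thesis
    proof (rule blinfun_eqI)
      fix x
      have "op_le (D m) (q k)"
        by (rule le_trans[OF DP qP qP Dle incseq_le[of q, OF qP q(2) n(2)]])
      moreover from this have "op_le (D m) (q n)" using le_trans[OF DP qP qP _ q(2)] n(1) by blast
      ultimately have "q k (D m x) = D m x" "q n (D m x) = D m x" using le_absorb[OF qP DP] by blast+
      then show "(D n o\<^sub>L D m) x = blinfun_apply 0 x"
        unfolding n(1) D by (simp add: blinfun.diff_left blinfun.zero_left)
    qed
  qed
  then have orth: "D n o\<^sub>L D m = 0" if "m \<noteq> n" for m n
    using that orth_sym[OF DP DP] by (cases "m < n") auto
  have rep: "D m = 0" if "m \<noteq> n" "D m = D n" for m n
    using orth[OF that(1)] that(2) DP[of m] by (simp add: projs_def)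
  have partial: "(\<Sum>n\<le>N. D n) = q N" for N by (induction N) (simp_all add: D)
  have partial_set: "\<Sum>(D ` {..N}) = q N" for N
    using sum.reindex_nontrivial[of "{..N}" D "\<lambda>p. p"] rep partial by simp
  define E where "E = range D"
  have E: "E \<subseteq> M" "pairwise (\<lambda>p q. p o\<^sub>L q = 0) E" "E \<subseteq> projs A"
    using DM DP orth by (auto simp: E_def pairwise_def) metis
  have "\<mu> e = (\<Sum>\<^sub>\<infinity>p\<in>E. \<mu> p)"
  proof (rule proj_measureD[OF \<mu> e(1) E(1,2)])
    fix x
    show "((\<lambda>p. blinfun_apply p x) has_sum e x) E"
    proof (rule orth_has_sum[OF E(3,2) eP])
      show "op_le p e" if "p \<in> E" for p
        using that le_trans[OF DP qP eP Dle lim_projs(2)[where q = q, OF qP e(2) q(2)]] by (auto simp: E_def)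
      fix \<epsilon> :: real assume "\<epsilon> > 0"
      then obtain N where "norm (q N x - e x) < \<epsilon>" using LIMSEQ_D[OF e(2)] by blast
      then have "norm (e x - \<Sum>(D ` {..N}) x) < \<epsilon>" by (simp only: partial_set norm_minus_commute)
      then show "\<exists>F. finite F \<and> F \<subseteq> E \<and> norm (e x - \<Sum>F x) < \<epsilon>"
        by (intro exI[of _ "D ` {..N}"]) (auto simp: E_def)
    qed
  qed
  also have "\<dots> \<le> c"
  proof (rule infsum_le_finite_sums)
    show "\<mu> summable_on E" by (rule nonneg_summable_on_complete) simp
    fix G assume G: "finite G" "G \<subseteq> E"
    then obtain I where I: "finite I" "G = D ` I" unfolding E_def by (meson finite_subset_image)
    obtain N where "I \<subseteq> {..N}" using finite_nat_iff_bounded_le I(1) by blast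
    then have "sum \<mu> G \<le> sum \<mu> (D ` {..N})" unfolding I(2) by (intro sum_mono2) auto
    also have "\<dots> = \<mu> (\<Sum>(D ` {..N}))"
      by (rule proj_measure_finite_sum[OF \<mu>, symmetric])
        (use DM q(1) partial_set pairwise_subset[OF E(2), of "D ` {..N}"] in \<open>auto simp: E_def\<close>)
    also have "\<dots> \<le> c" unfolding partial_set by (rule bound)
    finally show "sum \<mu> G \<le> c" .
  qed
  finally show ?thesis .
qed

text \<open>If \<open>M\<close> were empty then zero would be hereditary of finite measure, hence in \<open>M\<close> after all.\<close>

lemma closed_measure_zero_in_ideal:
  assumes M: "projection_ideal A M" and \<mu>: "closed_proj_measure A M \<mu>"
  shows "0 \<in> M"
proof (cases "M = {}")
  case False
  then obtain m where "m \<in> M" by blast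
  moreover have "op_le 0 m"
    using le_iff[OF ideal_projs[OF M \<open>m \<in> M\<close>] zero_projs]
    by (metis blinfun.zero_left blinfun.zero_right)
  ultimately show ?thesis using ideal_downward[OF M zero_projs] by blast
next
  case True
  have zero: "q = 0" if "q \<in> projs A" "op_le q 0" for q
  proof (rule blinfun_eqI)
    show "q x = blinfun_apply 0 x" for x
      using le_absorb[OF zero_projs that] by (metis blinfun.zero_left)
  qed
  have "op_le 0 r" if "r \<in> projs A" for r
    unfolding le_iff[OF that zero_projs] by (metis blinfun.zero_left blinfun.zero_right)
  then have "hereditary_finite_measure_proj A M \<mu> 0"
    using zero zero_projs True
    by (auto simp: hereditary_finite_measure_proj_def finite_measure_proj_def is_proj_sup_def
        below_def bot_ennreal)
  then show ?thesis using \<mu> zero_projs by (auto simp: closed_proj_measure_def)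
qed

text \<open>The partial sums \<open>q n\<close> increase to \<open>e\<close> and have measure at most \<open>C\<close>. For \<open>k\<close> in \<open>M\<close> below \<open>e\<close>, the meets of
  \<open>k\<close> with \<open>q n\<close> also have measure at most \<open>C\<close>, and by continuity of the lattice they increase to \<open>k\<close>; so
  \<open>\<mu> k \<le> C\<close>. Thus \<open>e\<close> is hereditary of finite measure and closedness applies.\<close>

lemma closed_measure_sum_mem:
  assumes sep: "separable_space (euclidean :: 'h topology)" and fin: "finite_algebra A"
    and M: "projection_ideal A M" and \<mu>: "closed_proj_measure A M \<mu>"
    and e: "e \<in> projs A" and E: "E \<subseteq> M" "pairwise (\<lambda>p q. p o\<^sub>L q = 0) E"
    and sum: "\<And>x. ((\<lambda>p. blinfun_apply p x) has_sum e x) E"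
    and c: "(\<Sum>\<^sub>\<infinity>p\<in>E. \<mu> p) < \<infinity>"
  shows "e \<in> M"
proof -
  have M0: "0 \<in> M" by (rule closed_measure_zero_in_ideal[OF M \<mu>])
  have pm: "proj_measure M \<mu>" using \<mu> by (simp add: closed_proj_measure_def finite_proj_measure_def)
  have EP: "E \<subseteq> projs A" using E(1) ideal_projs[OF M] by blast
  obtain F where F: "\<And>n. finite (F n)" "\<And>n. F n \<subseteq> E" "\<And>n. F n \<subseteq> F (Suc n)"
    "filterlim F (finite_subsets_at_top E) sequentially"
    using countable_finite_exhaustion[OF orth_family_countable[OF sep EP E(2)]] by blast
  define q where "q n = \<Sum>(F n)" for n
  have qP: "q n \<in> projs A" and qinc: "op_le (q n) (q (Suc n))" for n
    unfolding q_def by (rule incseq_partial_sums[where F = F, OF F(1-3) EP E(2)])+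
  have FM: "F n \<subseteq> M" "pairwise (\<lambda>p q. p o\<^sub>L q = 0) (F n)" for n
    using F(2) E(1) pairwise_subset[OF E(2)] by blast+
  have qM: "q n \<in> M" for n unfolding q_def by (rule ideal_sum[OF M M0 F(1) FM])
  have lim: "(\<lambda>n. q n x) \<longlonglongrightarrow> e x" for x
    using filterlim_compose[OF sum[of x, unfolded has_sum_def] F(4)]
    by (simp add: q_def blinfun.sum_left)
  define C where "C = (\<Sum>\<^sub>\<infinity>p\<in>E. \<mu> p)"
  have qC: "\<mu> (q n) \<le> C" for n
  proof -
    have "\<mu> (q n) = sum \<mu> (F n)" unfolding q_def
      by (rule proj_measure_finite_sum[OF pm F(1) FM qM[unfolded q_def]])
    also have "\<dots> \<le> C" unfolding C_def
      by (rule ennreal_sum_le_infsum[OF F(1,2)])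
    finally show ?thesis .
  qed
  have bound: "\<mu> k \<le> C" if k: "k \<in> M" "op_le k e" for k
  proof -
    have kP: "k \<in> projs A" using k(1) ideal_projs[OF M] by blast
    have mP: "meet k (q n) \<in> projs A" for n by (rule meet_projs[OF kP qP])
    have mM: "meet k (q n) \<in> M" for n
      by (rule ideal_downward[OF M mP qM meet_le2[OF kP qP]])
    show ?thesis
    proof (rule proj_measure_bound_limit[where q = "\<lambda>n. meet k (q n)", OF M pm mM _ k(1)])
      show "op_le (meet k (q n)) (meet k (q (Suc n)))" for n
        using qinc[of n] by (simp add: le_iff mP qP meet_fix[OF kP qP])
      show "(\<lambda>n. meet k (q n) x) \<longlonglongrightarrow> k x" for x
        by (rule meet_continuous[where q = q, OF fin qP qinc lim kP k(2)])
      show "\<mu> (meet k (q n)) \<le> C" for n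
        using proj_measure_mono[OF M M0 pm mM qM meet_le2[OF kP qP]] qC by (rule order_trans)
    qed
  qed
  have "hereditary_finite_measure_proj A M \<mu> e"
    unfolding hereditary_finite_measure_proj_def
  proof (intro conjI ballI impI e)
    fix s assume s: "s \<in> projs A" "op_le s e"
    have "\<mu> k \<le> C" if "k \<in> below M s" for k
      using that bound le_trans[OF ideal_projs[OF M] s(1) e _ s(2)] by (auto simp: below_def)
    then have "(SUP k\<in>below M s. \<mu> k) \<le> C" by (rule SUP_least)
    also have "\<dots> < \<infinity>" using c by (simp add: C_def)
    finally show "finite_measure_proj A M \<mu> s"
      using s(1) ideal_is_proj_sup_below[OF sep fin M M0 s(1)] by (simp add: finite_measure_proj_def)
  qed
  then show ?thesis using \<mu> e by (auto simp: closed_proj_measure_def)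
qed

lemma has_sum_proj_upper:
  assumes E: "E \<subseteq> projs A" "pairwise (\<lambda>p q. p o\<^sub>L q = 0) E" and e: "e \<in> projs A"
    and sum: "\<And>x. ((\<lambda>p. blinfun_apply p x) has_sum e x) E"
    and p: "p \<in> E"
  shows "op_le p e"
proof -
  have pP: "p \<in> projs A" using p E by blast
  show ?thesis
    unfolding le_iff[OF e pP]
  proof (intro allI impI)
    fix x assume x: "p x = x"
    have "q x = 0" if "q \<in> E - {p}" for q
    proof -
      have "q (p x) = 0" using that p E by (intro orth_commute(1)) (auto simp: pairwise_def)
      then show ?thesis by (simp add: x)
    qed
    then have "((\<lambda>p. blinfun_apply p x) has_sum x) {p} \<longleftrightarrow> ((\<lambda>p. blinfun_apply p x) has_sum x) E"
      using p by (intro has_sum_cong_neutral) auto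
    moreover have "((\<lambda>p. blinfun_apply p x) has_sum x) {p}" using x by (intro has_sum_finiteI) auto
    ultimately show "e x = x" using sum[of x] has_sum_unique by blast
  qed
qed

end

theorem theorem3:
  fixes A M :: "('h::complex_hilbert \<Rightarrow>\<^sub>L 'h) set"
    and \<mu> :: "('h \<Rightarrow>\<^sub>L 'h) \<Rightarrow> ennreal"
  assumes "separable_space (euclidean :: 'h topology)"
    and "von_neumann_algebra A"
    and "finite_algebra A"
    and "\<not> has_type_I_summand A 2"
    and "projection_ideal A M"
    and "closed_proj_measure A M \<mu>"
  shows "\<exists>\<mu>\<^sub>1. sigma_finite_proj_measure A (projs A) \<mu>\<^sub>1 \<and> (\<forall>p\<in>M. \<mu>\<^sub>1 p = \<mu> p)"
proof -
  interpret vna A by unfold_locales (rule assms(2))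
  note sep = assms(1) and fin = assms(3) and M = assms(5) and closed = assms(6)
  have M0: "0 \<in> M" by (rule closed_measure_zero_in_ideal[OF M closed])
  have \<mu>: "proj_measure M \<mu>" and finite: "\<And>p. p \<in> M \<Longrightarrow> \<mu> p < \<infinity>"
    using closed by (auto simp: closed_proj_measure_def finite_proj_measure_def)
  define \<nu> where "\<nu> p = (if p \<in> M then \<mu> p else \<infinity>)" for p
  have "proj_measure (projs A) \<nu>"
    unfolding proj_measure_def
  proof (intro ballI allI impI, elim conjE)
    fix e E assume e: "e \<in> projs A" and E: "E \<subseteq> projs A" "pairwise (\<lambda>p q. p o\<^sub>L q = 0) E"
      and sum: "\<forall>x. ((\<lambda>p. blinfun_apply p x) has_sum blinfun_apply e x) E"
    show "\<nu> e = (\<Sum>\<^sub>\<infinity>p\<in>E. \<nu> p)"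
    proof (cases "e \<in> M")
      case True
      have "E \<subseteq> M"
        using ideal_downward[OF M _ True has_sum_proj_upper[OF E e]] sum E(1) by blast
      then have "\<mu> e = (\<Sum>\<^sub>\<infinity>p\<in>E. \<mu> p)" using proj_measureD[OF \<mu> True _ E(2)] sum by blast
      also have "\<dots> = (\<Sum>\<^sub>\<infinity>p\<in>E. \<nu> p)" using \<open>E \<subseteq> M\<close> by (intro infsum_cong) (auto simp: \<nu>_def)
      finally show ?thesis using True by (simp add: \<nu>_def)
    next
      case False
      have "(\<Sum>\<^sub>\<infinity>p\<in>E. \<nu> p) = \<infinity>"
      proof (cases "E \<subseteq> M")
        case True
        then have "\<not> (\<Sum>\<^sub>\<infinity>p\<in>E. \<mu> p) < \<infinity>"
          using closed_measure_sum_mem[OF sep fin M closed e True E(2)] sum False by blast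
        moreover have "(\<Sum>\<^sub>\<infinity>p\<in>E. \<nu> p) = (\<Sum>\<^sub>\<infinity>p\<in>E. \<mu> p)"
          using True by (intro infsum_cong) (auto simp: \<nu>_def)
        ultimately show ?thesis by (simp add: not_less top_unique)
      next
        case False
        then obtain p where p: "p \<in> E" "p \<notin> M" by blast
        have "sum \<nu> {p} \<le> (\<Sum>\<^sub>\<infinity>p\<in>E. \<nu> p)"
          by (rule ennreal_sum_le_infsum) (use p in auto)
        then show ?thesis using p(2) by (simp add: \<nu>_def top_unique)
      qed
      then show ?thesis using False by (simp add: \<nu>_def)
    qed
  qed
  moreover obtain q :: "nat \<Rightarrow> 'h \<Rightarrow>\<^sub>L 'h" where q: "\<And>n. q n \<in> M" "\<And>n. op_le (q n) (q (Suc n))"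
    "\<And>x. (\<lambda>n. q n x) \<longlonglongrightarrow> x"
    using ideal_exhaustion[OF sep fin M M0] by blast
  have qP: "q n \<in> projs A" for n using q(1) ideal_projs[OF M] by blast
  have lim: "(\<lambda>n. q n x) \<longlonglongrightarrow> id_blinfun x" for x using q(3) by simp
  have "is_proj_sup A (range q) id_blinfun"
    unfolding is_proj_sup_def using lim_projs[where q = q, OF qP lim q(2)] by auto
  moreover have "\<nu> (q n) < \<infinity>" for n using finite[OF q(1)] q(1) by (simp add: \<nu>_def)
  ultimately have "sigma_finite_proj_measure A (projs A) \<nu>"
    using qP q(2) by (auto simp: sigma_finite_proj_measure_def intro!: exI[of _ q])
  then show ?thesis by (intro exI[of _ \<nu>]) (simp add: \<nu>_def)
qed

end
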